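(* Let $\Bbbk$ be any field, let $n$ be a positive integer, and let $R = \Bbbk[\mathbb{R}^n_+]$ with graded maximal ideal $\mathfrak{m}$. The open Koszul complex $\mathring{\mathbb{K}}^{\mathbf{x}}_\bullet$ is a flat resolution of $\Bbbk = R/\mathfrak{m}$ over $R$.
   Context: $\mathbb{R}_+$ is the additive monoid of nonnegative real numbers and $\mathbb{R}^n_+ = \prod_{i=1}^n\mathbb{R}_+$. $R = \Bbbk[\mathbb{R}^n_+]$ is the monoid algebra (real-exponent polynomials in $n$ variables), and $\mathfrak{m}$ is the ideal spanned over $\Bbbk$ by all nonunit monomials. $R_1 = \Bbbk[\mathbb{R}_+]$ is the case $n=1$, with graded maximal ideal $\mathfrak{m}_1$ spanned by the monomials $x^a$ with $a>0$; thus $R \cong R_1 \otimes_{\Bbbk}\cdots\otimes_{\Bbbk} R_1$ ($n$ factors). Let $\mathring{\mathbb{K}}^1_\bullet$ be the complex of $R_1$-modules $R_1 \hookleftarrow \mathfrak{m}_1$ given by inclusion, with $R_1$ in homological degree $0$ and $\mathfrak{m}_1$ in degree $1$. The open Koszul complex is $\mathring{\mathbb{K}}^{\mathbf{x}}_\bullet = \bigotimes_{i=1}^n \mathring{\mathbb{K}}^1_\bullet$, the tensor product over $\Bbbk$ of $n$ copies of $\mathring{\mathbb{K}}^1_\bullet$, the $i$th copy being in the variable $x_i$. *)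

theory Defs
  imports "HOL-Algebra.Algebra"
begin

section \<open>Modules over a commutative ring\<close>

text \<open>
  The record \<^type>\<open>module\<close> of HOL-Algebra extends the record of rings. The fields \<open>mult\<close> and \<open>one\<close>
  have no meaning for a module and are left undefined below.
\<close>

definition mod_hom ::
    "('r, 'x) ring_scheme \<Rightarrow> ('r, 'a, 'y) module_scheme \<Rightarrow> ('r, 'b, 'z) module_scheme \<Rightarrow> ('a \<Rightarrow> 'b) set"
  where "mod_hom R M N =
    {f \<in> carrier M \<rightarrow> carrier N.
       (\<forall>x\<in>carrier M. \<forall>y\<in>carrier M. f (x \<oplus>\<^bsub>M\<^esub> y) = f x \<oplus>\<^bsub>N\<^esub> f y) \<and>
       (\<forall>r\<in>carrier R. \<forall>x\<in>carrier M. f (r \<odot>\<^bsub>M\<^esub> x) = r \<odot>\<^bsub>N\<^esub> f x)}"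

text \<open>An ideal \<open>I\<close> of \<open>R\<close>, regarded as an \<open>R\<close>-module; \<open>R\<close> itself is \<open>ideal_module R (carrier R)\<close>.\<close>

definition ideal_module :: "('r, 'x) ring_scheme \<Rightarrow> 'r set \<Rightarrow> ('r, 'r) module"
  where "ideal_module R I =
    \<lparr>carrier = I, monoid.mult = undefined, one = undefined,
     ring.zero = \<zero>\<^bsub>R\<^esub>, add = add R, smult = monoid.mult R\<rparr>"

definition quot_module :: "('r, 'a, 'x) module_scheme \<Rightarrow> 'a set \<Rightarrow> ('r, 'a set) module"
  where "quot_module M N =
    \<lparr>carrier = a_rcosets\<^bsub>M\<^esub> N, monoid.mult = undefined, one = undefined,
     ring.zero = N, add = set_add M,
     smult = (\<lambda>r S. \<Union>x\<in>S. N +>\<^bsub>M\<^esub> (r \<odot>\<^bsub>M\<^esub> x))\<rparr>"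

text \<open>Only used for finite index sets \<open>D\<close>, where direct sum and direct product agree.\<close>

definition finite_direct_sum :: "'i set \<Rightarrow> ('i \<Rightarrow> ('r, 'a, 'x) module_scheme) \<Rightarrow> ('r, 'i \<Rightarrow> 'a) module"
  where "finite_direct_sum D M =
    \<lparr>carrier = (\<Pi>\<^sub>E d\<in>D. carrier (M d)), monoid.mult = undefined, one = undefined,
     ring.zero = (\<lambda>d\<in>D. \<zero>\<^bsub>M d\<^esub>),
     add = (\<lambda>s t. \<lambda>d\<in>D. s d \<oplus>\<^bsub>M d\<^esub> t d),
     smult = (\<lambda>r s. \<lambda>d\<in>D. r \<odot>\<^bsub>M d\<^esub> s d)\<rparr>"


section \<open>Flat modules\<close>

text \<open>
  \<open>M \<otimes>\<^sub>R A\<close> is the free abelian group on \<open>M \<times> A\<close> modulo the usual relations. Its \<open>R\<close>-module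
  structure plays no role in flatness and is not recorded.
\<close>

definition tensor_relations ::
    "('r, 'x) ring_scheme \<Rightarrow> ('r, 'm, 'y) module_scheme \<Rightarrow> ('r, 'a, 'z) module_scheme \<Rightarrow> ('m \<times> 'a \<Rightarrow>\<^sub>0 int) set"
  where "tensor_relations R M A = generate (free_Abelian_group (carrier M \<times> carrier A))
    ({frag_of (x \<oplus>\<^bsub>M\<^esub> y, a) - frag_of (x, a) - frag_of (y, a) | x y a.
        x \<in> carrier M \<and> y \<in> carrier M \<and> a \<in> carrier A} \<union>
     {frag_of (x, a \<oplus>\<^bsub>A\<^esub> b) - frag_of (x, a) - frag_of (x, b) | x a b.
        x \<in> carrier M \<and> a \<in> carrier A \<and> b \<in> carrier A} \<union>
     {frag_of (r \<odot>\<^bsub>M\<^esub> x, a) - frag_of (x, r \<odot>\<^bsub>A\<^esub> a) | r x a.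
        r \<in> carrier R \<and> x \<in> carrier M \<and> a \<in> carrier A})"

definition tensor_group ::
    "('r, 'x) ring_scheme \<Rightarrow> ('r, 'm, 'y) module_scheme \<Rightarrow> ('r, 'a, 'z) module_scheme \<Rightarrow> ('m \<times> 'a \<Rightarrow>\<^sub>0 int) set monoid"
  where "tensor_group R M A =
    free_Abelian_group (carrier M \<times> carrier A) Mod tensor_relations R M A"

text \<open>The homomorphism \<open>id \<otimes> f : M \<otimes>\<^sub>R A \<rightarrow> M \<otimes>\<^sub>R B\<close> induced by \<open>f : A \<rightarrow> B\<close>, on cosets.\<close>

definition tensor_id_map ::
    "('r, 'x) ring_scheme \<Rightarrow> ('r, 'm, 'y) module_scheme \<Rightarrow> ('r, 'b, 'z) module_scheme \<Rightarrow> ('a \<Rightarrow> 'b) \<Rightarrow>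
      ('m \<times> 'a \<Rightarrow>\<^sub>0 int) set \<Rightarrow> ('m \<times> 'b \<Rightarrow>\<^sub>0 int) set"
  where "tensor_id_map R M B f S =
    (\<Union>c\<in>S. tensor_relations R M B #>\<^bsub>free_Abelian_group (carrier M \<times> carrier B)\<^esub>
              frag_extend (\<lambda>(x, a). frag_of (x, f a)) c)"

text \<open>
  HOL cannot quantify over types inside a definition, so the types of the elements of the test
  modules are parameters. A theorem in which these are type variables covers all test modules.
\<close>

definition flat_module ::
    "'a itself \<Rightarrow> 'b itself \<Rightarrow> ('r, 'x) ring_scheme \<Rightarrow> ('r, 'm, 'y) module_scheme \<Rightarrow> bool"
  where "flat_module _ _ R M \<longleftrightarrow> module R M \<and>
    (\<forall>(A :: ('r, 'a) module) (B :: ('r, 'b) module) f.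
       module R A \<and> module R B \<and> f \<in> mod_hom R A B \<and> inj_on f (carrier A) \<longrightarrow>
       inj_on (tensor_id_map R M B f) (carrier (tensor_group R M A)))"


section \<open>Chain complexes and flat resolutions\<close>

text \<open>\<open>boundary C p\<close> maps the chains of degree \<open>p + 1\<close> to those of degree \<open>p\<close>.\<close>

record ('r, 'a) chain_complex =
  chains :: "nat \<Rightarrow> ('r, 'a) module"
  boundary :: "nat \<Rightarrow> 'a \<Rightarrow> 'a"

definition is_chain_complex :: "('r, 'x) ring_scheme \<Rightarrow> ('r, 'a) chain_complex \<Rightarrow> bool"
  where "is_chain_complex R C \<longleftrightarrow>
    (\<forall>p. module R (chains C p)) \<and>
    (\<forall>p. boundary C p \<in> mod_hom R (chains C (Suc p)) (chains C p)) \<and>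
    (\<forall>p. \<forall>x\<in>carrier (chains C (Suc (Suc p))).
       boundary C p (boundary C (Suc p) x) = \<zero>\<^bsub>chains C p\<^esub>)"

text \<open>
  A resolution of \<open>N\<close>: the augmented complex \<open>0 \<leftarrow> N \<leftarrow> C\<^sub>0 \<leftarrow> C\<^sub>1 \<leftarrow> \<dots>\<close> is exact for some augmentation
  \<open>\<epsilon>\<close>, that is, the homology of \<open>C\<close> is \<open>N\<close> in degree 0 and vanishes in positive degrees.
\<close>

definition is_resolution ::
    "('r, 'x) ring_scheme \<Rightarrow> ('r, 'a) chain_complex \<Rightarrow> ('r, 'b, 'y) module_scheme \<Rightarrow> bool"
  where "is_resolution R C N \<longleftrightarrow>
    is_chain_complex R C \<and> module R N \<and>
    (\<exists>\<epsilon>\<in>mod_hom R (chains C 0) N.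
       \<epsilon> ` carrier (chains C 0) = carrier N \<and>
       a_kernel (chains C 0) N \<epsilon> = boundary C 0 ` carrier (chains C 1)) \<and>
    (\<forall>p. a_kernel (chains C (Suc p)) (chains C p) (boundary C p) =
         boundary C (Suc p) ` carrier (chains C (Suc (Suc p))))"

definition is_flat_resolution ::
    "'s itself \<Rightarrow> 't itself \<Rightarrow> ('r, 'x) ring_scheme \<Rightarrow> ('r, 'a) chain_complex \<Rightarrow>
      ('r, 'b, 'y) module_scheme \<Rightarrow> bool"
  where "is_flat_resolution S T R C N \<longleftrightarrow>
    is_resolution R C N \<and> (\<forall>p. flat_module S T R (chains C p))"


section \<open>Real-exponent polynomial rings\<close>

text \<open>
  The monoid algebra of the submonoid \<open>Q\<close> of an additive monoid. The element
  \<open>Poly_Mapping.single a c\<close> is the term \<open>c x\<^sup>a\<close>, and products are convolutions.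
\<close>

definition monoid_algebra :: "'e::comm_monoid_add set \<Rightarrow> ('e \<Rightarrow>\<^sub>0 'k::field) ring"
  where "monoid_algebra Q =
    \<lparr>carrier = {p. Poly_Mapping.keys p \<subseteq> Q}, monoid.mult = (*), one = 1, ring.zero = 0, add = (+)\<rparr>"

definition nonunit_ideal :: "'e::comm_monoid_add set \<Rightarrow> ('e \<Rightarrow>\<^sub>0 'k::field) set"
  where "nonunit_ideal Q =
    {p. Poly_Mapping.keys p \<subseteq> {a \<in> Q. \<not> (\<exists>b\<in>Q. a + b = 0)}}"

text \<open>
  Exponent vectors in \<open>n\<close> variables are finitely supported functions on the naturals that vanish
  outside \<open>{..<n}\<close>, so the variables are numbered from 0. This is \<open>\<real>\<^sub>+\<^sup>n\<close>.
\<close>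

definition orthant :: "nat \<Rightarrow> (nat \<Rightarrow>\<^sub>0 real) set"
  where "orthant n =
    {a. Poly_Mapping.keys a \<subseteq> {..<n} \<and> (\<forall>i. 0 \<le> Poly_Mapping.lookup a i)}"

definition real_poly_ring :: "nat \<Rightarrow> ((nat \<Rightarrow>\<^sub>0 real) \<Rightarrow>\<^sub>0 'k::field) ring"
  where "real_poly_ring n = monoid_algebra (orthant n)"

definition graded_max_ideal :: "nat \<Rightarrow> ((nat \<Rightarrow>\<^sub>0 real) \<Rightarrow>\<^sub>0 'k::field) set"
  where "graded_max_ideal n = nonunit_ideal (orthant n)"

definition real_poly_ring1 :: "(real \<Rightarrow>\<^sub>0 'k::field) ring"
  where "real_poly_ring1 = monoid_algebra {0..}"

definition graded_max_ideal1 :: "(real \<Rightarrow>\<^sub>0 'k::field) set"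
  where "graded_max_ideal1 = {p. Poly_Mapping.keys p \<subseteq> {0<..}}"


section \<open>Tensor products over the ground field\<close>

text \<open>
  For \<open>\<kk>[\<real>\<^sub>+]\<close>-modules \<open>M 0, \<dots>, M (n - 1)\<close> the tensor product \<open>M 0 \<otimes> \<cdots> \<otimes> M (n - 1)\<close> over \<open>\<kk>\<close> is the
  \<open>\<kk>\<close>-vector space with basis the \<open>n\<close>-tuples, modulo the \<open>\<kk>\<close>-span of the multilinearity relations.
  Scalars \<open>c\<close> act on \<open>M i\<close> as constant polynomials \<open>Poly_Mapping.single 0 c\<close>.
  Since \<open>\<kk>[\<real>\<^sub>+\<^sup>n] \<cong> \<kk>[\<real>\<^sub>+] \<otimes> \<cdots> \<otimes> \<kk>[\<real>\<^sub>+]\<close>, it is a \<open>\<kk>[\<real>\<^sub>+\<^sup>n]\<close>-module: the monomial with exponent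
  \<open>a\<close> sends the tuple \<open>m\<close> to the tuple \<open>i \<mapsto> x\<^bsup>a i\<^esup> m i\<close>.
\<close>

inductive_set multilinear_relations ::
    "nat \<Rightarrow> (nat \<Rightarrow> (real \<Rightarrow>\<^sub>0 'k::field, 'm) module) \<Rightarrow> ((nat \<Rightarrow> 'm) \<Rightarrow>\<^sub>0 'k) set"
  for n :: nat and M :: "nat \<Rightarrow> (real \<Rightarrow>\<^sub>0 'k::field, 'm) module"
  where
    zero: "0 \<in> multilinear_relations n M"
  | plus: "s \<in> multilinear_relations n M \<Longrightarrow> t \<in> multilinear_relations n M \<Longrightarrow>
      s + t \<in> multilinear_relations n M"
  | scale: "s \<in> multilinear_relations n M \<Longrightarrow>
      Poly_Mapping.map (\<lambda>b. c * b) s \<in> multilinear_relations n M"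
  | additive: "m \<in> (\<Pi>\<^sub>E j\<in>{..<n}. carrier (M j)) \<Longrightarrow> i < n \<Longrightarrow>
      x \<in> carrier (M i) \<Longrightarrow> y \<in> carrier (M i) \<Longrightarrow>
      Poly_Mapping.single (m(i := x \<oplus>\<^bsub>M i\<^esub> y)) 1
        - Poly_Mapping.single (m(i := x)) 1 - Poly_Mapping.single (m(i := y)) 1
      \<in> multilinear_relations n M"
  | homogeneous: "m \<in> (\<Pi>\<^sub>E j\<in>{..<n}. carrier (M j)) \<Longrightarrow> i < n \<Longrightarrow> x \<in> carrier (M i) \<Longrightarrow>
      Poly_Mapping.single (m(i := Poly_Mapping.single 0 c \<odot>\<^bsub>M i\<^esub> x)) 1
        - Poly_Mapping.single (m(i := x)) c
      \<in> multilinear_relations n M"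

definition tuple_module ::
    "nat \<Rightarrow> (nat \<Rightarrow> (real \<Rightarrow>\<^sub>0 'k::field, 'm) module) \<Rightarrow>
      ((nat \<Rightarrow>\<^sub>0 real) \<Rightarrow>\<^sub>0 'k, (nat \<Rightarrow> 'm) \<Rightarrow>\<^sub>0 'k) module"
  where "tuple_module n M =
    \<lparr>carrier = {t. Poly_Mapping.keys t \<subseteq> (\<Pi>\<^sub>E i\<in>{..<n}. carrier (M i))},
     monoid.mult = undefined, one = undefined, ring.zero = 0, add = (+),
     smult = (\<lambda>r t. \<Sum>a\<in>Poly_Mapping.keys r. \<Sum>m\<in>Poly_Mapping.keys t.
       Poly_Mapping.single
         (\<lambda>i\<in>{..<n}. Poly_Mapping.single (Poly_Mapping.lookup a i) 1 \<odot>\<^bsub>M i\<^esub> m i)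
         (Poly_Mapping.lookup r a * Poly_Mapping.lookup t m))\<rparr>"

definition field_tensor ::
    "nat \<Rightarrow> (nat \<Rightarrow> (real \<Rightarrow>\<^sub>0 'k::field, 'm) module) \<Rightarrow>
      ((nat \<Rightarrow>\<^sub>0 real) \<Rightarrow>\<^sub>0 'k, ((nat \<Rightarrow> 'm) \<Rightarrow>\<^sub>0 'k) set) module"
  where "field_tensor n M = quot_module (tuple_module n M) (multilinear_relations n M)"

text \<open>The map \<open>f 0 \<otimes> \<cdots> \<otimes> f (n - 1)\<close> into \<open>field_tensor n N\<close>, on cosets.\<close>

definition field_tensor_map ::
    "nat \<Rightarrow> (nat \<Rightarrow> (real \<Rightarrow>\<^sub>0 'k::field, 'm) module) \<Rightarrow> (nat \<Rightarrow> 'm \<Rightarrow> 'm) \<Rightarrow>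
      ((nat \<Rightarrow> 'm) \<Rightarrow>\<^sub>0 'k) set \<Rightarrow> ((nat \<Rightarrow> 'm) \<Rightarrow>\<^sub>0 'k) set"
  where "field_tensor_map n N f S =
    (\<Union>t\<in>S. multilinear_relations n N +>\<^bsub>tuple_module n N\<^esub>
       (\<Sum>m\<in>Poly_Mapping.keys t.
          Poly_Mapping.single (\<lambda>i\<in>{..<n}. f i (m i)) (Poly_Mapping.lookup t m)))"

definition multidegrees :: "nat \<Rightarrow> nat \<Rightarrow> (nat \<Rightarrow> nat) set"
  where "multidegrees n p = {d \<in> {..<n} \<rightarrow>\<^sub>E UNIV. (\<Sum>i<n. d i) = p}"

text \<open>
  The tensor product of complexes: in degree \<open>p\<close> it is the direct sum of the
  \<open>C\<^sub>0\<^sub>,\<^sub>d\<^sub>0 \<otimes> C\<^sub>1\<^sub>,\<^sub>d\<^sub>1 \<otimes> \<cdots>\<close> over all \<open>d\<close> with \<open>d\<^sub>0 + d\<^sub>1 + \<cdots> = p\<close>. With the Koszul sign rule the component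
  of the boundary from multidegree \<open>e(i := Suc (e i))\<close> to \<open>e\<close> is
  \<open>(-1)\<close> to the power \<open>e\<^sub>0 + \<cdots> + e\<^bsub>i-1\<^esub>\<close> times \<open>id \<otimes> \<cdots> \<otimes> \<partial> \<otimes> \<cdots> \<otimes> id\<close>, with \<open>\<partial>\<close> in position \<open>i\<close>.
\<close>

definition tensor_complex ::
    "nat \<Rightarrow> (nat \<Rightarrow> (real \<Rightarrow>\<^sub>0 'k::field, 'm) chain_complex) \<Rightarrow>
      ((nat \<Rightarrow>\<^sub>0 real) \<Rightarrow>\<^sub>0 'k, (nat \<Rightarrow> nat) \<Rightarrow> ((nat \<Rightarrow> 'm) \<Rightarrow>\<^sub>0 'k) set) chain_complex"
  where "tensor_complex n C =
    \<lparr>chains = (\<lambda>p. finite_direct_sum (multidegrees n p)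
       (\<lambda>d. field_tensor n (\<lambda>i. chains (C i) (d i)))),
     boundary = (\<lambda>p s. \<lambda>e\<in>multidegrees n p.
       \<Oplus>\<^bsub>field_tensor n (\<lambda>j. chains (C j) (e j))\<^esub>i\<in>{..<n}.
         (-1) ^ (\<Sum>j<i. e j) \<odot>\<^bsub>field_tensor n (\<lambda>j. chains (C j) (e j))\<^esub>
         field_tensor_map n (\<lambda>j. chains (C j) (e j))
           (\<lambda>j. if j = i then boundary (C i) (e i) else id) (s (e(i := Suc (e i)))))\<rparr>"


section \<open>The open Koszul complex\<close>

definition open_koszul1 :: "(real \<Rightarrow>\<^sub>0 'k::field, real \<Rightarrow>\<^sub>0 'k) chain_complex"
  where "open_koszul1 =
    \<lparr>chains = (\<lambda>p. ideal_module real_poly_ring1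
       (if p = 0 then carrier real_poly_ring1 else if p = 1 then graded_max_ideal1 else {0})),
     boundary = (\<lambda>p x. if p = 0 then x else 0)\<rparr>"

definition open_koszul ::
    "nat \<Rightarrow> ((nat \<Rightarrow>\<^sub>0 real) \<Rightarrow>\<^sub>0 'k::field,
      (nat \<Rightarrow> nat) \<Rightarrow> ((nat \<Rightarrow> (real \<Rightarrow>\<^sub>0 'k)) \<Rightarrow>\<^sub>0 'k) set) chain_complex"
  where "open_koszul n = tensor_complex n (\<lambda>_. open_koszul1)"

definition residue_field_module ::
    "nat \<Rightarrow> ((nat \<Rightarrow>\<^sub>0 real) \<Rightarrow>\<^sub>0 'k::field, ((nat \<Rightarrow>\<^sub>0 real) \<Rightarrow>\<^sub>0 'k) set) module"
  where "residue_field_module n =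
    quot_module (ideal_module (real_poly_ring n) (carrier (real_poly_ring n))) (graded_max_ideal n)"

end

theory Submission
  imports Defs
begin

text \<open>
  The tensor product of the modules \<open>R\<^sub>1\<close> and \<open>\<mm>\<^sub>1\<close> in multidegree \<open>d\<close> is the monomial ideal of
  \<open>\<kk>[\<real>\<^sub>+\<^sup>n]\<close> spanned by the \<open>x\<^sup>a\<close> with \<open>a i > 0\<close> whenever \<open>d i = 1\<close>, and all components of the
  boundary become signed inclusions. At each exponent \<open>a \<noteq> 0\<close> the complex is the augmented chain
  complex of a simplex on the support of \<open>a\<close>, which a cone with apex the first element of the support
  contracts; at \<open>a = 0\<close> only degree 0 survives. For flatness, the real exponents let finitely many
  elements of such an ideal be divided by a common monomial of the ideal, so the ideal is a directed
  union of free submodules of rank one.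
\<close>

section \<open>Modules\<close>

text \<open>Tensor products over the field are quotients of huge free spaces on tuples, so nothing
  is verified on cosets directly. Each quotient is compared with a concrete model, a monomial ideal
  or the field itself, by a map from representatives whose kernel is exactly what is divided out;
  the module structure is then carried over. The difficult inclusion is that elements killed by
  evaluation are combinations of multilinearity relations. It holds because every tuple can be
  rewritten, modulo relations, as a combination of tuples of monomials. The apex of the cone is the
  first element of the support because the Koszul sign of that component is then +1 wherever the
  strand is nonzero, so the contraction carries no signs. For flatness no direct limit of tensor
  products is formed. A relation in a tensor product mentions finitely many elements, so it suffices
  to factor the inclusion of a submodule around them through a free module. The dividing monomial
  must depend on these elements: exponents in the ideal can be arbitrarily small, and the smallest
  positive coordinate that occurs, capped at 1, supplies its exponent.\<close>

lemma mod_homD: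
  assumes "f \<in> mod_hom R M N"
  shows "x \<in> carrier M \<Longrightarrow> f x \<in> carrier N"
    and "x \<in> carrier M \<Longrightarrow> y \<in> carrier M \<Longrightarrow> f (x \<oplus>\<^bsub>M\<^esub> y) = f x \<oplus>\<^bsub>N\<^esub> f y"
    and "r \<in> carrier R \<Longrightarrow> x \<in> carrier M \<Longrightarrow> f (r \<odot>\<^bsub>M\<^esub> x) = r \<odot>\<^bsub>N\<^esub> f x"
  using assms by (auto simp: mod_hom_def)

lemma mod_homI:
  assumes "\<And>x. x \<in> carrier M \<Longrightarrow> f x \<in> carrier N"
    and "\<And>x y. x \<in> carrier M \<Longrightarrow> y \<in> carrier M \<Longrightarrow> f (x \<oplus>\<^bsub>M\<^esub> y) = f x \<oplus>\<^bsub>N\<^esub> f y"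
    and "\<And>r x. r \<in> carrier R \<Longrightarrow> x \<in> carrier M \<Longrightarrow> f (r \<odot>\<^bsub>M\<^esub> x) = r \<odot>\<^bsub>N\<^esub> f x"
  shows "f \<in> mod_hom R M N"
  using assms by (auto simp: mod_hom_def)

lemma abelian_group_zero_hom:
  assumes M: "abelian_group M" and N: "abelian_group N"
    and f: "\<And>x. x \<in> carrier M \<Longrightarrow> f x \<in> carrier N"
      "\<And>x y. x \<in> carrier M \<Longrightarrow> y \<in> carrier M \<Longrightarrow> f (x \<oplus>\<^bsub>M\<^esub> y) = f x \<oplus>\<^bsub>N\<^esub> f y"
  shows "f \<zero>\<^bsub>M\<^esub> = \<zero>\<^bsub>N\<^esub>"
proof -
  interpret M: abelian_group M by fact
  interpret N: abelian_group N by fact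
  have "f \<zero>\<^bsub>M\<^esub> \<oplus>\<^bsub>N\<^esub> f \<zero>\<^bsub>M\<^esub> = f \<zero>\<^bsub>M\<^esub>"
    using f(2)[of "\<zero>\<^bsub>M\<^esub>" "\<zero>\<^bsub>M\<^esub>"] by simp
  then show ?thesis
    using f(1)[OF M.zero_closed] by (metis N.add.r_cancel_one')
qed

lemma mod_hom_zero:
  assumes "module R M" "module R N" "f \<in> mod_hom R M N"
  shows "f \<zero>\<^bsub>M\<^esub> = \<zero>\<^bsub>N\<^esub>"
  using assms by (intro abelian_group_zero_hom) (auto dest: mod_homD module.axioms)

lemma mod_hom_inj_iff_kernel:
  assumes M: "module R M" and N: "module R N" and f: "f \<in> mod_hom R M N"
    and inj: "inj_on f (carrier M)" and x: "x \<in> carrier M"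
  shows "f x = \<zero>\<^bsub>N\<^esub> \<longleftrightarrow> x = \<zero>\<^bsub>M\<^esub>"
proof -
  interpret M: module R M by fact
  show ?thesis
    using mod_hom_zero[OF M N f] inj x by (metis M.zero_closed inj_onD)
qed

section \<open>Transport of module structure along a bijection\<close>

lemma abelian_group_bij_transfer:
  assumes M: "abelian_group M" and bij: "bij_betw g (carrier M) (carrier N)"
    and add: "\<And>x y. x \<in> carrier M \<Longrightarrow> y \<in> carrier M \<Longrightarrow> g (x \<oplus>\<^bsub>M\<^esub> y) = g x \<oplus>\<^bsub>N\<^esub> g y"
    and zero: "g \<zero>\<^bsub>M\<^esub> = \<zero>\<^bsub>N\<^esub>"
  shows "abelian_group N"
proof -
  interpret M: abelian_group M by fact
  have surj: "\<exists>x\<in>carrier M. y = g x" if "y \<in> carrier N" for y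
    using bij that by (auto simp: bij_betw_def)
  have mem: "g x \<in> carrier N" if "x \<in> carrier M" for x
    using bij that by (auto simp: bij_betw_def)
  show ?thesis
  proof (rule abelian_groupI)
    fix x y assume "x \<in> carrier N" "y \<in> carrier N"
    then obtain x' y' where "x' \<in> carrier M" "y' \<in> carrier M" "x = g x'" "y = g y'"
      using surj[of x] surj[of y] by blast
    then show "x \<oplus>\<^bsub>N\<^esub> y \<in> carrier N" "x \<oplus>\<^bsub>N\<^esub> y = y \<oplus>\<^bsub>N\<^esub> x"
      by (simp_all add: add[symmetric] mem M.a_comm)
  next
    show "\<zero>\<^bsub>N\<^esub> \<in> carrier N"
      using mem zero by (metis M.zero_closed)
  next
    fix x y z assume "x \<in> carrier N" "y \<in> carrier N" "z \<in> carrier N"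
    then obtain x' y' z' where "x' \<in> carrier M" "y' \<in> carrier M" "z' \<in> carrier M"
      "x = g x'" "y = g y'" "z = g z'"
      using surj[of x] surj[of y] surj[of z] by blast
    then show "x \<oplus>\<^bsub>N\<^esub> y \<oplus>\<^bsub>N\<^esub> z = x \<oplus>\<^bsub>N\<^esub> (y \<oplus>\<^bsub>N\<^esub> z)"
      by (simp add: add[symmetric] M.a_assoc)
  next
    fix x assume "x \<in> carrier N"
    then obtain x' where x': "x' \<in> carrier M" "x = g x'"
      using surj[of x] by blast
    then show "\<zero>\<^bsub>N\<^esub> \<oplus>\<^bsub>N\<^esub> x = x"
      by (simp add: zero[symmetric] add[symmetric])
    have "g (\<ominus>\<^bsub>M\<^esub> x') \<oplus>\<^bsub>N\<^esub> x = \<zero>\<^bsub>N\<^esub>"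
      using x' by (simp add: zero[symmetric] add[symmetric] M.l_neg)
    then show "\<exists>y\<in>carrier N. y \<oplus>\<^bsub>N\<^esub> x = \<zero>\<^bsub>N\<^esub>"
      using mem x' by (metis M.a_inv_closed)
  qed
qed

text \<open>This is how quotients are shown to be modules without computing with cosets. The zero of
  \<open>N\<close> is a record field that the addition does not determine until \<open>N\<close> is
  known to be a group, hence the separate hypothesis on it.\<close>

lemma module_bij_transfer:
  assumes M: "module R M" and bij: "bij_betw g (carrier M) (carrier N)"
    and g: "g \<in> mod_hom R M N" and zero: "g \<zero>\<^bsub>M\<^esub> = \<zero>\<^bsub>N\<^esub>"
  shows "module R N"
proof -
  interpret M: module R M by fact
  have surj: "\<exists>x\<in>carrier M. y = g x" if "y \<in> carrier N" for y
    using bij that by (auto simp: bij_betw_def)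
  note g = mod_homD[OF g]
  show ?thesis
  proof (rule moduleI)
    show "abelian_group N"
      by (rule abelian_group_bij_transfer[OF M.abelian_group_axioms bij g(2) zero])
    show "cring R" ..
  next
    fix a x assume "a \<in> carrier R" "x \<in> carrier N"
    then show "a \<odot>\<^bsub>N\<^esub> x \<in> carrier N"
      using surj by (metis M.smult_closed g(1) g(3))
  next
    fix a b x assume a: "a \<in> carrier R" "b \<in> carrier R" and x: "x \<in> carrier N"
    obtain x' where "x' \<in> carrier M" "x = g x'"
      using surj[of x] x by blast
    with a show "(a \<oplus>\<^bsub>R\<^esub> b) \<odot>\<^bsub>N\<^esub> x = a \<odot>\<^bsub>N\<^esub> x \<oplus>\<^bsub>N\<^esub> b \<odot>\<^bsub>N\<^esub> x"
      "(a \<otimes>\<^bsub>R\<^esub> b) \<odot>\<^bsub>N\<^esub> x = a \<odot>\<^bsub>N\<^esub> (b \<odot>\<^bsub>N\<^esub> x)"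
      by (simp_all add: g(2,3)[symmetric] M.smult_l_distr M.smult_assoc1)
  next
    fix a x y assume a: "a \<in> carrier R" and x: "x \<in> carrier N" "y \<in> carrier N"
    obtain x' y' where "x' \<in> carrier M" "x = g x'" "y' \<in> carrier M" "y = g y'"
      using surj[of x] surj[of y] x by blast
    with a show "a \<odot>\<^bsub>N\<^esub> (x \<oplus>\<^bsub>N\<^esub> y) = a \<odot>\<^bsub>N\<^esub> x \<oplus>\<^bsub>N\<^esub> a \<odot>\<^bsub>N\<^esub> y"
      by (simp add: g(2,3)[symmetric] M.smult_r_distr)
  next
    fix x assume "x \<in> carrier N"
    then obtain x' where "x' \<in> carrier M" "x = g x'"
      using surj[of x] by blast
    then show "\<one>\<^bsub>R\<^esub> \<odot>\<^bsub>N\<^esub> x = x"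
      by (simp add: g(3)[symmetric])
  qed
qed

text \<open>Elements with the same image differ by an element of the kernel. Cosets thus become
  fibres, which are labelled by the points of \<open>Q\<close>.\<close>

lemma (in abelian_group) a_r_coset_fiber:
  assumes Q: "abelian_group Q"
    and T: "\<And>m. m \<in> carrier G \<Longrightarrow> T m \<in> carrier Q"
      "\<And>x y. x \<in> carrier G \<Longrightarrow> y \<in> carrier G \<Longrightarrow> T (x \<oplus> y) = T x \<oplus>\<^bsub>Q\<^esub> T y"
    and x: "x \<in> carrier G"
  shows "{m \<in> carrier G. T m = \<zero>\<^bsub>Q\<^esub>} +> x = {m \<in> carrier G. T m = T x}"
proof -
  interpret Q: abelian_group Q by fact
  have "\<exists>h\<in>{m \<in> carrier G. T m = \<zero>\<^bsub>Q\<^esub>}. m = h \<oplus> x" if m: "m \<in> carrier G" "T m = T x" for m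
  proof
    have d: "(m \<oplus> \<ominus> x) \<oplus> x = m"
      using m x by (simp add: a_assoc l_neg)
    with m x show "m = (m \<oplus> \<ominus> x) \<oplus> x" by simp
    have "T (m \<oplus> \<ominus> x) \<oplus>\<^bsub>Q\<^esub> T x = T x"
      using m x T(2)[of "m \<oplus> \<ominus> x" x] d by simp
    then have "T (m \<oplus> \<ominus> x) = \<zero>\<^bsub>Q\<^esub>"
      using m x T(1) by (metis Q.add.r_cancel_one a_inv_closed add.m_closed)
    then show "m \<oplus> \<ominus> x \<in> {m \<in> carrier G. T m = \<zero>\<^bsub>Q\<^esub>}"
      using m x by simp
  qed
  moreover have "T (h \<oplus> x) = T x" if "h \<in> carrier G" "T h = \<zero>\<^bsub>Q\<^esub>" for h
    using that x T by simp
  ultimately show ?thesis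
    using x by (auto simp: a_r_coset_def')
qed

text \<open>The module axioms of \<open>M\<close> are not assumed: those of the quotient are inherited from \<open>Q\<close>.\<close>

lemma quot_module_iso:
  fixes T :: "'m \<Rightarrow> 'x"
  assumes Q: "module R Q" and M: "abelian_group M"
    and smult: "\<And>r m. r \<in> carrier R \<Longrightarrow> m \<in> carrier M \<Longrightarrow> r \<odot>\<^bsub>M\<^esub> m \<in> carrier M"
    and T: "T \<in> mod_hom R M Q" and surj: "T ` carrier M = carrier Q"
    and N: "N = {m \<in> carrier M. T m = \<zero>\<^bsub>Q\<^esub>}"
  defines "g \<equiv> \<lambda>x. {m \<in> carrier M. T m = x}"
  shows "g \<in> mod_hom R Q (quot_module M N)"
    and "bij_betw g (carrier Q) (carrier (quot_module M N))"
    and "g \<zero>\<^bsub>Q\<^esub> = \<zero>\<^bsub>quot_module M N\<^esub>"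
    and "module R (quot_module M N)"
proof -
  interpret Q: module R Q by fact
  interpret M: abelian_group M by fact
  note T = mod_homD[OF T]
  have coset: "N +>\<^bsub>M\<^esub> m = g (T m)" if "m \<in> carrier M" for m
    unfolding N g_def by (rule M.a_r_coset_fiber[OF Q.abelian_group_axioms T(1,2) that])
  have lift: "\<exists>m\<in>carrier M. T m = x" if "x \<in> carrier Q" for x
    using surj that by (metis imageE)
  have carrier: "carrier (quot_module M N) = g ` carrier Q"
  proof -
    have "carrier (quot_module M N) = (\<lambda>m. N +>\<^bsub>M\<^esub> m) ` carrier M"
      by (auto simp: quot_module_def A_RCOSETS_def' )
    also have "\<dots> = (\<lambda>m. g (T m)) ` carrier M"
      using coset by (auto intro!: image_cong)
    also have "\<dots> = g ` carrier Q"
      unfolding surj[symmetric] by (simp add: image_image)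
    finally show ?thesis .
  qed
  have add: "g (x \<oplus>\<^bsub>Q\<^esub> y) = g x \<oplus>\<^bsub>quot_module M N\<^esub> g y"
    if xy: "x \<in> carrier Q" "y \<in> carrier Q" for x y
  proof -
    have "\<exists>a\<in>g x. \<exists>b\<in>g y. m = a \<oplus>\<^bsub>M\<^esub> b" if m: "m \<in> carrier M" "T m = x \<oplus>\<^bsub>Q\<^esub> y" for m
    proof -
      obtain b where b: "b \<in> carrier M" "T b = y"
        using lift xy by blast
      \<comment> \<open>The sum of cosets is elementwise, so each \<open>m\<close> in the fibre over
        the sum has to be split. Any lift \<open>b\<close> of \<open>y\<close> does, with the
        difference as the other summand.\<close>
      let ?a = "m \<oplus>\<^bsub>M\<^esub> \<ominus>\<^bsub>M\<^esub> b"
      have ab: "?a \<oplus>\<^bsub>M\<^esub> b = m"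
        using m b by (simp add: M.a_assoc M.l_neg)
      have "T ?a \<oplus>\<^bsub>Q\<^esub> y = x \<oplus>\<^bsub>Q\<^esub> y"
        using T(2)[of ?a b] ab m b by simp
      then have "T ?a = x"
        using T(1)[of ?a] m b xy Q.add.right_cancel by simp
      then show ?thesis
        using ab b m unfolding g_def by (intro bexI[of _ ?a] bexI[of _ b]) auto
    qed
    then show ?thesis
      using T(2) xy by (auto simp: g_def quot_module_def set_add_def')
  qed
  have scal: "g (r \<odot>\<^bsub>Q\<^esub> x) = r \<odot>\<^bsub>quot_module M N\<^esub> g x"
    if rx: "r \<in> carrier R" "x \<in> carrier Q" for r x
  proof -
    have "N +>\<^bsub>M\<^esub> (r \<odot>\<^bsub>M\<^esub> m) = g (r \<odot>\<^bsub>Q\<^esub> x)" if "m \<in> g x" for m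
      using that rx coset[of "r \<odot>\<^bsub>M\<^esub> m"] smult T(3) by (auto simp: g_def)
    \<comment> \<open>A scalar multiple of a coset is a union over its representatives. The sets
      united all agree, but a union over no representatives would be empty.\<close>
    moreover have "g x \<noteq> {}"
      using lift rx by (auto simp: g_def)
    ultimately show ?thesis
      by (auto simp: quot_module_def)
  qed
  show hom: "g \<in> mod_hom R Q (quot_module M N)"
    using add scal carrier by (intro mod_homI) auto
  have "inj_on g (carrier Q)"
  proof (rule inj_onI)
    fix x y assume x: "x \<in> carrier Q" and "g x = g y"
    moreover obtain m where "m \<in> carrier M" "T m = x"
      using lift x by blast
    ultimately show "x = y"
      by (auto simp: g_def)
  qed
  then show bij: "bij_betw g (carrier Q) (carrier (quot_module M N))"
    by (simp add: bij_betw_def carrier)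
  show zero: "g \<zero>\<^bsub>Q\<^esub> = \<zero>\<^bsub>quot_module M N\<^esub>"
    by (simp add: g_def N quot_module_def)
  show "module R (quot_module M N)"
    by (rule module_bij_transfer[OF Q bij hom zero])
qed

section \<open>Finite direct sums\<close>

lemma finite_direct_sum_simps:
  "carrier (finite_direct_sum D M) = (\<Pi>\<^sub>E d\<in>D. carrier (M d))"
  "\<zero>\<^bsub>finite_direct_sum D M\<^esub> = (\<lambda>d\<in>D. \<zero>\<^bsub>M d\<^esub>)"
  "s \<oplus>\<^bsub>finite_direct_sum D M\<^esub> t = (\<lambda>d\<in>D. s d \<oplus>\<^bsub>M d\<^esub> t d)"
  "r \<odot>\<^bsub>finite_direct_sum D M\<^esub> s = (\<lambda>d\<in>D. r \<odot>\<^bsub>M d\<^esub> s d)"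
  by (simp_all add: finite_direct_sum_def)

lemma module_finite_direct_sum:
  assumes R: "cring R" and M: "\<And>d. d \<in> D \<Longrightarrow> module R (M d)"
  shows "module R (finite_direct_sum D M)"
proof -
  note ax = module.axioms[OF M]
  have grp: "abelian_group (M d)" if "d \<in> D" for d
    using ax that by blast
  have ag: "abelian_group (finite_direct_sum D M)"
  proof (rule abelian_groupI; unfold finite_direct_sum_simps)
    show "(\<lambda>d\<in>D. \<zero>\<^bsub>M d\<^esub>) \<in> (\<Pi>\<^sub>E d\<in>D. carrier (M d))"
      using grp by (auto simp: abelian_groupE(2))
  next
    fix x assume x: "x \<in> (\<Pi>\<^sub>E d\<in>D. carrier (M d))"
    then have xd: "x d \<in> carrier (M d)" if "d \<in> D" for d
      using that by auto
    show "(\<lambda>d\<in>D. (\<lambda>d\<in>D. \<zero>\<^bsub>M d\<^esub>) d \<oplus>\<^bsub>M d\<^esub> x d) = x"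
    proof -
      have "(\<lambda>d\<in>D. (\<lambda>d\<in>D. \<zero>\<^bsub>M d\<^esub>) d \<oplus>\<^bsub>M d\<^esub> x d) = restrict x D"
        by (intro restrict_ext) (simp add: abelian_groupE(5)[OF grp] xd)
      then show ?thesis
        using PiE_restrict[OF x] by simp
    qed
    show "\<exists>y\<in>\<Pi>\<^sub>E d\<in>D. carrier (M d). (\<lambda>d\<in>D. y d \<oplus>\<^bsub>M d\<^esub> x d) = (\<lambda>d\<in>D. \<zero>\<^bsub>M d\<^esub>)"
    proof
      show "(\<lambda>d\<in>D. \<ominus>\<^bsub>M d\<^esub> x d) \<in> (\<Pi>\<^sub>E d\<in>D. carrier (M d))"
        using grp xd by (auto simp: abelian_group.a_inv_closed)
      show "(\<lambda>d\<in>D. (\<lambda>d\<in>D. \<ominus>\<^bsub>M d\<^esub> x d) d \<oplus>\<^bsub>M d\<^esub> x d) = (\<lambda>d\<in>D. \<zero>\<^bsub>M d\<^esub>)"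
        by (intro restrict_ext) (simp add: abelian_group.l_neg[OF grp] xd)
    qed
  next
    fix x y assume "x \<in> (\<Pi>\<^sub>E d\<in>D. carrier (M d))" "y \<in> (\<Pi>\<^sub>E d\<in>D. carrier (M d))"
    then have xd: "x d \<in> carrier (M d)" "y d \<in> carrier (M d)" if "d \<in> D" for d
      using that by auto
    show "(\<lambda>d\<in>D. x d \<oplus>\<^bsub>M d\<^esub> y d) \<in> (\<Pi>\<^sub>E d\<in>D. carrier (M d))"
      using grp xd by (auto simp: abelian_groupE(1))
    show "(\<lambda>d\<in>D. x d \<oplus>\<^bsub>M d\<^esub> y d) = (\<lambda>d\<in>D. y d \<oplus>\<^bsub>M d\<^esub> x d)"
      by (intro restrict_ext) (simp add: abelian_groupE(4)[OF grp] xd)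
  next
    fix x y z assume "x \<in> (\<Pi>\<^sub>E d\<in>D. carrier (M d))" "y \<in> (\<Pi>\<^sub>E d\<in>D. carrier (M d))"
      "z \<in> (\<Pi>\<^sub>E d\<in>D. carrier (M d))"
    then have xd: "x d \<in> carrier (M d)" "y d \<in> carrier (M d)" "z d \<in> carrier (M d)" if "d \<in> D" for d
      using that by auto
    show "(\<lambda>d\<in>D. (\<lambda>d\<in>D. x d \<oplus>\<^bsub>M d\<^esub> y d) d \<oplus>\<^bsub>M d\<^esub> z d) =
          (\<lambda>d\<in>D. x d \<oplus>\<^bsub>M d\<^esub> (\<lambda>d\<in>D. y d \<oplus>\<^bsub>M d\<^esub> z d) d)"
      by (intro restrict_ext) (simp add: abelian_groupE(3)[OF grp] xd)
  qed
  note mod = module.smult_closed[OF M] module.smult_l_distr[OF M] module.smult_r_distr[OF M]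
    module.smult_assoc1[OF M] module.smult_one[OF M]
  show ?thesis
    by (rule moduleI[OF R ag]; unfold finite_direct_sum_simps PiE_iff)
      (auto simp: mod extensional_restrict intro!: restrict_ext extensionalityI[of _ D])
qed

lemma finite_direct_sum_iso:
  assumes "\<And>d. d \<in> D \<Longrightarrow> module R (M d)"
    and g: "\<And>d. d \<in> D \<Longrightarrow> g d \<in> mod_hom R (M d) (N d)"
    and bij: "\<And>d. d \<in> D \<Longrightarrow> bij_betw (g d) (carrier (M d)) (carrier (N d))"
  defines "G \<equiv> \<lambda>s. \<lambda>d\<in>D. g d (s d)"
  shows "G \<in> mod_hom R (finite_direct_sum D M) (finite_direct_sum D N)"
    and "bij_betw G (carrier (finite_direct_sum D M)) (carrier (finite_direct_sum D N))"
proof -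
  note hom = mod_homD[OF g]
  show "G \<in> mod_hom R (finite_direct_sum D M) (finite_direct_sum D N)"
    by (rule mod_homI; unfold finite_direct_sum_simps G_def PiE_iff)
      (auto simp: hom intro!: restrict_ext)
  show "bij_betw G (carrier (finite_direct_sum D M)) (carrier (finite_direct_sum D N))"
  proof (rule bij_betw_byWitness[where f' = "\<lambda>t. \<lambda>d\<in>D. inv_into (carrier (M d)) (g d) (t d)"];
      unfold finite_direct_sum_simps)
    show "\<forall>s\<in>\<Pi>\<^sub>E d\<in>D. carrier (M d). (\<lambda>d\<in>D. inv_into (carrier (M d)) (g d) (G s d)) = s"
      by (auto simp: G_def PiE_iff bij_betw_inv_into_left[OF bij] intro!: extensionalityI[of _ D])
    show "\<forall>t\<in>\<Pi>\<^sub>E d\<in>D. carrier (N d). G (\<lambda>d\<in>D. inv_into (carrier (M d)) (g d) (t d)) = t"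
      by (auto simp: G_def PiE_iff bij_betw_inv_into_right[OF bij] intro!: extensionalityI[of _ D])
    show "G ` (\<Pi>\<^sub>E d\<in>D. carrier (M d)) \<subseteq> (\<Pi>\<^sub>E d\<in>D. carrier (N d))"
      by (auto simp: G_def hom PiE_iff)
    show "(\<lambda>t. \<lambda>d\<in>D. inv_into (carrier (M d)) (g d) (t d)) ` (\<Pi>\<^sub>E d\<in>D. carrier (N d))
        \<subseteq> (\<Pi>\<^sub>E d\<in>D. carrier (M d))"
      using bij by (auto simp: PiE_iff bij_betw_def intro!: inv_into_into)
  qed
qed

text \<open>Every chain of \<open>C'\<close> is some \<open>g p x\<close>, and there its boundary is
  the image of that of \<open>x\<close>. Linearity of the boundary of \<open>C'\<close> and the
  vanishing of its square are therefore conclusions, so neither has to be checked on cosets.\<close>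

lemma resolution_iso:
  assumes res: "is_resolution R C N"
    and C': "\<And>p. module R (chains C' p)" and N': "module R N'"
    and g: "\<And>p. g p \<in> mod_hom R (chains C p) (chains C' p)"
    and bij: "\<And>p. bij_betw (g p) (carrier (chains C p)) (carrier (chains C' p))"
    and comm: "\<And>p x. x \<in> carrier (chains C (Suc p)) \<Longrightarrow>
      boundary C' p (g (Suc p) x) = g p (boundary C p x)"
    and h: "h \<in> mod_hom R N N'" and bij_h: "bij_betw h (carrier N) (carrier N')"
  shows "is_resolution R C' N'"
proof -
  have cplx: "is_chain_complex R C" and N: "module R N"
    using res by (simp_all add: is_resolution_def)
  have C: "module R (chains C p)" for p
    using cplx by (simp add: is_chain_complex_def)
  have bd: "boundary C p \<in> mod_hom R (chains C (Suc p)) (chains C p)" for p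
    using cplx by (simp add: is_chain_complex_def)
  have dd: "boundary C p (boundary C (Suc p) x) = \<zero>\<^bsub>chains C p\<^esub>"
    if "x \<in> carrier (chains C (Suc (Suc p)))" for p x
    using cplx that by (simp add: is_chain_complex_def)
  have ker: "a_kernel (chains C (Suc p)) (chains C p) (boundary C p) =
         boundary C (Suc p) ` carrier (chains C (Suc (Suc p)))" for p
    using res by (simp add: is_resolution_def)
  obtain \<epsilon> where \<epsilon>: "\<epsilon> \<in> mod_hom R (chains C 0) N" and \<epsilon>_surj: "\<epsilon> ` carrier (chains C 0) = carrier N"
    and \<epsilon>_ker: "a_kernel (chains C 0) N \<epsilon> = boundary C 0 ` carrier (chains C 1)"
    using res unfolding is_resolution_def by blast
  have img: "carrier (chains C' p) = g p ` carrier (chains C p)" for p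
    using bij by (auto simp: bij_betw_def)
  note gh = mod_homD[OF g] and bdh = mod_homD[OF bd]
  note add_cl = abelian_groupE(1)[OF module.axioms(2)[OF C]] and smult_cl = module.smult_closed[OF C]
  have g0: "g p \<zero>\<^bsub>chains C p\<^esub> = \<zero>\<^bsub>chains C' p\<^esub>" for p
    by (rule mod_hom_zero[OF C C' g])
  have g_ker: "g p x = \<zero>\<^bsub>chains C' p\<^esub> \<longleftrightarrow> x = \<zero>\<^bsub>chains C p\<^esub>" if "x \<in> carrier (chains C p)" for p x
    using that bij by (intro mod_hom_inj_iff_kernel[OF C C' g]) (auto simp: bij_betw_def)
  have h_ker: "h x = \<zero>\<^bsub>N'\<^esub> \<longleftrightarrow> x = \<zero>\<^bsub>N\<^esub>" if "x \<in> carrier N" for x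
    using that bij_h by (intro mod_hom_inj_iff_kernel[OF N N' h]) (auto simp: bij_betw_def)
  have bd': "boundary C' p \<in> mod_hom R (chains C' (Suc p)) (chains C' p)" for p
    by (rule mod_homI; unfold img)
      (auto simp: comm gh(1) bdh add_cl smult_cl gh(2,3)[symmetric])
  have chain: "is_chain_complex R C'"
    unfolding is_chain_complex_def img
    using C' bd' by (auto simp: comm bdh dd g0)
  have im: "boundary C' p ` carrier (chains C' (Suc p)) =
      g p ` boundary C p ` carrier (chains C (Suc p))" for p
    unfolding img image_image by (intro image_cong) (auto simp: comm)
  have ker': "a_kernel (chains C' (Suc p)) (chains C' p) (boundary C' p) =
      g (Suc p) ` a_kernel (chains C (Suc p)) (chains C p) (boundary C p)" for p
  proof -
    have "boundary C' p (g (Suc p) x) = \<zero>\<^bsub>chains C' p\<^esub> \<longleftrightarrow> boundary C p x = \<zero>\<^bsub>chains C p\<^esub>"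
      if "x \<in> carrier (chains C (Suc p))" for x
      using that by (simp add: comm g_ker bdh(1))
    then show ?thesis
      unfolding a_kernel_def' img by auto
  qed
  \<comment> \<open>The augmentation forced by the isomorphisms \<open>g 0\<close> and
    \<open>h\<close>. Its linearity is checked at the points \<open>g 0 x\<close>, which avoids
    proving that the inverse of \<open>g 0\<close> is linear.\<close>
  define \<epsilon>' where "\<epsilon>' x = h (\<epsilon> (inv_into (carrier (chains C 0)) (g 0) x))" for x
  have \<epsilon>': "\<epsilon>' (g 0 x) = h (\<epsilon> x)" if "x \<in> carrier (chains C 0)" for x
    using that bij[of 0] by (simp add: \<epsilon>'_def bij_betw_inv_into_left)
  note eh = mod_homD[OF \<epsilon>] and hh = mod_homD[OF h]
  have "\<epsilon>' \<in> mod_hom R (chains C' 0) N'"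
    by (rule mod_homI; unfold img)
      (auto simp: \<epsilon>' gh(1) eh hh add_cl smult_cl gh(2,3)[symmetric])
  moreover have "\<epsilon>' ` carrier (chains C' 0) = carrier N'"
  proof -
    have "\<epsilon>' ` carrier (chains C' 0) = h ` \<epsilon> ` carrier (chains C 0)"
      unfolding img image_image by (intro image_cong) (auto simp: \<epsilon>')
    then show ?thesis
      using \<epsilon>_surj bij_h by (auto simp: bij_betw_def)
  qed
  moreover have "a_kernel (chains C' 0) N' \<epsilon>' = boundary C' 0 ` carrier (chains C' 1)"
  proof -
    have "a_kernel (chains C' 0) N' \<epsilon>' = g 0 ` a_kernel (chains C 0) N \<epsilon>"
    proof -
      have "\<epsilon>' (g 0 x) = \<zero>\<^bsub>N'\<^esub> \<longleftrightarrow> \<epsilon> x = \<zero>\<^bsub>N\<^esub>" if "x \<in> carrier (chains C 0)" for x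
        using that by (simp add: \<epsilon>' h_ker eh(1))
      then show ?thesis
        unfolding a_kernel_def' img by auto
    qed
    then show ?thesis
      unfolding \<epsilon>_ker using im[of 0] by simp
  qed
  moreover have "a_kernel (chains C' (Suc p)) (chains C' p) (boundary C' p) =
         boundary C' (Suc p) ` carrier (chains C' (Suc (Suc p)))" for p
    unfolding ker' ker im ..
  ultimately show ?thesis
    unfolding is_resolution_def using chain N' by auto
qed

section \<open>A criterion for flatness\<close>

text \<open>A linear form on a submodule. HOL functions are total, so conditions are imposed on
  \<open>M0\<close> only. The forms used later divide by a monomial and take values outside the ring
  away from \<open>M0\<close>.\<close>

definition partial_functional ::
    "('r, 'x) ring_scheme \<Rightarrow> ('r, 'm, 'y) module_scheme \<Rightarrow> 'm set \<Rightarrow> ('m \<Rightarrow> 'r) \<Rightarrow> bool"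
  where "partial_functional R M M0 \<kappa> \<longleftrightarrow> M0 \<subseteq> carrier M \<and> (\<forall>x\<in>M0. \<kappa> x \<in> carrier R) \<and>
    (\<forall>x\<in>M0. \<forall>y\<in>M0. x \<oplus>\<^bsub>M\<^esub> y \<in> M0 \<and> \<kappa> (x \<oplus>\<^bsub>M\<^esub> y) = \<kappa> x \<oplus>\<^bsub>R\<^esub> \<kappa> y) \<and>
    (\<forall>r\<in>carrier R. \<forall>x\<in>M0. r \<odot>\<^bsub>M\<^esub> x \<in> M0 \<and> \<kappa> (r \<odot>\<^bsub>M\<^esub> x) = r \<otimes>\<^bsub>R\<^esub> \<kappa> x)"

lemma hom_free_Abelian_group_simps:
  assumes B: "abelian_group B" and h: "h \<in> hom (free_Abelian_group S) (add_monoid B)"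
  shows "h 0 = \<zero>\<^bsub>B\<^esub>"
    and "Poly_Mapping.keys x \<subseteq> S \<Longrightarrow> h x \<in> carrier B"
    and "Poly_Mapping.keys x \<subseteq> S \<Longrightarrow> Poly_Mapping.keys y \<subseteq> S \<Longrightarrow> h (x + y) = h x \<oplus>\<^bsub>B\<^esub> h y"
    and "Poly_Mapping.keys x \<subseteq> S \<Longrightarrow> h (- x) = \<ominus>\<^bsub>B\<^esub> h x"
    and "Poly_Mapping.keys x \<subseteq> S \<Longrightarrow> Poly_Mapping.keys y \<subseteq> S \<Longrightarrow> h (x - y) = h x \<ominus>\<^bsub>B\<^esub> h y"
proof -
  interpret B: abelian_group B by fact
  interpret h: group_hom "free_Abelian_group S" "add_monoid B" h
    by (intro group_hom.intro group_hom_axioms.intro h group_free_Abelian_group B.a_group)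
  show "h 0 = \<zero>\<^bsub>B\<^esub>"
    using h.hom_one by simp
  show cl: "h x \<in> carrier B" if "Poly_Mapping.keys x \<subseteq> S" for x
    using h.hom_closed[of x] that by simp
  show add: "h (x + y) = h x \<oplus>\<^bsub>B\<^esub> h y"
    if "Poly_Mapping.keys x \<subseteq> S" "Poly_Mapping.keys y \<subseteq> S" for x y
    using h.hom_mult[of x y] that by simp
  show neg: "h (- x) = \<ominus>\<^bsub>B\<^esub> h x" if "Poly_Mapping.keys x \<subseteq> S" for x
    using h.hom_inv[of x] that by (simp add: a_inv_def)
  show "h (x - y) = h x \<ominus>\<^bsub>B\<^esub> h y"
    if "Poly_Mapping.keys x \<subseteq> S" "Poly_Mapping.keys y \<subseteq> S" for x y
    using add[of x "- y"] neg[of y] that by (simp add: a_minus_def)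
qed

section \<open>The relations that define a tensor product\<close>

context
  fixes R :: "('r, 'x) ring_scheme" and M :: "('r, 'm, 'y) module_scheme"
    and A :: "('r, 'a, 'z) module_scheme"
  assumes M: "module R M" and A: "module R A"
begin

interpretation M: module R M by (rule M)
interpretation A: module R A by (rule A)

lemma subgroup_tensor_relations:
  "subgroup (tensor_relations R M A) (free_Abelian_group (carrier M \<times> carrier A))"
  unfolding tensor_relations_def
  by (rule group.generate_is_subgroup[OF group_free_Abelian_group])
    (auto dest!: subsetD[OF keys_diff])

lemma tensor_relations_closed:
  shows "0 \<in> tensor_relations R M A"
    and "u \<in> tensor_relations R M A \<Longrightarrow> Poly_Mapping.keys u \<subseteq> carrier M \<times> carrier A"
    and "u \<in> tensor_relations R M A \<Longrightarrow> - u \<in> tensor_relations R M A"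
    and "u \<in> tensor_relations R M A \<Longrightarrow> v \<in> tensor_relations R M A \<Longrightarrow>
      u + v \<in> tensor_relations R M A"
    and "u \<in> tensor_relations R M A \<Longrightarrow> v \<in> tensor_relations R M A \<Longrightarrow>
      u - v \<in> tensor_relations R M A"
proof -
  note sg = subgroup_tensor_relations
  show "0 \<in> tensor_relations R M A"
    using subgroup.one_closed[OF sg] by simp
  show keys: "Poly_Mapping.keys u \<subseteq> carrier M \<times> carrier A" if "u \<in> tensor_relations R M A" for u
    using subgroup.mem_carrier[OF sg that] by simp
  show neg: "- u \<in> tensor_relations R M A" if "u \<in> tensor_relations R M A" for u
    using subgroup.m_inv_closed[OF sg that] keys[OF that] by simp
  show add: "u + v \<in> tensor_relations R M A"
    if "u \<in> tensor_relations R M A" "v \<in> tensor_relations R M A" for u v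
    using subgroup.m_closed[OF sg that] by simp
  show "u - v \<in> tensor_relations R M A"
    if "u \<in> tensor_relations R M A" "v \<in> tensor_relations R M A" for u v
    using add[OF that(1) neg[OF that(2)]] by simp
qed

lemma tensor_relations_sum:
  "(\<And>d. d \<in> D \<Longrightarrow> u d \<in> tensor_relations R M A) \<Longrightarrow> sum u D \<in> tensor_relations R M A"
  by (induction D rule: infinite_finite_induct) (auto simp: tensor_relations_closed)

lemma tensor_relations_generators:
  shows "x \<in> carrier M \<Longrightarrow> y \<in> carrier M \<Longrightarrow> a \<in> carrier A \<Longrightarrow>
      frag_of (x \<oplus>\<^bsub>M\<^esub> y, a) - frag_of (x, a) - frag_of (y, a) \<in> tensor_relations R M A"
    and "x \<in> carrier M \<Longrightarrow> a \<in> carrier A \<Longrightarrow> b \<in> carrier A \<Longrightarrow>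
      frag_of (x, a \<oplus>\<^bsub>A\<^esub> b) - frag_of (x, a) - frag_of (x, b) \<in> tensor_relations R M A"
    and "r \<in> carrier R \<Longrightarrow> x \<in> carrier M \<Longrightarrow> a \<in> carrier A \<Longrightarrow>
      frag_of (r \<odot>\<^bsub>M\<^esub> x, a) - frag_of (x, r \<odot>\<^bsub>A\<^esub> a) \<in> tensor_relations R M A"
  unfolding tensor_relations_def by (rule generate.incl, blast)+

lemma tensor_relations_zero:
  shows "x \<in> carrier M \<Longrightarrow> frag_of (x, \<zero>\<^bsub>A\<^esub>) \<in> tensor_relations R M A"
    and "a \<in> carrier A \<Longrightarrow> frag_of (\<zero>\<^bsub>M\<^esub>, a) \<in> tensor_relations R M A"
  \<comment> \<open>Additivity applied to zero plus zero gives the negative of the generator in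
    question.\<close>
  using tensor_relations_generators(2)[of x "\<zero>\<^bsub>A\<^esub>" "\<zero>\<^bsub>A\<^esub>"]
    tensor_relations_generators(1)[of "\<zero>\<^bsub>M\<^esub>" "\<zero>\<^bsub>M\<^esub>" a]
  by (auto dest: tensor_relations_closed(3))

lemma tensor_relations_diff:
  assumes "x \<in> carrier M" "a \<in> carrier A" "b \<in> carrier A"
  shows "frag_of (x, a \<ominus>\<^bsub>A\<^esub> b) - (frag_of (x, a) - frag_of (x, b)) \<in> tensor_relations R M A"
proof -
  have "(a \<ominus>\<^bsub>A\<^esub> b) \<oplus>\<^bsub>A\<^esub> b = a"
    using assms by (simp add: A.minus_eq A.a_assoc A.l_neg)
  then have "frag_of (x, a) - frag_of (x, a \<ominus>\<^bsub>A\<^esub> b) - frag_of (x, b) \<in> tensor_relations R M A"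
    using tensor_relations_generators(2)[of x "a \<ominus>\<^bsub>A\<^esub> b" b] assms by simp
  from tensor_relations_closed(3)[OF this] show ?thesis
    by (simp add: algebra_simps)
qed

lemma tensor_relations_finsum:
  assumes "finite D" "\<And>d. d \<in> D \<Longrightarrow> x d \<in> carrier M" "a \<in> carrier A"
  shows "frag_of (finsum M x D, a) - (\<Sum>d\<in>D. frag_of (x d, a)) \<in> tensor_relations R M A"
  using assms(1,2)
proof (induction D rule: finite_induct)
  case empty
  then show ?case using assms(3) by (simp add: tensor_relations_zero)
next
  case (insert d D)
  then have x: "x \<in> D \<rightarrow> carrier M" "x d \<in> carrier M" by auto
  then have "frag_of (x d \<oplus>\<^bsub>M\<^esub> finsum M x D, a) - frag_of (x d, a) - frag_of (finsum M x D, a)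
      + (frag_of (finsum M x D, a) - (\<Sum>d\<in>D. frag_of (x d, a))) \<in> tensor_relations R M A"
    using insert assms(3)
    by (intro tensor_relations_closed(4) tensor_relations_generators(1)) auto
  then show ?case
    using insert x by (simp add: algebra_simps)
qed

text \<open>
  A relation involves finitely many elements of \<open>M\<close>, so it is annihilated by the functionals
  \<open>\<kappa> \<otimes> id\<close> for linear \<open>\<kappa>\<close> that are defined only on a submodule containing these elements.
\<close>

lemma tensor_relations_annihilated:
  assumes "u \<in> tensor_relations R M A"
  shows "\<exists>F. finite F \<and> F \<subseteq> carrier M \<and>
    (\<forall>M0 \<kappa> h. F \<subseteq> M0 \<longrightarrow> partial_functional R M M0 \<kappa> \<longrightarrow>
      h \<in> hom (free_Abelian_group (carrier M \<times> carrier A)) (add_monoid A) \<longrightarrow>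
      (\<forall>x\<in>M0. \<forall>a\<in>carrier A. h (frag_of (x, a)) = \<kappa> x \<odot>\<^bsub>A\<^esub> a) \<longrightarrow>
      h u = \<zero>\<^bsub>A\<^esub>)"
    (is "\<exists>F. ?P u F")
proof -
  note hsimps = hom_free_Abelian_group_simps[OF A.abelian_group_axioms]
  let ?G = "{frag_of (x \<oplus>\<^bsub>M\<^esub> y, a) - frag_of (x, a) - frag_of (y, a) | x y a.
        x \<in> carrier M \<and> y \<in> carrier M \<and> a \<in> carrier A} \<union>
     {frag_of (x, a \<oplus>\<^bsub>A\<^esub> b) - frag_of (x, a) - frag_of (x, b) | x a b.
        x \<in> carrier M \<and> a \<in> carrier A \<and> b \<in> carrier A} \<union>
     {frag_of (r \<odot>\<^bsub>M\<^esub> x, a) - frag_of (x, r \<odot>\<^bsub>A\<^esub> a) | r x a.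
        r \<in> carrier R \<and> x \<in> carrier M \<and> a \<in> carrier A}"
  have neg_self: "a \<oplus>\<^bsub>A\<^esub> b \<ominus>\<^bsub>A\<^esub> a \<ominus>\<^bsub>A\<^esub> b = \<zero>\<^bsub>A\<^esub>" if "a \<in> carrier A" "b \<in> carrier A" for a b
  proof -
    have "a \<oplus>\<^bsub>A\<^esub> b \<ominus>\<^bsub>A\<^esub> a \<ominus>\<^bsub>A\<^esub> b = (a \<oplus>\<^bsub>A\<^esub> b) \<oplus>\<^bsub>A\<^esub> \<ominus>\<^bsub>A\<^esub> (a \<oplus>\<^bsub>A\<^esub> b)"
      using that by (simp add: A.minus_eq A.minus_add A.a_assoc)
    then show ?thesis
      using that by (simp add: A.r_neg)
  qed
  have keys3: "Poly_Mapping.keys (frag_of p - frag_of q) \<subseteq> carrier M \<times> carrier A"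
    if "p \<in> carrier M \<times> carrier A" "q \<in> carrier M \<times> carrier A" for p q :: "'m \<times> 'a"
    using keys_diff[of "frag_of p" "frag_of q"] that by auto
  have gen: "\<exists>F. ?P u F" if u: "u \<in> ?G" for u
  proof -
    from u show ?thesis
    proof (elim UnE CollectE exE conjE)
      fix x y a assume 1: "u = frag_of (x \<oplus>\<^bsub>M\<^esub> y, a) - frag_of (x, a) - frag_of (y, a)"
        "x \<in> carrier M" "y \<in> carrier M" "a \<in> carrier A"
      show ?thesis
      \<comment> \<open>Listing the left factors is enough: the sum of \<open>x\<close> and
        \<open>y\<close>, and the multiple of \<open>x\<close> in the third case, lie in
        \<open>M0\<close> by closure.\<close>
      proof (rule exI[of _ "{x, y}"], intro conjI allI impI)
        fix M0 \<kappa> h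
        assume F: "{x, y} \<subseteq> M0" and pf: "partial_functional R M M0 \<kappa>"
          and h: "h \<in> hom (free_Abelian_group (carrier M \<times> carrier A)) (add_monoid A)"
          and h\<kappa>: "\<forall>x\<in>M0. \<forall>a\<in>carrier A. h (frag_of (x, a)) = \<kappa> x \<odot>\<^bsub>A\<^esub> a"
        have "h u = (\<kappa> x \<oplus>\<^bsub>R\<^esub> \<kappa> y) \<odot>\<^bsub>A\<^esub> a \<ominus>\<^bsub>A\<^esub> \<kappa> x \<odot>\<^bsub>A\<^esub> a \<ominus>\<^bsub>A\<^esub> \<kappa> y \<odot>\<^bsub>A\<^esub> a"
          using F pf h\<kappa> 1 by (simp add: partial_functional_def hsimps(5)[OF h] keys3)
        then show "h u = \<zero>\<^bsub>A\<^esub>"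
          using F pf 1 by (simp add: partial_functional_def A.smult_l_distr neg_self)
      qed (use 1 in auto)
    next
      fix x a b assume 2: "u = frag_of (x, a \<oplus>\<^bsub>A\<^esub> b) - frag_of (x, a) - frag_of (x, b)"
        "x \<in> carrier M" "a \<in> carrier A" "b \<in> carrier A"
      show ?thesis
      proof (rule exI[of _ "{x}"], intro conjI allI impI)
        fix M0 \<kappa> h
        assume F: "{x} \<subseteq> M0" and pf: "partial_functional R M M0 \<kappa>"
          and h: "h \<in> hom (free_Abelian_group (carrier M \<times> carrier A)) (add_monoid A)"
          and h\<kappa>: "\<forall>x\<in>M0. \<forall>a\<in>carrier A. h (frag_of (x, a)) = \<kappa> x \<odot>\<^bsub>A\<^esub> a"
        have "h u = \<kappa> x \<odot>\<^bsub>A\<^esub> (a \<oplus>\<^bsub>A\<^esub> b) \<ominus>\<^bsub>A\<^esub> \<kappa> x \<odot>\<^bsub>A\<^esub> a \<ominus>\<^bsub>A\<^esub> \<kappa> x \<odot>\<^bsub>A\<^esub> b"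
          using F h\<kappa> 2 by (simp add: hsimps(5)[OF h] keys3)
        then show "h u = \<zero>\<^bsub>A\<^esub>"
          using F pf 2 by (simp add: partial_functional_def A.smult_r_distr neg_self)
      qed (use 2 in auto)
    next
      fix r x a assume 3: "u = frag_of (r \<odot>\<^bsub>M\<^esub> x, a) - frag_of (x, r \<odot>\<^bsub>A\<^esub> a)"
        "r \<in> carrier R" "x \<in> carrier M" "a \<in> carrier A"
      show ?thesis
      proof (rule exI[of _ "{x}"], intro conjI allI impI)
        fix M0 \<kappa> h
        assume F: "{x} \<subseteq> M0" and pf: "partial_functional R M M0 \<kappa>"
          and h: "h \<in> hom (free_Abelian_group (carrier M \<times> carrier A)) (add_monoid A)"
          and h\<kappa>: "\<forall>x\<in>M0. \<forall>a\<in>carrier A. h (frag_of (x, a)) = \<kappa> x \<odot>\<^bsub>A\<^esub> a"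
        have "h u = (r \<otimes>\<^bsub>R\<^esub> \<kappa> x) \<odot>\<^bsub>A\<^esub> a \<ominus>\<^bsub>A\<^esub> \<kappa> x \<odot>\<^bsub>A\<^esub> (r \<odot>\<^bsub>A\<^esub> a)"
          using F pf h\<kappa> 3 by (simp add: partial_functional_def hsimps(5)[OF h] keys3)
        \<comment> \<open>Commutativity of the ring is what makes the functional respect the
          relation that moves \<open>r\<close> between the two factors.\<close>
        moreover have "r \<otimes>\<^bsub>R\<^esub> \<kappa> x = \<kappa> x \<otimes>\<^bsub>R\<^esub> r" "\<kappa> x \<in> carrier R"
          using F pf 3 by (auto simp: partial_functional_def M.m_comm)
        ultimately show "h u = \<zero>\<^bsub>A\<^esub>"
          using 3 by (simp add: A.smult_assoc1 A.minus_eq A.r_neg)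
      qed (use 3 in auto)
    qed
  qed
  have "u \<in> generate (free_Abelian_group (carrier M \<times> carrier A)) ?G"
    using assms by (simp add: tensor_relations_def)
  then show ?thesis
  proof (induction u rule: generate.induct)
    case one
    show ?case
      by (rule exI[of _ "{}"]) (auto simp: hsimps(1))
  next
    case (incl u)
    then show ?case by (rule gen)
  next
    case (inv u)
    then have keys: "Poly_Mapping.keys u \<subseteq> carrier M \<times> carrier A"
      by (intro tensor_relations_closed(2)) (simp add: tensor_relations_def generate.incl)
    obtain F where F: "?P u F"
      using gen[OF inv] by blast
    have zero: "\<ominus>\<^bsub>A\<^esub> \<zero>\<^bsub>A\<^esub> = \<zero>\<^bsub>A\<^esub>"
      by (rule A.minus_equality) simp_all
    have "?P (- u) F"
    proof (intro conjI allI impI)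
      fix M0 \<kappa> h
      assume M0: "F \<subseteq> M0" "partial_functional R M M0 \<kappa>"
        "h \<in> hom (free_Abelian_group (carrier M \<times> carrier A)) (add_monoid A)"
        "\<forall>x\<in>M0. \<forall>a\<in>carrier A. h (frag_of (x, a)) = \<kappa> x \<odot>\<^bsub>A\<^esub> a"
      have "h u = \<zero>\<^bsub>A\<^esub>"
        by (rule conjunct2[OF conjunct2[OF F], THEN spec, THEN spec, THEN spec, THEN mp, OF M0(1), THEN mp, OF M0(2), THEN mp, OF M0(3), THEN mp, OF M0(4)])
      then show "h (- u) = \<zero>\<^bsub>A\<^esub>"
        by (simp add: hsimps(4)[OF M0(3) keys] zero)
    qed (use F in auto)
    then show ?case
      using keys by auto
  next
    case (eng u v)
    obtain F where F: "?P u F" using eng by blast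
    obtain F' where F': "?P v F'" using eng by blast
    have keys: "Poly_Mapping.keys u \<subseteq> carrier M \<times> carrier A" "Poly_Mapping.keys v \<subseteq> carrier M \<times> carrier A"
      using eng by (auto intro!: tensor_relations_closed(2) simp: tensor_relations_def)
    show ?case
    proof (rule exI[of _ "F \<union> F'"], intro conjI allI impI)
      fix M0 \<kappa> h
      assume "F \<union> F' \<subseteq> M0" and M0: "partial_functional R M M0 \<kappa>"
        "h \<in> hom (free_Abelian_group (carrier M \<times> carrier A)) (add_monoid A)"
        "\<forall>x\<in>M0. \<forall>a\<in>carrier A. h (frag_of (x, a)) = \<kappa> x \<odot>\<^bsub>A\<^esub> a"
      then have FM: "F \<subseteq> M0" "F' \<subseteq> M0" by auto
      have "h u = \<zero>\<^bsub>A\<^esub>"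
        by (rule conjunct2[OF conjunct2[OF F], THEN spec, THEN spec, THEN spec, THEN mp, OF FM(1), THEN mp, OF M0(1), THEN mp, OF M0(2), THEN mp, OF M0(3)])
      moreover have "h v = \<zero>\<^bsub>A\<^esub>"
        by (rule conjunct2[OF conjunct2[OF F'], THEN spec, THEN spec, THEN spec, THEN mp, OF FM(2), THEN mp, OF M0(1), THEN mp, OF M0(2), THEN mp, OF M0(3)])
      ultimately show "h (u \<otimes>\<^bsub>free_Abelian_group (carrier M \<times> carrier A)\<^esub> v) = \<zero>\<^bsub>A\<^esub>"
        using keys by (simp add: hsimps(3)[OF M0(2)])
    qed (use F F' in auto)
  qed
qed

end

text \<open>The inclusion of \<open>M0\<close> in \<open>M\<close> factors through the finite free
  module on \<open>D\<close>, with \<open>\<kappa>\<close> as the map into it and \<open>e\<close>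
  as the map out of it. Asking this around every finite set is a concrete form of being a filtered
  union of pieces that behave like free modules. The type of indices is a parameter because a
  definition cannot quantify over types.\<close>

definition locally_split ::
    "'i itself \<Rightarrow> ('r, 'x) ring_scheme \<Rightarrow> ('r, 'm, 'y) module_scheme \<Rightarrow> bool"
  where "locally_split _ R M \<longleftrightarrow> module R M \<and>
    (\<forall>F. finite F \<longrightarrow> F \<subseteq> carrier M \<longrightarrow>
      (\<exists>M0 (D :: 'i set) e \<kappa>. F \<subseteq> M0 \<and> M0 \<subseteq> carrier M \<and> finite D \<and> e ` D \<subseteq> carrier M \<and>
        (\<forall>d\<in>D. partial_functional R M M0 (\<kappa> d)) \<and>
        (\<forall>x\<in>M0. x = finsum M (\<lambda>d. \<kappa> d x \<odot>\<^bsub>M\<^esub> e d) D)))"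

lemma keys_frag_map:
  "Poly_Mapping.keys (frag_extend (\<lambda>p. frag_of (\<phi> p)) c) \<subseteq> \<phi> ` Poly_Mapping.keys c"
  using keys_frag_extend[of "\<lambda>p. frag_of (\<phi> p)" c] by auto

text \<open>The map \<open>\<kappa> \<otimes> id\<close> is built on the free abelian group and not
  on the tensor product, because \<open>\<kappa>\<close> is linear on \<open>M0\<close> only.
  Generators with left factor off \<open>M0\<close> get the default value zero, and the universal
  property does the rest.\<close>

lemma partial_functional_tensor:
  assumes A: "module R A" and \<kappa>: "partial_functional R M M0 \<kappa>"
  shows "\<exists>h. h \<in> hom (free_Abelian_group (carrier M \<times> carrier A)) (add_monoid A) \<and>
    (\<forall>x\<in>M0. \<forall>a\<in>carrier A. h (frag_of (x, a)) = \<kappa> x \<odot>\<^bsub>A\<^esub> a)"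
proof -
  interpret A: module R A by fact
  let ?g = "\<lambda>(x, a). if x \<in> M0 then \<kappa> x \<odot>\<^bsub>A\<^esub> a else \<zero>\<^bsub>A\<^esub>"
  have "?g ` (carrier M \<times> carrier A) \<subseteq> carrier (add_monoid A)"
    using \<kappa> by (auto simp: partial_functional_def)
  then obtain h where "h \<in> hom (free_Abelian_group (carrier M \<times> carrier A)) (add_monoid A)"
    "\<And>p. p \<in> carrier M \<times> carrier A \<Longrightarrow> h (frag_of p) = ?g p"
    by (rule comm_group.free_Abelian_group_universal[OF A.a_comm_group]) blast
  then show ?thesis
    using \<kappa> by (intro exI[of _ h]) (auto simp: partial_functional_def)
qed

text \<open>
  Over a submodule \<open>M0\<close> with a finite dual basis \<open>e, \<kappa>\<close>, an element of \<open>M0 \<otimes> A\<close> is determined by its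
  images under the functionals \<open>\<kappa> d \<otimes> id\<close>, and these commute with \<open>id \<otimes> f\<close>.
\<close>

lemma tensor_id_kernel:
  fixes A :: "('r, 'a) module" and B :: "('r, 'b) module"
  assumes split: "locally_split TYPE('i) R M" and A: "module R A" and B: "module R B"
    and f: "f \<in> mod_hom R A B" and inj: "inj_on f (carrier A)"
    and c: "Poly_Mapping.keys c \<subseteq> carrier M \<times> carrier A"
    and rel: "frag_extend (\<lambda>(x, a). frag_of (x, f a)) c \<in> tensor_relations R M B"
  shows "c \<in> tensor_relations R M A"
proof -
  have M: "module R M" using split by (simp add: locally_split_def)
  interpret M: module R M by fact
  interpret A: module R A by fact
  interpret B: module R B by fact
  note fh = mod_homD[OF f]
  note hA = hom_free_Abelian_group_simps[OF A.abelian_group_axioms]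
  note hB = hom_free_Abelian_group_simps[OF B.abelian_group_axioms]
  note relA = tensor_relations_closed[OF M A] tensor_relations_generators[OF M A]
  let ?\<phi> = "frag_extend (\<lambda>(x, a). frag_of (x, f a))"
  obtain F where F: "finite F" "F \<subseteq> carrier M"
    and annih: "\<forall>M0 \<kappa> h. F \<subseteq> M0 \<longrightarrow> partial_functional R M M0 \<kappa> \<longrightarrow>
      h \<in> hom (free_Abelian_group (carrier M \<times> carrier B)) (add_monoid B) \<longrightarrow>
      (\<forall>x\<in>M0. \<forall>b\<in>carrier B. h (frag_of (x, b)) = \<kappa> x \<odot>\<^bsub>B\<^esub> b) \<longrightarrow> h (?\<phi> c) = \<zero>\<^bsub>B\<^esub>"
    using tensor_relations_annihilated[OF M B rel] by (elim exE conjE) (rule that)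
  \<comment> \<open>\<open>M0\<close> has to serve twice: with \<open>F\<close> inside, the
    functionals kill the given relation over \<open>B\<close>; with the left factors of
    \<open>c\<close> inside, \<open>c\<close> itself can be expanded in the dual basis.\<close>
  have "finite (F \<union> fst ` Poly_Mapping.keys c)" "F \<union> fst ` Poly_Mapping.keys c \<subseteq> carrier M"
    using F c by auto
  then obtain M0 and D :: "'i set" and e \<kappa> where FM0: "F \<union> fst ` Poly_Mapping.keys c \<subseteq> M0" and M0: "M0 \<subseteq> carrier M"
    and D: "finite D" and e: "e ` D \<subseteq> carrier M"
    and \<kappa>: "\<forall>d\<in>D. partial_functional R M M0 (\<kappa> d)"
    and basis: "\<forall>x\<in>M0. x = finsum M (\<lambda>d. \<kappa> d x \<odot>\<^bsub>M\<^esub> e d) D"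
    using split unfolding locally_split_def
    by (elim conjE allE[of _ "F \<union> fst ` Poly_Mapping.keys c"] impE exE) (assumption | rule that)+
  have \<kappa>_mem: "\<kappa> d x \<in> carrier R" if "d \<in> D" "x \<in> M0" for d x
    using \<kappa> that by (simp add: partial_functional_def)
  have "\<forall>d\<in>D. \<exists>h. h \<in> hom (free_Abelian_group (carrier M \<times> carrier A)) (add_monoid A) \<and>
      (\<forall>x\<in>M0. \<forall>a\<in>carrier A. h (frag_of (x, a)) = \<kappa> d x \<odot>\<^bsub>A\<^esub> a)"
    using \<kappa> partial_functional_tensor[OF A] by blast
  from bchoice[OF this] obtain h where hh: "\<forall>d\<in>D. h d \<in> hom (free_Abelian_group (carrier M \<times> carrier A)) (add_monoid A) \<and>
      (\<forall>x\<in>M0. \<forall>a\<in>carrier A. h d (frag_of (x, a)) = \<kappa> d x \<odot>\<^bsub>A\<^esub> a)" ..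
  then have h: "h d \<in> hom (free_Abelian_group (carrier M \<times> carrier A)) (add_monoid A)"
    if "d \<in> D" for d
    using that by blast
  have h_of: "h d (frag_of (x, a)) = \<kappa> d x \<odot>\<^bsub>A\<^esub> a"
    if "d \<in> D" "x \<in> M0" "a \<in> carrier A" for d x a
    using hh that by blast
  have "\<forall>d\<in>D. \<exists>k. k \<in> hom (free_Abelian_group (carrier M \<times> carrier B)) (add_monoid B) \<and>
      (\<forall>x\<in>M0. \<forall>a\<in>carrier B. k (frag_of (x, a)) = \<kappa> d x \<odot>\<^bsub>B\<^esub> a)"
    using \<kappa> partial_functional_tensor[OF B] by blast
  from bchoice[OF this] obtain k where kk: "\<forall>d\<in>D. k d \<in> hom (free_Abelian_group (carrier M \<times> carrier B)) (add_monoid B) \<and>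
      (\<forall>x\<in>M0. \<forall>a\<in>carrier B. k d (frag_of (x, a)) = \<kappa> d x \<odot>\<^bsub>B\<^esub> a)" ..
  then have k: "k d \<in> hom (free_Abelian_group (carrier M \<times> carrier B)) (add_monoid B)"
    if "d \<in> D" for d
    using that by blast
  have k_of: "k d (frag_of (x, a)) = \<kappa> d x \<odot>\<^bsub>B\<^esub> a"
    if "d \<in> D" "x \<in> M0" "a \<in> carrier B" for d x a
    using kk that by blast
  have f0: "f \<zero>\<^bsub>A\<^esub> = \<zero>\<^bsub>B\<^esub>"
    by (rule mod_hom_zero[OF A B f])
  have f_minus: "f (a \<ominus>\<^bsub>A\<^esub> b) = f a \<ominus>\<^bsub>B\<^esub> f b" if ab: "a \<in> carrier A" "b \<in> carrier A" for a b
  proof -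
    have "f (a \<ominus>\<^bsub>A\<^esub> b) \<oplus>\<^bsub>B\<^esub> f b = f a"
      using ab fh(2)[of "a \<ominus>\<^bsub>A\<^esub> b" b] by (simp add: A.minus_eq A.a_assoc A.l_neg)
    then have "f a \<ominus>\<^bsub>B\<^esub> f b = f (a \<ominus>\<^bsub>A\<^esub> b) \<oplus>\<^bsub>B\<^esub> f b \<ominus>\<^bsub>B\<^esub> f b"
      by simp
    also have "\<dots> = f (a \<ominus>\<^bsub>A\<^esub> b)"
      using ab fh(1)[of "a \<ominus>\<^bsub>A\<^esub> b"] fh(1)[of b] by (simp add: B.minus_eq B.a_assoc B.r_neg)
    finally show ?thesis ..
  qed
  have sub: "M0 \<times> carrier A \<subseteq> carrier M \<times> carrier A"
    using M0 by auto
  have keys_\<phi>: "Poly_Mapping.keys (?\<phi> u) \<subseteq> carrier M \<times> carrier B" if "Poly_Mapping.keys u \<subseteq> M0 \<times> carrier A" for u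
  proof -
    have "Poly_Mapping.keys (?\<phi> u) \<subseteq> (\<lambda>(x, a). (x, f a)) ` Poly_Mapping.keys u"
      using keys_frag_map[of "\<lambda>(x, a). (x, f a)" u] by (simp add: case_prod_unfold)
    also have "\<dots> \<subseteq> (\<lambda>(x, a). (x, f a)) ` (M0 \<times> carrier A)"
      using that by (rule image_mono)
    also have "\<dots> \<subseteq> carrier M \<times> carrier B"
      using M0 by (auto simp: fh(1))
    finally show ?thesis .
  qed
  \<comment> \<open>Naturality of \<open>\<kappa> \<otimes> id\<close> in the second factor, checked
    on generators, where it is linearity of \<open>f\<close>.\<close>
  have compat: "f (h d u) = k d (?\<phi> u)" if d: "d \<in> D" and u: "Poly_Mapping.keys u \<subseteq> M0 \<times> carrier A" for d u
    using u
  proof (induction u rule: free_Abelian_group_induct[consumes 1, case_names zero diff of])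
    case zero
    then show ?case
      using hA(1)[OF h[OF d]] hB(1)[OF k[OF d]] f0 by simp
  next
    case (diff u v)
    then have "Poly_Mapping.keys u \<subseteq> carrier M \<times> carrier A" "Poly_Mapping.keys v \<subseteq> carrier M \<times> carrier A"
      using sub by blast+
    with diff keys_\<phi>[of u] keys_\<phi>[of v] show ?case
      by (simp add: hA(2,5)[OF h[OF d]] hB(5)[OF k[OF d]] f_minus frag_extend_diff)
  next
    case (of p)
    then obtain x a where "p = (x, a)" "x \<in> M0" "a \<in> carrier A" by auto
    then show ?case
      using fh(1,3) by (simp add: h_of[OF d] k_of[OF d] \<kappa>_mem[OF d])
  qed
  \<comment> \<open>Replace \<open>x\<close> by its dual basis expansion, use additivity in the left
    factor, and move each coefficient across the tensor sign.\<close>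
  have expand: "u - (\<Sum>d\<in>D. frag_of (e d, h d u)) \<in> tensor_relations R M A"
    if "Poly_Mapping.keys u \<subseteq> M0 \<times> carrier A" for u
    using that
  proof (induction u rule: free_Abelian_group_induct[consumes 1, case_names zero diff of])
    case zero
    have "(\<Sum>d\<in>D. frag_of (e d, h d 0)) \<in> tensor_relations R M A"
      using e by (intro tensor_relations_sum[OF M A]) (auto simp: hA(1)[OF h] tensor_relations_zero[OF M A])
    then show ?case
      using relA(3) by simp
  next
    case (diff u v)
    then have uv: "Poly_Mapping.keys u \<subseteq> carrier M \<times> carrier A" "Poly_Mapping.keys v \<subseteq> carrier M \<times> carrier A"
      using sub by blast+
    have "(\<Sum>d\<in>D. frag_of (e d, h d (u - v)) - (frag_of (e d, h d u) - frag_of (e d, h d v)))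
        \<in> tensor_relations R M A"
      using e uv
      by (intro tensor_relations_sum[OF M A])
        (simp add: hA(5)[OF h] hA(2)[OF h] tensor_relations_diff[OF M A] image_subset_iff)
    from relA(5)[OF relA(5)[OF diff(3,4)] this] show ?case
      by (simp add: sum_subtractf sum.distrib algebra_simps)
  next
    case (of p)
    then obtain x a where p: "p = (x, a)" "x \<in> M0" "a \<in> carrier A" by auto
    have ke: "\<kappa> d x \<odot>\<^bsub>M\<^esub> e d \<in> carrier M" if "d \<in> D" for d
      using e that \<kappa>_mem[OF that p(2)] by auto
    have "frag_of (x, a) - (\<Sum>d\<in>D. frag_of (\<kappa> d x \<odot>\<^bsub>M\<^esub> e d, a)) \<in> tensor_relations R M A"
      using tensor_relations_finsum[OF M A D ke p(3)] basis p(2) by force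
    moreover have "(\<Sum>d\<in>D. frag_of (\<kappa> d x \<odot>\<^bsub>M\<^esub> e d, a) - frag_of (e d, h d (frag_of (x, a))))
        \<in> tensor_relations R M A"
      using e p
      by (intro tensor_relations_sum[OF M A])
        (simp add: h_of relA(8) \<kappa>_mem image_subset_iff)
    ultimately show ?case
      using relA(4) unfolding p(1) by (fastforce simp: sum_subtractf)
  qed
  have cM0: "Poly_Mapping.keys c \<subseteq> M0 \<times> carrier A"
    using FM0 c by fastforce
  have zero: "h d c = \<zero>\<^bsub>A\<^esub>" if d: "d \<in> D" for d
  proof -
    \<comment> \<open>The relation holds over \<open>B\<close>, so each coordinate of the image of
      \<open>c\<close> vanishes. Injectivity of \<open>f\<close> pulls this back to
      \<open>A\<close>, one coordinate at a time.\<close>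
    have "k d (?\<phi> c) = \<zero>\<^bsub>B\<^esub>"
      using \<kappa> d FM0 k_of k by (intro annih[rule_format, of M0 "\<kappa> d"]) auto
    then have "f (h d c) = \<zero>\<^bsub>B\<^esub>"
      using compat[OF d cM0] by simp
    then show ?thesis
      using mod_hom_inj_iff_kernel[OF A B f inj] hA(2)[OF h[OF d] c] by simp
  qed
  have "(\<Sum>d\<in>D. frag_of (e d, h d c)) \<in> tensor_relations R M A"
    using e by (intro tensor_relations_sum[OF M A]) (auto simp: zero tensor_relations_zero[OF M A])
  from relA(4)[OF expand[OF cM0] this] show ?thesis
    by simp
qed

text \<open>What remains after \<open>tensor_id_kernel\<close> is the passage from a trivial kernel
  to injectivity on cosets. The induced map is a union over representatives, so equality of two
  images is exploited by following the image of one representative \<open>s\<close> into the other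
  union.\<close>

lemma locally_split_imp_flat:
  fixes R :: "('r, 'x) ring_scheme" and M :: "('r, 'm, 'y) module_scheme"
  assumes split: "locally_split TYPE('i) R M"
  shows "flat_module TYPE('a) TYPE('b) R M"
  unfolding flat_module_def
proof (intro conjI allI impI)
  show M: "module R M"
    using split by (simp add: locally_split_def)
  fix A :: "('r, 'a) module" and B :: "('r, 'b) module" and f
  assume "module R A \<and> module R B \<and> f \<in> mod_hom R A B \<and> inj_on f (carrier A)"
  then have A: "module R A" and B: "module R B" and f: "f \<in> mod_hom R A B"
    and inj: "inj_on f (carrier A)"
    by auto
  interpret M: module R M by fact
  interpret A: module R A by fact
  interpret B: module R B by fact
  let ?GA = "free_Abelian_group (carrier M \<times> carrier A)"
  let ?GB = "free_Abelian_group (carrier M \<times> carrier B)"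
  let ?\<phi> = "frag_extend (\<lambda>(x, a). frag_of (x, f a))"
  note fh = mod_homD[OF f]
  note sgA = subgroup_tensor_relations[OF M A] and sgB = subgroup_tensor_relations[OF M B]
  have relA: "tensor_relations R M A #>\<^bsub>?GA\<^esub> c = {u + c | u. u \<in> tensor_relations R M A}" for c
    by (auto simp: r_coset_def)
  have relB: "tensor_relations R M B #>\<^bsub>?GB\<^esub> c = {u + c | u. u \<in> tensor_relations R M B}" for c
    by (auto simp: r_coset_def)
  show "inj_on (tensor_id_map R M B f) (carrier (tensor_group R M A))"
  proof (rule inj_onI)
    fix S T assume "S \<in> carrier (tensor_group R M A)" "T \<in> carrier (tensor_group R M A)"
      and eq: "tensor_id_map R M B f S = tensor_id_map R M B f T"
    then obtain s t where s: "Poly_Mapping.keys s \<subseteq> carrier M \<times> carrier A" "S = tensor_relations R M A #>\<^bsub>?GA\<^esub> s"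
      and t: "Poly_Mapping.keys t \<subseteq> carrier M \<times> carrier A" "T = tensor_relations R M A #>\<^bsub>?GA\<^esub> t"
      by (auto simp: tensor_group_def FactGroup_def RCOSETS_def)
    have "s \<in> S"
      using s relA tensor_relations_closed(1)[OF M A] by force
    then have "?\<phi> s \<in> tensor_id_map R M B f S"
      unfolding tensor_id_map_def relB using tensor_relations_closed(1)[OF M B] by force
    then have "?\<phi> s \<in> tensor_id_map R M B f T"
      unfolding eq .
    then obtain t' u where t': "t' \<in> T" and u: "u \<in> tensor_relations R M B" "?\<phi> s = u + ?\<phi> t'"
      unfolding tensor_id_map_def relB by blast
    obtain v where v: "v \<in> tensor_relations R M A" "t' = v + t"
      using t' t relA by auto
    have "Poly_Mapping.keys t' \<subseteq> carrier M \<times> carrier A"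
      unfolding v(2) using keys_add[of v t] tensor_relations_closed(2)[OF M A v(1)] t(1) by blast
    then have "Poly_Mapping.keys (s - t') \<subseteq> carrier M \<times> carrier A"
      using keys_diff[of s t'] s(1) by blast
    moreover have "?\<phi> (s - t') \<in> tensor_relations R M B"
      using u by (simp add: frag_extend_diff)
    ultimately have "s - t' \<in> tensor_relations R M A"
      by (rule tensor_id_kernel[OF split A B f inj])
    then have "(s - t') + v \<in> tensor_relations R M A"
      using v(1) by (rule tensor_relations_closed(4)[OF M A])
    then have st: "s - t \<in> tensor_relations R M A"
      by (simp add: v(2) algebra_simps)
    have "\<exists>w'\<in>tensor_relations R M A. w + s = w' + t" if "w \<in> tensor_relations R M A" for w
      using tensor_relations_closed(4)[OF M A that st] by (intro bexI[of _ "w + (s - t)"]) auto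
    moreover have "\<exists>w'\<in>tensor_relations R M A. w + t = w' + s" if "w \<in> tensor_relations R M A" for w
      using tensor_relations_closed(5)[OF M A that st] by (intro bexI[of _ "w - (s - t)"]) auto
    ultimately show "S = T"
      unfolding s(2) t(2) relA by blast
  qed
qed

lemma (in abelian_group) finsum_hom:
  assumes "abelian_group N" "\<And>x. x \<in> carrier G \<Longrightarrow> g x \<in> carrier N"
    "\<And>x y. x \<in> carrier G \<Longrightarrow> y \<in> carrier G \<Longrightarrow> g (x \<oplus> y) = g x \<oplus>\<^bsub>N\<^esub> g y"
    "finite D" "\<And>d. d \<in> D \<Longrightarrow> x d \<in> carrier G"
  shows "g (finsum G x D) = finsum N (\<lambda>d. g (x d)) D"
  using assms(4,5)
proof (induction D rule: finite_induct)
  case empty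
  then show ?case
    using abelian_group_zero_hom[OF abelian_group_axioms assms(1-3)] abelian_group.axioms(1)[OF assms(1)]
    by (simp add: abelian_monoid.finsum_empty)
next
  case (insert d D)
  then have "x \<in> D \<rightarrow> carrier G" by auto
  with insert show ?case
    using abelian_group.axioms(1)[OF assms(1)] assms(2,3)
    by (simp add: abelian_monoid.finsum_insert)
qed

text \<open>Splitting is proved for sums of ideals, whereas flatness is wanted for sums of coset
  modules. Functionals are composed with the inverse of \<open>g\<close>, and the elements
  \<open>e\<close> are pushed forward along \<open>g\<close>.\<close>

lemma locally_split_iso:
  assumes split: "locally_split TYPE('i) R M" and N: "module R N"
    and g: "g \<in> mod_hom R M N" and bij: "bij_betw g (carrier M) (carrier N)"
  shows "locally_split TYPE('i) R N"
  unfolding locally_split_def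
proof (intro conjI allI impI N)
  have M: "module R M" using split by (simp add: locally_split_def)
  interpret M: module R M by fact
  interpret N: module R N by fact
  note gh = mod_homD[OF g]
  define g' where "g' = inv_into (carrier M) g"
  have g'g: "g' (g x) = x" if "x \<in> carrier M" for x
    using bij_betw_inv_into_left[OF bij that] by (simp add: g'_def)
  have gg': "g (g' y) = y" if "y \<in> carrier N" for y
    using bij_betw_inv_into_right[OF bij that] by (simp add: g'_def)
  have g'_mem: "g' y \<in> carrier M" if "y \<in> carrier N" for y
    using bij that by (auto simp: g'_def bij_betw_def intro: inv_into_into)
  fix F assume F: "finite F" "F \<subseteq> carrier N"
  have "finite (g' ` F)" "g' ` F \<subseteq> carrier M"
    using F g'_mem by auto
  then obtain M0 and D :: "'i set" and e \<kappa> where FM0: "g' ` F \<subseteq> M0" and M0: "M0 \<subseteq> carrier M"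
    and D: "finite D" and e: "e ` D \<subseteq> carrier M"
    and \<kappa>: "\<forall>d\<in>D. partial_functional R M M0 (\<kappa> d)"
    and basis: "\<forall>x\<in>M0. x = finsum M (\<lambda>d. \<kappa> d x \<odot>\<^bsub>M\<^esub> e d) D"
    using split unfolding locally_split_def
    by (elim conjE allE[of _ "g' ` F"] impE exE) (assumption | rule that)+
  have mem: "x \<in> carrier M" if "x \<in> M0" for x using M0 that by blast
  have \<kappa>_mem: "\<kappa> d x \<in> carrier R" if "d \<in> D" "x \<in> M0" for d x
    using \<kappa> that by (simp add: partial_functional_def)
  have sum: "g x = finsum N (\<lambda>d. \<kappa> d x \<odot>\<^bsub>N\<^esub> g (e d)) D" if "x \<in> M0" for x
  proof -
    have "g x = g (finsum M (\<lambda>d. \<kappa> d x \<odot>\<^bsub>M\<^esub> e d) D)"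
      using basis that by auto
    also have "\<dots> = finsum N (\<lambda>d. g (\<kappa> d x \<odot>\<^bsub>M\<^esub> e d)) D"
      using D e \<kappa>_mem[OF _ that]
      by (intro M.finsum_hom[OF N.abelian_group_axioms gh(1,2)]) auto
    also have "\<dots> = finsum N (\<lambda>d. \<kappa> d x \<odot>\<^bsub>N\<^esub> g (e d)) D"
      using e \<kappa>_mem[OF _ that] by (intro N.finsum_cong') (auto simp: gh(1,3))
    finally show ?thesis .
  qed
  show "\<exists>M0 (D :: 'i set) e \<kappa>. F \<subseteq> M0 \<and> M0 \<subseteq> carrier N \<and> finite D \<and> e ` D \<subseteq> carrier N \<and>
        (\<forall>d\<in>D. partial_functional R N M0 (\<kappa> d)) \<and>
        (\<forall>x\<in>M0. x = finsum N (\<lambda>d. \<kappa> d x \<odot>\<^bsub>N\<^esub> e d) D)"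
  proof (intro exI conjI)
    show "F \<subseteq> g ` M0"
      using FM0 F(2) gg' by (metis image_eqI image_subset_iff subset_iff)
    show "g ` M0 \<subseteq> carrier N" "(\<lambda>d. g (e d)) ` D \<subseteq> carrier N"
      using gh(1) mem e by auto
    show "finite D" by fact
    show "\<forall>d\<in>D. partial_functional R N (g ` M0) (\<lambda>y. \<kappa> d (g' y))"
      using \<kappa> mem gh(1) by (auto simp: partial_functional_def gh(2,3)[symmetric] g'g)
    show "\<forall>x\<in>g ` M0. x = finsum N (\<lambda>d. \<kappa> d (g' x) \<odot>\<^bsub>N\<^esub> g (e d)) D"
      by (simp add: g'g mem sum[symmetric])
  qed
qed

section \<open>Linear maps on finitely supported functions\<close>

lemma lookup_map_scale:
  "Poly_Mapping.lookup (Poly_Mapping.map ((*) c) p) k = c * Poly_Mapping.lookup p (k :: 'a)"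
  for c :: "'k::mult_zero"
  by (simp add: Poly_Mapping.map.rep_eq when_def)

lemma map_scale_simps:
  fixes c :: "'k::comm_ring_1"
  shows "Poly_Mapping.map ((*) c) 0 = 0"
    and "Poly_Mapping.map ((*) 0) p = (0 :: 'a \<Rightarrow>\<^sub>0 'k)"
    and "Poly_Mapping.map ((*) 1) p = p"
    and "Poly_Mapping.map ((*) (- 1)) p = - p"
    and "Poly_Mapping.map ((*) c) (p + q) = Poly_Mapping.map ((*) c) p + Poly_Mapping.map ((*) c) q"
    and "Poly_Mapping.map ((*) c) (p - q) = Poly_Mapping.map ((*) c) p - Poly_Mapping.map ((*) c) q"
    and "Poly_Mapping.map ((*) c) (Poly_Mapping.single x b) = Poly_Mapping.single x (c * b)"
    and "Poly_Mapping.map ((*) b) (Poly_Mapping.map ((*) c) p) = Poly_Mapping.map ((*) (b * c)) p"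
  by (rule poly_mapping_eqI;
      simp add: lookup_map_scale lookup_add lookup_minus lookup_single when_def algebra_simps)+

lemma poly_mapping_eq_sum_single:
  "p = (\<Sum>k\<in>Poly_Mapping.keys p. Poly_Mapping.single k (Poly_Mapping.lookup p k))"
  by (rule poly_mapping_eqI) (simp add: lookup_sum lookup_single when_def in_keys_iff)

text \<open>Both the evaluation of tuples and its section have this form. Scaling by
  \<open>Poly_Mapping.map\<close> matches the scaling rule of the multilinearity relations.\<close>

definition lin_ext :: "('a \<Rightarrow> 'b \<Rightarrow>\<^sub>0 'k::comm_ring_1) \<Rightarrow> ('a \<Rightarrow>\<^sub>0 'k) \<Rightarrow> 'b \<Rightarrow>\<^sub>0 'k"
  where "lin_ext \<phi> t =
    (\<Sum>m\<in>Poly_Mapping.keys t. Poly_Mapping.map ((*) (Poly_Mapping.lookup t m)) (\<phi> m))"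

text \<open>Summing over any finite superset of the support gives two arguments and their sum a
  common index set, so linearity can be checked coefficientwise although terms may cancel.\<close>

lemma lookup_lin_ext:
  assumes "finite A" "Poly_Mapping.keys t \<subseteq> A"
  shows "Poly_Mapping.lookup (lin_ext \<phi> t) b =
    (\<Sum>m\<in>A. Poly_Mapping.lookup t m * Poly_Mapping.lookup (\<phi> m) b)"
proof -
  have "Poly_Mapping.lookup (lin_ext \<phi> t) b =
      (\<Sum>m\<in>Poly_Mapping.keys t. Poly_Mapping.lookup t m * Poly_Mapping.lookup (\<phi> m) b)"
    by (simp add: lin_ext_def lookup_sum lookup_map_scale)
  also have "\<dots> = (\<Sum>m\<in>A. Poly_Mapping.lookup t m * Poly_Mapping.lookup (\<phi> m) b)"
    using assms by (intro sum.mono_neutral_left) (auto simp: in_keys_iff)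
  finally show ?thesis .
qed

lemma lin_ext_add: "lin_ext \<phi> (s + t) = lin_ext \<phi> s + lin_ext \<phi> t"
proof (rule poly_mapping_eqI)
  fix b
  let ?A = "Poly_Mapping.keys s \<union> Poly_Mapping.keys t"
  show "Poly_Mapping.lookup (lin_ext \<phi> (s + t)) b = Poly_Mapping.lookup (lin_ext \<phi> s + lin_ext \<phi> t) b"
    by (simp add: lookup_lin_ext[of ?A] keys_add lookup_add sum.distrib algebra_simps)
qed

lemma lin_ext_scale: "lin_ext \<phi> (Poly_Mapping.map ((*) c) t) = Poly_Mapping.map ((*) c) (lin_ext \<phi> t)"
proof (rule poly_mapping_eqI)
  fix b
  have "Poly_Mapping.keys (Poly_Mapping.map ((*) c) t) \<subseteq> Poly_Mapping.keys t"
    by (auto simp: in_keys_iff lookup_map_scale)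
  then show "Poly_Mapping.lookup (lin_ext \<phi> (Poly_Mapping.map ((*) c) t)) b =
      Poly_Mapping.lookup (Poly_Mapping.map ((*) c) (lin_ext \<phi> t)) b"
    by (simp add: lookup_lin_ext[of "Poly_Mapping.keys t"] lookup_map_scale sum_distrib_left mult.assoc)
qed

lemma lin_ext_0: "lin_ext \<phi> 0 = 0"
  by (simp add: lin_ext_def)

lemma lin_ext_single:
  "lin_ext \<phi> (Poly_Mapping.single m c) = Poly_Mapping.map ((*) c) (\<phi> m)"
  by (cases "c = 0") (simp_all add: lin_ext_def map_scale_simps)

lemma lin_ext_uminus: "lin_ext \<phi> (- t) = - lin_ext \<phi> t"
  using lin_ext_scale[of \<phi> "- 1" t] by (simp add: map_scale_simps)

lemma lin_ext_diff: "lin_ext \<phi> (s - t) = lin_ext \<phi> s - lin_ext \<phi> t"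
  using lin_ext_add[of \<phi> s "- t"] by (simp add: lin_ext_uminus)

lemma lin_ext_sum: "lin_ext \<phi> (sum f A) = (\<Sum>x\<in>A. lin_ext \<phi> (f x))"
  by (induction A rule: infinite_finite_induct) (simp_all add: lin_ext_0 lin_ext_add)

lemma keys_lin_ext:
  "Poly_Mapping.keys (lin_ext \<phi> t) \<subseteq> (\<Union>m\<in>Poly_Mapping.keys t. Poly_Mapping.keys (\<phi> m))"
proof
  fix b assume "b \<in> Poly_Mapping.keys (lin_ext \<phi> t)"
  then have "(\<Sum>m\<in>Poly_Mapping.keys t. Poly_Mapping.lookup t m * Poly_Mapping.lookup (\<phi> m) b) \<noteq> 0"
    using lookup_lin_ext[of "Poly_Mapping.keys t" t \<phi> b] by (simp add: in_keys_iff)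
  then obtain m where "m \<in> Poly_Mapping.keys t" "Poly_Mapping.lookup (\<phi> m) b \<noteq> 0"
    by (metis (no_types, lifting) mult_zero_right sum.neutral)
  then show "b \<in> (\<Union>m\<in>Poly_Mapping.keys t. Poly_Mapping.keys (\<phi> m))"
    by (auto simp: in_keys_iff)
qed

section \<open>Monomial ideals\<close>

lemma abelian_group_keys_subset:
  fixes M :: "('e \<Rightarrow>\<^sub>0 'k::ab_group_add, 'z) ring_scheme"
  assumes "carrier M = {t. Poly_Mapping.keys t \<subseteq> S}" "\<zero>\<^bsub>M\<^esub> = 0" "\<And>s t. s \<oplus>\<^bsub>M\<^esub> t = s + t"
  shows "abelian_group M"
  by (rule abelian_groupI)
    (auto simp: assms add.assoc add.commute add.left_commute
      dest!: subsetD[OF keys_add] intro!: exI[of _ "- x" for x])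

lemma cring_monoid_algebra:
  assumes "0 \<in> Q" "\<And>a b. a \<in> Q \<Longrightarrow> b \<in> Q \<Longrightarrow> a + b \<in> Q"
  shows "cring (monoid_algebra Q :: ('e::comm_monoid_add \<Rightarrow>\<^sub>0 'k::field) ring)"
proof (rule cringI)
  show "abelian_group (monoid_algebra Q :: ('e \<Rightarrow>\<^sub>0 'k) ring)"
    by (rule abelian_group_keys_subset) (auto simp: monoid_algebra_def)
  show "comm_monoid (monoid_algebra Q :: ('e \<Rightarrow>\<^sub>0 'k) ring)"
  proof (rule comm_monoidI)
    fix p q :: "'e \<Rightarrow>\<^sub>0 'k"
    assume "p \<in> carrier (monoid_algebra Q)" "q \<in> carrier (monoid_algebra Q)"
    then show "p \<otimes>\<^bsub>monoid_algebra Q\<^esub> q \<in> carrier (monoid_algebra Q)"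
      using keys_mult[of p q] assms(2) by (fastforce simp: monoid_algebra_def)
  qed (use assms(1) in \<open>auto simp: monoid_algebra_def mult.assoc mult.commute\<close>)
qed (auto simp: monoid_algebra_def algebra_simps)

lemma module_ideal_monoid_algebra:
  fixes E :: "'e::comm_monoid_add set"
  assumes Q: "0 \<in> Q" "\<And>a b. a \<in> Q \<Longrightarrow> b \<in> Q \<Longrightarrow> a + b \<in> Q"
    and E: "\<And>a b. a \<in> Q \<Longrightarrow> b \<in> E \<Longrightarrow> a + b \<in> E"
  shows "module (monoid_algebra Q) (ideal_module (monoid_algebra Q)
    {p :: 'e \<Rightarrow>\<^sub>0 'k::field. Poly_Mapping.keys p \<subseteq> E})"
proof (rule moduleI)
  show "cring (monoid_algebra Q :: ('e \<Rightarrow>\<^sub>0 'k) ring)"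
    using Q by (rule cring_monoid_algebra)
  show "abelian_group (ideal_module (monoid_algebra Q) {p :: 'e \<Rightarrow>\<^sub>0 'k. Poly_Mapping.keys p \<subseteq> E})"
    by (rule abelian_group_keys_subset) (auto simp: ideal_module_def monoid_algebra_def)
  fix p q :: "'e \<Rightarrow>\<^sub>0 'k"
  assume "p \<in> carrier (monoid_algebra Q)"
    "q \<in> carrier (ideal_module (monoid_algebra Q) {p. Poly_Mapping.keys p \<subseteq> E})"
  then show "p \<odot>\<^bsub>ideal_module (monoid_algebra Q) {p. Poly_Mapping.keys p \<subseteq> E}\<^esub> q
      \<in> carrier (ideal_module (monoid_algebra Q) {p. Poly_Mapping.keys p \<subseteq> E})"
    using keys_mult[of p q] E by (fastforce simp: ideal_module_def monoid_algebra_def)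
qed (auto simp: ideal_module_def monoid_algebra_def algebra_simps)

text \<open>The empty set stands for the zero module in degrees 2 and above: only the zero
  polynomial has no exponents. All terms of the one-variable complex thus become monomial
  ideals.\<close>

definition koszul_exponents1 :: "nat \<Rightarrow> real set"
  where "koszul_exponents1 j = (if j = 0 then {0..} else if j = 1 then {0<..} else {})"

definition koszul_exponents :: "nat \<Rightarrow> (nat \<Rightarrow> nat) \<Rightarrow> (nat \<Rightarrow>\<^sub>0 real) set"
  where "koszul_exponents n d =
    {a \<in> orthant n. \<forall>i<n. Poly_Mapping.lookup a i \<in> koszul_exponents1 (d i)}"

definition koszul_ideal :: "nat \<Rightarrow> (nat \<Rightarrow> nat) \<Rightarrow> ((nat \<Rightarrow>\<^sub>0 real) \<Rightarrow>\<^sub>0 'k::field) set"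
  where "koszul_ideal n d = {p. Poly_Mapping.keys p \<subseteq> koszul_exponents n d}"

abbreviation koszul_module ::
    "nat \<Rightarrow> (nat \<Rightarrow> nat) \<Rightarrow> ((nat \<Rightarrow>\<^sub>0 real) \<Rightarrow>\<^sub>0 'k::field, (nat \<Rightarrow>\<^sub>0 real) \<Rightarrow>\<^sub>0 'k) module"
  where "koszul_module n d \<equiv> ideal_module (real_poly_ring n) (koszul_ideal n d)"

lemma orthant_zero: "0 \<in> orthant n"
  by (simp add: orthant_def)

lemma orthant_add: "a \<in> orthant n \<Longrightarrow> b \<in> orthant n \<Longrightarrow> a + b \<in> orthant n"
  using keys_add[of a b] by (auto simp: orthant_def lookup_add)

lemma koszul_exponents1_add: "0 \<le> x \<Longrightarrow> y \<in> koszul_exponents1 j \<Longrightarrow> x + y \<in> koszul_exponents1 j"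
  by (auto simp: koszul_exponents1_def split: if_splits)

lemma koszul_exponents_add:
  "a \<in> orthant n \<Longrightarrow> b \<in> koszul_exponents n d \<Longrightarrow> a + b \<in> koszul_exponents n d"
  by (auto simp: koszul_exponents_def orthant_add lookup_add koszul_exponents1_add)
    (auto simp: orthant_def koszul_exponents1_add)

lemma cring_real_poly_ring: "cring (real_poly_ring n)"
  unfolding real_poly_ring_def by (rule cring_monoid_algebra) (auto simp: orthant_zero orthant_add)

lemma module_koszul: "module (real_poly_ring n) (koszul_module n d)"
  unfolding real_poly_ring_def koszul_ideal_def
  by (rule module_ideal_monoid_algebra) (auto simp: orthant_zero orthant_add koszul_exponents_add)

lemma koszul_module_simps:
  "carrier (koszul_module n d) = koszul_ideal n d"
  "\<zero>\<^bsub>koszul_module n d\<^esub> = 0"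
  "p \<oplus>\<^bsub>koszul_module n d\<^esub> q = p + q"
  "r \<odot>\<^bsub>koszul_module n d\<^esub> p = r * p"
  by (simp_all add: ideal_module_def real_poly_ring_def monoid_algebra_def)

lemma carrier_real_poly_ring:
  "carrier (real_poly_ring n) = {r. Poly_Mapping.keys r \<subseteq> orthant n}"
  by (simp add: real_poly_ring_def monoid_algebra_def)

lemma open_koszul1_simps:
  "carrier (chains open_koszul1 j) = {p. Poly_Mapping.keys p \<subseteq> koszul_exponents1 j}"
  "\<zero>\<^bsub>chains open_koszul1 j\<^esub> = 0"
  "p \<oplus>\<^bsub>chains open_koszul1 j\<^esub> q = p + q"
  "r \<odot>\<^bsub>chains open_koszul1 j\<^esub> p = r * p"
  by (auto simp: open_koszul1_def ideal_module_def real_poly_ring1_def monoid_algebra_def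
      graded_max_ideal1_def koszul_exponents1_def)

section \<open>The tensor products in the open Koszul complex\<close>

definition embed_var :: "nat \<Rightarrow> (real \<Rightarrow>\<^sub>0 'k::field) \<Rightarrow> (nat \<Rightarrow>\<^sub>0 real) \<Rightarrow>\<^sub>0 'k"
  where "embed_var i = lin_ext (\<lambda>a. Poly_Mapping.single (Poly_Mapping.single i a) 1)"

text \<open>On representatives, the isomorphism of a tensor power of the one-variable ring with the
  ring in \<open>n\<close> variables: each factor is placed in its own variable and the results are
  multiplied.\<close>

definition tensor_eval :: "nat \<Rightarrow> ((nat \<Rightarrow> (real \<Rightarrow>\<^sub>0 'k::field)) \<Rightarrow>\<^sub>0 'k) \<Rightarrow> (nat \<Rightarrow>\<^sub>0 real) \<Rightarrow>\<^sub>0 'k"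
  where "tensor_eval n = lin_ext (\<lambda>m. \<Prod>i<n. embed_var i (m i))"

text \<open>A linear section of \<open>tensor_eval\<close> that splits a monomial into its
  one-variable factors. The restriction makes the tuple extensional, as membership in the carrier
  demands.\<close>

definition tensor_expand :: "nat \<Rightarrow> ((nat \<Rightarrow>\<^sub>0 real) \<Rightarrow>\<^sub>0 'k::field) \<Rightarrow> (nat \<Rightarrow> (real \<Rightarrow>\<^sub>0 'k)) \<Rightarrow>\<^sub>0 'k"
  where "tensor_expand n =
    lin_ext (\<lambda>a. Poly_Mapping.single (\<lambda>i\<in>{..<n}. Poly_Mapping.single (Poly_Mapping.lookup a i) 1) 1)"

abbreviation koszul_tuples :: "nat \<Rightarrow> (nat \<Rightarrow> nat) \<Rightarrow>
    ((nat \<Rightarrow>\<^sub>0 real) \<Rightarrow>\<^sub>0 'k::field, (nat \<Rightarrow> (real \<Rightarrow>\<^sub>0 'k)) \<Rightarrow>\<^sub>0 'k) module"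
  where "koszul_tuples n d \<equiv> tuple_module n (\<lambda>i. chains open_koszul1 (d i))"

abbreviation koszul_relations ::
    "nat \<Rightarrow> (nat \<Rightarrow> nat) \<Rightarrow> ((nat \<Rightarrow> (real \<Rightarrow>\<^sub>0 'k::field)) \<Rightarrow>\<^sub>0 'k) set"
  where "koszul_relations n d \<equiv> multilinear_relations n (\<lambda>i. chains open_koszul1 (d i))"

lemma carrier_koszul_tuples:
  "carrier (koszul_tuples n d) = {t. Poly_Mapping.keys t \<subseteq>
    (\<Pi>\<^sub>E i\<in>{..<n}. {p. Poly_Mapping.keys p \<subseteq> koszul_exponents1 (d i)})}"
  by (simp add: tuple_module_def open_koszul1_simps)

lemma koszul_tuples_simps:
  "\<zero>\<^bsub>koszul_tuples n d\<^esub> = 0" "s \<oplus>\<^bsub>koszul_tuples n d\<^esub> t = s + t"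
  by (simp_all add: tuple_module_def)

lemma abelian_group_koszul_tuples: "abelian_group (koszul_tuples n d)"
  by (rule abelian_group_keys_subset) (auto simp: carrier_koszul_tuples koszul_tuples_simps)

lemma embed_var_add: "embed_var i (p + q) = embed_var i p + embed_var i q"
  by (simp add: embed_var_def lin_ext_add)

lemma embed_var_single:
  "embed_var i (Poly_Mapping.single a c) = Poly_Mapping.single (Poly_Mapping.single i a) c"
  by (simp add: embed_var_def lin_ext_single map_scale_simps)

lemma embed_var_sum: "embed_var i (sum f A) = (\<Sum>x\<in>A. embed_var i (f x))"
  by (simp add: embed_var_def lin_ext_sum)

text \<open>Multiplicativity against a single term covers both uses: scalars are the terms with
  exponent 0, and the ring acts on tuples through monomials.\<close>

lemma embed_var_single_mult:
  "embed_var i (Poly_Mapping.single a c * p) =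
    Poly_Mapping.single (Poly_Mapping.single i a) c * embed_var i p"
proof -
  let ?q = "\<lambda>k. Poly_Mapping.single k (Poly_Mapping.lookup p k)"
  have "embed_var i (Poly_Mapping.single a c * (\<Sum>k\<in>Poly_Mapping.keys p. ?q k)) =
      Poly_Mapping.single (Poly_Mapping.single i a) c * embed_var i (\<Sum>k\<in>Poly_Mapping.keys p. ?q k)"
    by (simp add: sum_distrib_left embed_var_sum embed_var_single mult_single single_add)
  then show ?thesis
    by (simp flip: poly_mapping_eq_sum_single)
qed

lemma keys_embed_var: "Poly_Mapping.keys (embed_var i p) \<subseteq> Poly_Mapping.single i ` Poly_Mapping.keys p"
  unfolding embed_var_def using keys_lin_ext by fastforce

lemma sum_single_lookup:
  fixes n :: nat
  assumes "Poly_Mapping.keys a \<subseteq> {..<n}"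
  shows "(\<Sum>i<n. Poly_Mapping.single i (Poly_Mapping.lookup a i)) = a"
proof (rule poly_mapping_eqI)
  fix k
  show "Poly_Mapping.lookup (\<Sum>i<n. Poly_Mapping.single i (Poly_Mapping.lookup a i)) k = Poly_Mapping.lookup a k"
    using assms by (cases "k < n") (auto simp: lookup_sum lookup_single when_def in_keys_iff)
qed

lemma prod_single:
  "(\<Prod>i\<in>A. Poly_Mapping.single (f i) (1 :: 'k::comm_ring_1)) =
    Poly_Mapping.single (\<Sum>i\<in>A. f i) (1 :: 'k)"
  for f :: "'i \<Rightarrow> 'e::comm_monoid_add"
  by (induction A rule: infinite_finite_induct) (simp_all add: mult_single)

lemma keys_prod_embed_var:
  assumes "\<And>i. i < n \<Longrightarrow> Poly_Mapping.keys (m i) \<subseteq> koszul_exponents1 (d i)"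
  shows "Poly_Mapping.keys (\<Prod>i<n. embed_var i (m i)) \<subseteq> koszul_exponents n d"
  using assms
proof (induction n)
  case 0
  then show ?case
    by (auto simp: koszul_exponents_def orthant_zero)
next
  case (Suc n)
  have "a + Poly_Mapping.single n b \<in> koszul_exponents (Suc n) d"
    if a: "a \<in> koszul_exponents n d" and b: "b \<in> koszul_exponents1 (d n)" for a b
  proof -
    \<comment> \<open>The variable added in this step is new to \<open>a\<close>, so the sum has
      coordinate \<open>b\<close> there and the old coordinates elsewhere.\<close>
    have "Poly_Mapping.lookup a n = 0" "\<And>i. 0 \<le> Poly_Mapping.lookup a i"
      using a by (auto simp: koszul_exponents_def orthant_def in_keys_iff)
    moreover have "0 \<le> b"
      using b by (auto simp: koszul_exponents1_def split: if_splits)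
    ultimately show ?thesis
      using a b keys_add[of a "Poly_Mapping.single n b"]
      by (auto simp: koszul_exponents_def orthant_def lookup_add lookup_single when_def less_Suc_eq
          split: if_splits)
  qed
  moreover have "Poly_Mapping.keys (\<Prod>i<Suc n. embed_var i (m i)) \<subseteq>
      {a + b |a b. a \<in> Poly_Mapping.keys (\<Prod>i<n. embed_var i (m i)) \<and> b \<in> Poly_Mapping.keys (embed_var n (m n))}"
    using keys_mult[of "\<Prod>i<n. embed_var i (m i)" "embed_var n (m n)"] by simp
  moreover have "Poly_Mapping.keys (embed_var n (m n)) \<subseteq> Poly_Mapping.single n ` koszul_exponents1 (d n)"
    using keys_embed_var[of n "m n"] Suc.prems[of n] by blast
  moreover have "Poly_Mapping.keys (\<Prod>i<n. embed_var i (m i)) \<subseteq> koszul_exponents n d"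
    using Suc by simp
  ultimately show ?case by blast
qed

lemma tensor_eval_keys:
  assumes "t \<in> carrier (koszul_tuples n d)"
  shows "tensor_eval n t \<in> koszul_ideal n d"
proof -
  have "Poly_Mapping.keys (\<Prod>i<n. embed_var i (m i)) \<subseteq> koszul_exponents n d"
    if "m \<in> Poly_Mapping.keys t" for m
    using assms that by (intro keys_prod_embed_var) (auto simp: carrier_koszul_tuples PiE_iff)
  then show ?thesis
    unfolding koszul_ideal_def tensor_eval_def using keys_lin_ext by fastforce
qed

lemma tensor_expand_carrier:
  assumes "p \<in> koszul_ideal n d"
  shows "tensor_expand n p \<in> carrier (koszul_tuples n d)"
proof -
  have "Poly_Mapping.keys (tensor_expand n p) \<subseteq>
      (\<lambda>a. \<lambda>i\<in>{..<n}. Poly_Mapping.single (Poly_Mapping.lookup a i) 1) ` Poly_Mapping.keys p"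
    unfolding tensor_expand_def by (rule order.trans[OF keys_lin_ext]) auto
  also have "\<dots> \<subseteq> (\<Pi>\<^sub>E i\<in>{..<n}. {p. Poly_Mapping.keys p \<subseteq> koszul_exponents1 (d i)})"
    using assms by (auto simp: koszul_ideal_def koszul_exponents_def split: if_splits)
  finally show ?thesis
    by (simp add: carrier_koszul_tuples)
qed

lemma tensor_eval_expand:
  assumes "p \<in> koszul_ideal n d"
  shows "tensor_eval n (tensor_expand n p) = p"
proof -
  have monomial: "tensor_eval n (tensor_expand n (Poly_Mapping.single a c)) = Poly_Mapping.single a c"
    if "a \<in> Poly_Mapping.keys p" for a c
  proof -
    have "Poly_Mapping.keys a \<subseteq> {..<n}"
      using assms that by (auto simp: koszul_ideal_def koszul_exponents_def orthant_def)
    then show ?thesis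
      by (simp add: tensor_eval_def tensor_expand_def lin_ext_single map_scale_simps embed_var_single
          prod_single sum_single_lookup)
  qed
  have "tensor_eval n (tensor_expand n p) = (\<Sum>a\<in>Poly_Mapping.keys p.
      tensor_eval n (tensor_expand n (Poly_Mapping.single a (Poly_Mapping.lookup p a))))"
    by (subst poly_mapping_eq_sum_single) (simp add: tensor_eval_def tensor_expand_def lin_ext_sum)
  also have "\<dots> = p"
    by (simp add: monomial flip: poly_mapping_eq_sum_single)
  finally show ?thesis .
qed

text \<open>Isolating the factor that a multilinearity relation changes shows evaluation to be
  linear in that factor.\<close>

lemma prod_embed_var_upd:
  fixes m :: "nat \<Rightarrow> (real \<Rightarrow>\<^sub>0 'k::field)"
  assumes "i < n"
  shows "(\<Prod>j<n. embed_var j ((m(i := x)) j)) = embed_var i x * (\<Prod>j\<in>{..<n} - {i}. embed_var j (m j))"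
proof -
  have "(\<Prod>j<n. embed_var j ((m(i := x)) j)) =
      embed_var i ((m(i := x)) i) * (\<Prod>j\<in>{..<n} - {i}. embed_var j ((m(i := x)) j))"
    using assms by (intro prod.remove) auto
  also have "(\<Prod>j\<in>{..<n} - {i}. embed_var j ((m(i := x)) j)) = (\<Prod>j\<in>{..<n} - {i}. embed_var j (m j))"
    by (intro prod.cong) auto
  finally show ?thesis by simp
qed

section \<open>The kernel of evaluation\<close>

lemma tensor_eval_single:
  "tensor_eval n (Poly_Mapping.single m c) = Poly_Mapping.single 0 c * (\<Prod>i<n. embed_var i (m i))"
  by (simp add: tensor_eval_def lin_ext_single mult_map_scale_conv_mult)

lemma tensor_eval_diff: "tensor_eval n (s - t) = tensor_eval n s - tensor_eval n t"
  by (simp add: tensor_eval_def lin_ext_diff)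

lemma tensor_eval_relations:
  assumes "s \<in> koszul_relations n d"
  shows "tensor_eval n s = 0"
  using assms
proof (induction rule: multilinear_relations.induct)
  case zero
  then show ?case by (simp add: tensor_eval_def lin_ext_0)
next
  case (plus s t)
  then show ?case by (simp add: tensor_eval_def lin_ext_add)
next
  case (scale s c)
  then show ?case by (simp add: tensor_eval_def lin_ext_scale map_scale_simps)
next
  case (additive m i x y)
  then show ?case
    by (simp add: tensor_eval_single tensor_eval_diff prod_embed_var_upd embed_var_add
        open_koszul1_simps distrib_right del: fun_upd_apply)
next
  case (homogeneous m i x c)
  then show ?case
    by (simp add: tensor_eval_single tensor_eval_diff prod_embed_var_upd embed_var_single_mult
        open_koszul1_simps mult.assoc del: fun_upd_apply)
qed

lemma koszul_relations_carrier:
  assumes "s \<in> koszul_relations n d"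
  shows "s \<in> carrier (koszul_tuples n d)"
  using assms
proof (induction rule: multilinear_relations.induct)
  case zero
  then show ?case by (simp add: carrier_koszul_tuples)
next
  case (plus s t)
  then show ?case
    unfolding carrier_koszul_tuples using keys_add[of s t] by blast
next
  case (scale s c)
  moreover have "Poly_Mapping.keys (Poly_Mapping.map ((*) c) s) \<subseteq> Poly_Mapping.keys s"
    by (auto simp: in_keys_iff lookup_map_scale)
  ultimately show ?case
    unfolding carrier_koszul_tuples by blast
next
  case (additive m i x y)
  then show ?case
    unfolding carrier_koszul_tuples
    by (auto simp: PiE_iff extensional_def open_koszul1_simps subset_iff split: if_splits
        dest!: subsetD[OF keys_diff] subsetD[OF keys_add])
next
  case (homogeneous m i x c)
  then show ?case
    unfolding carrier_koszul_tuples
    by (auto simp: PiE_iff extensional_def open_koszul1_simps subset_iff split: if_splits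
        dest!: subsetD[OF keys_diff] subsetD[OF keys_mult])
qed

lemma koszul_relations_closed:
  shows "s \<in> koszul_relations n d \<Longrightarrow> t \<in> koszul_relations n d \<Longrightarrow> s - t \<in> koszul_relations n d"
    and "(\<And>x. x \<in> A \<Longrightarrow> f x \<in> koszul_relations n d) \<Longrightarrow> sum f A \<in> koszul_relations n d"
proof -
  show "s - t \<in> koszul_relations n d" if "s \<in> koszul_relations n d" "t \<in> koszul_relations n d" for s t
    using multilinear_relations.plus[OF that(1) multilinear_relations.scale[OF that(2), of "- 1"]]
    by (simp add: map_scale_simps)
  show "(\<And>x. x \<in> A \<Longrightarrow> f x \<in> koszul_relations n d) \<Longrightarrow> sum f A \<in> koszul_relations n d"
    by (induction A rule: infinite_finite_induct) (auto intro: multilinear_relations.intros)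
qed

text \<open>The induction is on the number \<open>k\<close> of leading entries that may be
  arbitrary; the later ones are monomials with coefficient 1. For \<open>k = 0\<close> the tuple
  equals the expansion of its product. In the step, entry \<open>k\<close> is written as the sum of
  its terms, which additivity separates and homogeneity makes monic.\<close>

lemma tuple_expand_relation:
  fixes m :: "nat \<Rightarrow> (real \<Rightarrow>\<^sub>0 'k::field)"
  assumes "k \<le> n" "m \<in> (\<Pi>\<^sub>E i\<in>{..<n}. carrier (chains open_koszul1 (d i)))"
    and "\<And>i. k \<le> i \<Longrightarrow> i < n \<Longrightarrow> \<exists>b. m i = Poly_Mapping.single b 1"
  shows "Poly_Mapping.single m 1 - tensor_expand n (\<Prod>i<n. embed_var i (m i)) \<in> koszul_relations n d"
  using assms
proof (induction k arbitrary: m)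
  case 0
  then have "\<forall>i\<in>{..<n}. \<exists>b. m i = Poly_Mapping.single b 1"
    by auto
  from bchoice[OF this] obtain b where b: "\<And>i. i < n \<Longrightarrow> m i = Poly_Mapping.single (b i) 1"
    by auto
  let ?a = "\<Sum>i<n. Poly_Mapping.single i (b i)"
  have "(\<Prod>i<n. embed_var i (m i)) = Poly_Mapping.single ?a 1"
    by (simp add: b embed_var_single prod_single)
  moreover have "(\<lambda>i\<in>{..<n}. Poly_Mapping.single (Poly_Mapping.lookup ?a i) 1) = m"
  proof
    fix i
    show "(\<lambda>i\<in>{..<n}. Poly_Mapping.single (Poly_Mapping.lookup ?a i) 1) i = m i"
      using b PiE_arb[OF 0(2), of i] by (cases "i < n") (auto simp: lookup_sum lookup_single when_def)
  qed
  ultimately show ?case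
    by (simp add: tensor_expand_def lin_ext_single map_scale_simps multilinear_relations.zero)
next
  case (Suc k)
  let ?\<delta> = "\<lambda>m. Poly_Mapping.single m 1 - tensor_expand n (\<Prod>i<n. embed_var i (m i))"
  have k: "k < n" using Suc.prems by simp
  have mk: "Poly_Mapping.keys (m k) \<subseteq> koszul_exponents1 (d k)"
    using Suc.prems(2) k by (auto simp: open_koszul1_simps PiE_iff)
  have upd: "m(k := x) \<in> (\<Pi>\<^sub>E i\<in>{..<n}. carrier (chains open_koszul1 (d i)))"
    if "x \<in> carrier (chains open_koszul1 (d k))" for x
    using Suc.prems(2) k that by (auto simp: PiE_iff extensional_def)
  \<comment> \<open>The alternative \<open>c = 0\<close> asks nothing of the tuple with entry
    \<open>x\<close>. It provides the tuple with entry zero, which starts the sum over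
    terms.\<close>
  have hom: "?\<delta> (m(k := Poly_Mapping.single 0 c * x)) \<in> koszul_relations n d"
    if x: "x \<in> carrier (chains open_koszul1 (d k))" and c: "c = 0 \<or> ?\<delta> (m(k := x)) \<in> koszul_relations n d" for x c
  proof -
    have 1: "Poly_Mapping.single (m(k := Poly_Mapping.single 0 c * x)) 1 - Poly_Mapping.single (m(k := x)) c
        \<in> koszul_relations n d"
      using multilinear_relations.homogeneous[of m n "\<lambda>i. chains open_koszul1 (d i)" k x c] Suc.prems(2) k x
      by (simp add: open_koszul1_simps)
    have 2: "Poly_Mapping.map ((*) c) (?\<delta> (m(k := x))) \<in> koszul_relations n d"
      using c by (auto simp: map_scale_simps(2) intro: multilinear_relations.intros)
    have "tensor_expand n (\<Prod>i<n. embed_var i ((m(k := Poly_Mapping.single 0 c * x)) i)) =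
        Poly_Mapping.map ((*) c) (tensor_expand n (\<Prod>i<n. embed_var i ((m(k := x)) i)))"
      unfolding prod_embed_var_upd[OF k] embed_var_single_mult tensor_expand_def lin_ext_scale[symmetric]
        mult_map_scale_conv_mult by (simp add: mult.assoc)
    then show ?thesis
      using multilinear_relations.plus[OF 1 2] by (simp add: map_scale_simps)
  qed
  \<comment> \<open>A partial sum over a set \<open>S\<close> of exponents replaces entry
    \<open>k\<close>, so that terms can be added one at a time; the full support restores the
    original entry.\<close>
  have "?\<delta> (m(k := \<Sum>b\<in>S. Poly_Mapping.single b (Poly_Mapping.lookup (m k) b))) \<in> koszul_relations n d"
    if "finite S" "S \<subseteq> Poly_Mapping.keys (m k)" for S
    using that
  proof (induction S rule: finite_induct)
    case empty
    show ?case
      using hom[of 0 0] by (simp add: open_koszul1_simps del: fun_upd_apply)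
  next
    case (insert b S)
    let ?y = "\<Sum>b\<in>S. Poly_Mapping.single b (Poly_Mapping.lookup (m k) b)"
    let ?x = "Poly_Mapping.single b (Poly_Mapping.lookup (m k) b)"
    have b: "Poly_Mapping.single b 1 \<in> carrier (chains open_koszul1 (d k))"
      using insert.prems mk by (auto simp: open_koszul1_simps)
    \<comment> \<open>Entry \<open>k\<close> is now a monic monomial as well, so the hypothesis for
      one fewer arbitrary entry applies.\<close>
    have "?\<delta> (m(k := Poly_Mapping.single b 1)) \<in> koszul_relations n d"
    proof (rule Suc.IH)
      show "m(k := Poly_Mapping.single b 1) \<in> (\<Pi>\<^sub>E i\<in>{..<n}. carrier (chains open_koszul1 (d i)))"
        by (rule upd[OF b])
      fix i assume "k \<le> i" "i < n"
      then show "\<exists>b'. (m(k := Poly_Mapping.single b 1)) i = Poly_Mapping.single b' 1"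
        using Suc.prems(3)[of i] by (cases "i = k") auto
    qed (use k in simp)
    then have x: "?\<delta> (m(k := ?x)) \<in> koszul_relations n d"
      using hom[OF b, of "Poly_Mapping.lookup (m k) b"] by (simp add: mult_single del: fun_upd_apply)
    have xc: "?x \<in> carrier (chains open_koszul1 (d k))"
      using insert.prems mk by (auto simp: open_koszul1_simps)
    have yc: "?y \<in> carrier (chains open_koszul1 (d k))"
      using insert.prems mk by (auto simp: open_koszul1_simps dest!: subsetD[OF keys_sum] split: if_splits)
    have "Poly_Mapping.single (m(k := ?x + ?y)) 1 - Poly_Mapping.single (m(k := ?x)) 1
        - Poly_Mapping.single (m(k := ?y)) 1 \<in> koszul_relations n d"
      using multilinear_relations.additive[of m n "\<lambda>i. chains open_koszul1 (d i)" k ?x ?y] Suc.prems(2) k xc yc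
      by (simp add: open_koszul1_simps)
    moreover have "tensor_expand n (\<Prod>i<n. embed_var i ((m(k := ?x + ?y)) i)) =
        tensor_expand n (\<Prod>i<n. embed_var i ((m(k := ?x)) i)) +
        tensor_expand n (\<Prod>i<n. embed_var i ((m(k := ?y)) i))"
      unfolding prod_embed_var_upd[OF k] embed_var_add tensor_expand_def
      by (simp add: distrib_right lin_ext_add)
    moreover have "?\<delta> (m(k := ?y)) \<in> koszul_relations n d"
      using insert by (simp del: fun_upd_apply)
    ultimately have "?\<delta> (m(k := ?x + ?y)) \<in> koszul_relations n d"
      using multilinear_relations.plus[OF multilinear_relations.plus[OF _ x]] by (fastforce simp: algebra_simps)
    then show ?case
      using insert by (simp del: fun_upd_apply)
  qed
  from this[of "Poly_Mapping.keys (m k)"] show ?case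
    by (simp del: fun_upd_apply flip: poly_mapping_eq_sum_single)
qed

text \<open>By linearity \<open>t\<close> is congruent, modulo relations, to the expansion of its
  evaluation. If the evaluation vanishes, so does the expansion, and \<open>t\<close> is itself a
  relation.\<close>

lemma koszul_relations_eq_kernel:
  "koszul_relations n d = {t \<in> carrier (koszul_tuples n d). tensor_eval n t = 0}"
proof
  show "koszul_relations n d \<subseteq> {t \<in> carrier (koszul_tuples n d). tensor_eval n t = 0}"
    using tensor_eval_relations koszul_relations_carrier by blast
  show "{t \<in> carrier (koszul_tuples n d). tensor_eval n t = 0} \<subseteq> koszul_relations n d"
  proof safe
    fix t assume t: "t \<in> carrier (koszul_tuples n d)" and T: "tensor_eval n t = 0"
    let ?c = "Poly_Mapping.lookup t"
    have "(\<Sum>m\<in>Poly_Mapping.keys t. Poly_Mapping.map ((*) (?c m))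
        (Poly_Mapping.single m 1 - tensor_expand n (\<Prod>i<n. embed_var i (m i)))) \<in> koszul_relations n d"
    proof (intro koszul_relations_closed(2) multilinear_relations.scale
        tuple_expand_relation[where k = n])
      fix m assume "m \<in> Poly_Mapping.keys t"
      then show "m \<in> (\<Pi>\<^sub>E i\<in>{..<n}. carrier (chains open_koszul1 (d i)))"
        using t by (auto simp: carrier_koszul_tuples open_koszul1_simps)
    qed auto
    also have "(\<Sum>m\<in>Poly_Mapping.keys t. Poly_Mapping.map ((*) (?c m))
        (Poly_Mapping.single m 1 - tensor_expand n (\<Prod>i<n. embed_var i (m i)))) =
      (\<Sum>m\<in>Poly_Mapping.keys t. Poly_Mapping.single m (?c m)) - tensor_expand n (tensor_eval n t)"
      by (simp add: map_scale_simps sum_subtractf tensor_expand_def tensor_eval_def lin_ext_sum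
          lin_ext_scale lin_ext_def[of _ t])
    finally show "t \<in> koszul_relations n d"
      by (simp add: T tensor_expand_def lin_ext_0 flip: poly_mapping_eq_sum_single)
  qed
qed

text \<open>A monomial acts on every entry of a tuple by its own coordinate, and the product of
  these one-variable powers is the monomial again. Closure and compatibility with evaluation are all
  that \<open>quot_module_iso\<close> asks of this action; the module axioms come from the
  ideal.\<close>

lemma koszul_tuples_smult:
  assumes r: "r \<in> carrier (real_poly_ring n)" and t: "t \<in> carrier (koszul_tuples n d)"
  shows "r \<odot>\<^bsub>koszul_tuples n d\<^esub> t \<in> carrier (koszul_tuples n d)"
    and "tensor_eval n (r \<odot>\<^bsub>koszul_tuples n d\<^esub> t) = r * tensor_eval n t"
proof -
  let ?r = "Poly_Mapping.lookup r" and ?t = "Poly_Mapping.lookup t"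
  let ?m = "\<lambda>a m. \<lambda>i\<in>{..<n}. Poly_Mapping.single (Poly_Mapping.lookup a i) 1 * m i"
  let ?P = "\<Pi>\<^sub>E i\<in>{..<n}. {p. Poly_Mapping.keys p \<subseteq> koszul_exponents1 (d i)}"
  have smult: "r \<odot>\<^bsub>koszul_tuples n d\<^esub> t =
      (\<Sum>a\<in>Poly_Mapping.keys r. \<Sum>m\<in>Poly_Mapping.keys t. Poly_Mapping.single (?m a m) (?r a * ?t m))"
    by (simp add: tuple_module_def open_koszul1_simps)
  have orth: "Poly_Mapping.keys a \<subseteq> {..<n}" "0 \<le> Poly_Mapping.lookup a i"
    if "a \<in> Poly_Mapping.keys r" for a i
    using r that by (auto simp: carrier_real_poly_ring orthant_def)
  have mP: "?m a m \<in> ?P" if a: "a \<in> Poly_Mapping.keys r" and m: "m \<in> Poly_Mapping.keys t" for a m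
  proof -
    have "Poly_Mapping.keys (Poly_Mapping.single (Poly_Mapping.lookup a i) 1 * m i) \<subseteq> koszul_exponents1 (d i)"
      if i: "i < n" for i
    proof -
      have "Poly_Mapping.keys (m i) \<subseteq> koszul_exponents1 (d i)"
        using t m i by (auto simp: carrier_koszul_tuples PiE_iff)
      then show ?thesis
        using orth(2)[OF a, of i] koszul_exponents1_add
          keys_mult[of "Poly_Mapping.single (Poly_Mapping.lookup a i) 1" "m i"]
        by fastforce
    qed
    then show ?thesis
      by (simp add: restrict_PiE_iff)
  qed
  have "(\<Union>a\<in>Poly_Mapping.keys r. \<Union>m\<in>Poly_Mapping.keys t.
      Poly_Mapping.keys (Poly_Mapping.single (?m a m) (?r a * ?t m))) \<subseteq> ?P"
  proof (intro UN_least)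
    fix a m assume "a \<in> Poly_Mapping.keys r" "m \<in> Poly_Mapping.keys t"
    from mP[OF this] show "Poly_Mapping.keys (Poly_Mapping.single (?m a m) (?r a * ?t m)) \<subseteq> ?P"
      unfolding keys_single by (simp only: insert_subset empty_subsetI split: if_split) blast
  qed
  moreover have "Poly_Mapping.keys (r \<odot>\<^bsub>koszul_tuples n d\<^esub> t) \<subseteq>
      (\<Union>a\<in>Poly_Mapping.keys r. \<Union>m\<in>Poly_Mapping.keys t.
      Poly_Mapping.keys (Poly_Mapping.single (?m a m) (?r a * ?t m)))"
    unfolding smult by (rule order.trans[OF keys_sum UN_mono[OF order.refl keys_sum]])
  ultimately show "r \<odot>\<^bsub>koszul_tuples n d\<^esub> t \<in> carrier (koszul_tuples n d)"
    unfolding carrier_koszul_tuples by simp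
  have monomial: "tensor_eval n (Poly_Mapping.single (?m a m) (?r a * ?t m)) =
      Poly_Mapping.single a (?r a) * Poly_Mapping.map ((*) (?t m)) (\<Prod>i<n. embed_var i (m i))"
    if "a \<in> Poly_Mapping.keys r" for a m
  proof -
    have "(\<Prod>i<n. embed_var i (?m a m i)) =
        (\<Prod>i<n. Poly_Mapping.single (Poly_Mapping.single i (Poly_Mapping.lookup a i)) 1 * embed_var i (m i))"
      by (intro prod.cong) (simp_all add: embed_var_single_mult)
    also have "\<dots> = Poly_Mapping.single a 1 * (\<Prod>i<n. embed_var i (m i))"
      using orth(1)[OF that] by (simp add: prod.distrib prod_single sum_single_lookup)
    finally have "tensor_eval n (Poly_Mapping.single (?m a m) (?r a * ?t m)) =
        (Poly_Mapping.single 0 (?r a * ?t m) * Poly_Mapping.single a 1) * (\<Prod>i<n. embed_var i (m i))"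
      by (simp add: tensor_eval_single mult.assoc del: restrict_apply)
    also have "Poly_Mapping.single 0 (?r a * ?t m) * Poly_Mapping.single a 1 =
        Poly_Mapping.single a (?r a) * Poly_Mapping.single 0 (?t m)"
      by (simp add: mult_single)
    finally show ?thesis
      by (simp add: mult_map_scale_conv_mult mult.assoc del: restrict_apply)
  qed
  have "tensor_eval n (r \<odot>\<^bsub>koszul_tuples n d\<^esub> t) =
      (\<Sum>a\<in>Poly_Mapping.keys r. Poly_Mapping.single a (?r a)) * tensor_eval n t"
    unfolding smult
    by (simp add: tensor_eval_def lin_ext_sum lin_ext_def[of _ t] sum_product
        monomial[unfolded tensor_eval_def] del: restrict_apply)
  then show "tensor_eval n (r \<odot>\<^bsub>koszul_tuples n d\<^esub> t) = r * tensor_eval n t"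
    by (simp flip: poly_mapping_eq_sum_single)
qed

text \<open>The inverse of the isomorphism induced by evaluation: the fibre over \<open>p\<close> is
  a single coset of the relations.\<close>

definition tensor_coset ::
    "nat \<Rightarrow> (nat \<Rightarrow> nat) \<Rightarrow> ((nat \<Rightarrow>\<^sub>0 real) \<Rightarrow>\<^sub>0 'k::field) \<Rightarrow> ((nat \<Rightarrow> (real \<Rightarrow>\<^sub>0 'k)) \<Rightarrow>\<^sub>0 'k) set"
  where "tensor_coset n d p = {t \<in> carrier (koszul_tuples n d). tensor_eval n t = p}"

lemma tensor_eval_surj: "tensor_eval n ` carrier (koszul_tuples n d) = koszul_ideal n d"
proof (intro equalityI subsetI)
  fix p assume p: "p \<in> koszul_ideal n d"
  show "p \<in> tensor_eval n ` carrier (koszul_tuples n d)"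
    by (rule image_eqI[where x = "tensor_expand n p"])
      (simp_all only: tensor_eval_expand[OF p] tensor_expand_carrier[OF p])
qed (auto simp: tensor_eval_keys)

lemma tensor_coset_iso:
  fixes n :: nat and d :: "nat \<Rightarrow> nat"
  defines "N \<equiv> field_tensor n (\<lambda>i. chains (open_koszul1 ::
    (real \<Rightarrow>\<^sub>0 'k::field, real \<Rightarrow>\<^sub>0 'k) chain_complex) (d i))"
  shows "tensor_coset n d \<in> mod_hom (real_poly_ring n) (koszul_module n d) N"
    and "bij_betw (tensor_coset n d) (carrier (koszul_module n d)) (carrier N)"
    and "tensor_coset n d 0 = \<zero>\<^bsub>N\<^esub>"
    and "module (real_poly_ring n) N"
proof -
  have T: "tensor_eval n \<in> mod_hom (real_poly_ring n) (koszul_tuples n d) (koszul_module n d)"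
    by (rule mod_homI)
      (auto simp: koszul_module_simps koszul_tuples_simps tensor_eval_keys koszul_tuples_smult,
       simp add: tensor_eval_def lin_ext_add)
  have surj: "tensor_eval n ` carrier (koszul_tuples n d) = carrier (koszul_module n d)"
    by (simp only: tensor_eval_surj koszul_module_simps)
  have ker: "koszul_relations n d = {t \<in> carrier (koszul_tuples n d). tensor_eval n t = \<zero>\<^bsub>koszul_module n d\<^esub>}"
    unfolding koszul_relations_eq_kernel koszul_module_simps ..
  have coset: "tensor_coset n d = (\<lambda>p. {t \<in> carrier (koszul_tuples n d). tensor_eval n t = p})"
    by (simp add: fun_eq_iff tensor_coset_def)
  note iso = quot_module_iso[OF module_koszul abelian_group_koszul_tuples _ T surj ker, folded coset]
  show "tensor_coset n d \<in> mod_hom (real_poly_ring n) (koszul_module n d) N"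
    unfolding N_def field_tensor_def by (rule iso(1)) (rule koszul_tuples_smult(1))
  show "bij_betw (tensor_coset n d) (carrier (koszul_module n d)) (carrier N)"
    unfolding N_def field_tensor_def by (rule iso(2)) (rule koszul_tuples_smult(1))
  have "tensor_coset n d \<zero>\<^bsub>koszul_module n d\<^esub> = \<zero>\<^bsub>N\<^esub>"
    unfolding N_def field_tensor_def coset by (rule quot_module_iso(3)[OF module_koszul abelian_group_koszul_tuples _ T surj ker]) (rule koszul_tuples_smult(1))
  then show "tensor_coset n d 0 = \<zero>\<^bsub>N\<^esub>"
    by (simp add: koszul_module_simps)
  show "module (real_poly_ring n) N"
    unfolding N_def field_tensor_def by (rule iso(4)) (rule koszul_tuples_smult(1))
qed

text \<open>Identifies a coset from any one representative, which is how an induced map of tensor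
  products is computed.\<close>

lemma koszul_relations_coset:
  assumes "t \<in> carrier (koszul_tuples n d)"
  shows "koszul_relations n d +>\<^bsub>koszul_tuples n d\<^esub> t = tensor_coset n d (tensor_eval n t)"
  unfolding koszul_relations_eq_kernel tensor_coset_def
  using abelian_group.a_r_coset_fiber[OF abelian_group_koszul_tuples
      module.axioms(2)[OF module_koszul], of n d "tensor_eval n" n d t] assms
  by (simp add: koszul_module_simps koszul_tuples_simps tensor_eval_keys)
    (simp add: tensor_eval_def lin_ext_add)

section \<open>The complex of monomial ideals\<close>

lemma finite_multidegrees: "finite (multidegrees n p)"
proof (rule finite_subset)
  show "multidegrees n p \<subseteq> (\<Pi>\<^sub>E i\<in>{..<n}. {..p})"
  proof
    fix d assume "d \<in> multidegrees n p"
    then show "d \<in> (\<Pi>\<^sub>E i\<in>{..<n}. {..p})"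
      by (intro PiE_I) (auto simp: multidegrees_def intro!: member_le_sum)
  qed
qed (simp add: finite_PiE)

text \<open>The old entry is added on the left instead of subtracted on the right, which avoids
  truncated subtraction.\<close>

lemma sum_fun_upd:
  fixes e :: "nat \<Rightarrow> nat"
  assumes "i < n"
  shows "(\<Sum>j<n. (e(i := x)) j) + e i = (\<Sum>j<n. e j) + x"
proof -
  have "(\<Sum>j<n. (e(i := x)) j) = x + (\<Sum>j\<in>{..<n} - {i}. e j)"
    using assms by (subst sum.remove[of _ i]) auto
  moreover have "(\<Sum>j<n. e j) = e i + (\<Sum>j\<in>{..<n} - {i}. e j)"
    using assms by (intro sum.remove) auto
  ultimately show ?thesis by simp
qed

lemma multidegrees_Suc:
  assumes "e \<in> multidegrees n p" "i < n"
  shows "e(i := Suc (e i)) \<in> multidegrees n (Suc p)"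
  using assms sum_fun_upd[OF assms(2), of e "Suc (e i)"]
  by (auto simp: multidegrees_def PiE_iff extensional_def)

lemma multidegrees_drop:
  assumes "e \<in> multidegrees n (Suc p)" "i < n" "e i = 1"
  shows "e(i := 0) \<in> multidegrees n p"
  using assms sum_fun_upd[OF assms(2), of e 0]
  by (auto simp: multidegrees_def PiE_iff extensional_def)

lemma multidegrees_0: "multidegrees n 0 = {\<lambda>i\<in>{..<n}. 0}"
  by (auto simp: multidegrees_def PiE_iff extensional_def restrict_def fun_eq_iff)

lemma koszul_ideal_exponent:
  "p \<in> koszul_ideal n d \<Longrightarrow> Poly_Mapping.lookup p a \<noteq> 0 \<Longrightarrow> a \<in> koszul_exponents n d"
  by (auto simp: koszul_ideal_def in_keys_iff)

lemma koszul_exponents_Suc: "koszul_exponents n (e(i := Suc (e i))) \<subseteq> koszul_exponents n e"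
proof
  fix a assume a: "a \<in> koszul_exponents n (e(i := Suc (e i)))"
  have "Poly_Mapping.lookup a j \<in> koszul_exponents1 (e j)" if "j < n" for j
  proof (cases "j = i")
    case True
    then have "Poly_Mapping.lookup a i \<in> koszul_exponents1 (Suc (e i))"
      using a that by (auto simp: koszul_exponents_def)
    then show ?thesis
      using True by (auto simp: koszul_exponents1_def split: if_splits)
  next
    case False
    have "Poly_Mapping.lookup a j \<in> koszul_exponents1 ((e(i := Suc (e i))) j)"
      using a that unfolding koszul_exponents_def by blast
    then show ?thesis
      using False by simp
  qed
  then show "a \<in> koszul_exponents n e"
    using a by (simp add: koszul_exponents_def)
qed

lemma koszul_ideal_Suc: "koszul_ideal n (e(i := Suc (e i))) \<subseteq> koszul_ideal n e"
  using koszul_exponents_Suc by (fastforce simp: koszul_ideal_def)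

text \<open>Multidegrees are arbitrary functions, while only those with entries 0 and 1, the subsets
  of the variables, carry anything: one zero factor annihilates the tensor product.\<close>

lemma koszul_ideal_trivial:
  assumes "i < n" "2 \<le> d i" "p \<in> koszul_ideal n d"
  shows "p = 0"
proof -
  have "koszul_exponents n d = {}"
    using assms(1,2) by (auto simp: koszul_exponents_def koszul_exponents1_def split: if_splits)
  then show ?thesis
    using assms(3) by (auto simp: koszul_ideal_def intro!: poly_mapping_eqI simp: in_keys_iff)
qed

text \<open>The exponent 0 violates positivity at \<open>i\<close>. Hence its strand lives in
  multidegree zero alone, which is where the residue field comes from.\<close>

lemma koszul_ideal_lookup_0:
  assumes "i < n" "d i \<noteq> 0" "p \<in> koszul_ideal n d"
  shows "Poly_Mapping.lookup p 0 = 0"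
proof -
  have "0 \<notin> koszul_exponents n d"
    using assms(1,2) by (auto simp: koszul_exponents_def koszul_exponents1_def split: if_splits)
  then show ?thesis
    using assms(3) by (auto simp: koszul_ideal_def in_keys_iff)
qed

section \<open>The boundary of the complex of ideals\<close>

lemma lookup_sign_mult:
  "Poly_Mapping.lookup ((- 1) ^ k * p) a = (- 1) ^ k * Poly_Mapping.lookup p a"
  for p :: "'e::comm_monoid_add \<Rightarrow>\<^sub>0 'k::comm_ring_1"
  by (cases "even k") simp_all

lemma koszul_ideal_closed:
  fixes p q :: "(nat \<Rightarrow>\<^sub>0 real) \<Rightarrow>\<^sub>0 'k::field" and f :: "'i \<Rightarrow> (nat \<Rightarrow>\<^sub>0 real) \<Rightarrow>\<^sub>0 'k"
  shows "0 \<in> koszul_ideal n d"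
    and "p \<in> koszul_ideal n d \<Longrightarrow> q \<in> koszul_ideal n d \<Longrightarrow> p + q \<in> koszul_ideal n d"
    and "p \<in> koszul_ideal n d \<Longrightarrow> (- 1) ^ k * p \<in> koszul_ideal n d"
    and "(\<And>x. x \<in> A \<Longrightarrow> f x \<in> koszul_ideal n d) \<Longrightarrow> sum f A \<in> koszul_ideal n d"
proof -
  show 0: "0 \<in> koszul_ideal n d"
    by (simp add: koszul_ideal_def)
  show add: "p + q \<in> koszul_ideal n d" if "p \<in> koszul_ideal n d" "q \<in> koszul_ideal n d"
    for p q :: "(nat \<Rightarrow>\<^sub>0 real) \<Rightarrow>\<^sub>0 'k"
    using that keys_add[of p q] by (auto simp: koszul_ideal_def)
  show "(- 1) ^ k * p \<in> koszul_ideal n d" if "p \<in> koszul_ideal n d"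
    using that by (auto simp: koszul_ideal_def subset_iff in_keys_iff lookup_sign_mult)
  show "(\<And>x. x \<in> A \<Longrightarrow> f x \<in> koszul_ideal n d) \<Longrightarrow> sum f A \<in> koszul_ideal n d"
    by (induction A rule: infinite_finite_induct) (auto simp: 0 add)
qed

text \<open>Generic in the coefficients: the same formula is applied to polynomials and, at a fixed
  exponent, to their coefficients in the field.\<close>

definition koszul_boundary ::
    "nat \<Rightarrow> ((nat \<Rightarrow> nat) \<Rightarrow> 'a) \<Rightarrow> (nat \<Rightarrow> nat) \<Rightarrow> 'a::comm_ring_1"
  where "koszul_boundary n s e = (\<Sum>i<n. (- 1) ^ (\<Sum>j<i. e j) * s (e(i := Suc (e i))))"

definition koszul_complex ::
    "nat \<Rightarrow> ((nat \<Rightarrow>\<^sub>0 real) \<Rightarrow>\<^sub>0 'k::field, (nat \<Rightarrow> nat) \<Rightarrow> (nat \<Rightarrow>\<^sub>0 real) \<Rightarrow>\<^sub>0 'k) chain_complex"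
  where "koszul_complex n =
    \<lparr>chains = (\<lambda>p. finite_direct_sum (multidegrees n p) (koszul_module n)),
     boundary = (\<lambda>p s. restrict (koszul_boundary n s) (multidegrees n p))\<rparr>"

lemma koszul_complex_simps:
  "chains (koszul_complex n) p = finite_direct_sum (multidegrees n p) (koszul_module n)"
  "boundary (koszul_complex n) p s = restrict (koszul_boundary n s) (multidegrees n p)"
  by (simp_all add: koszul_complex_def)

lemma koszul_chains_simps:
  "carrier (chains (koszul_complex n) p) = (\<Pi>\<^sub>E d\<in>multidegrees n p. koszul_ideal n d)"
  "\<zero>\<^bsub>chains (koszul_complex n) p\<^esub> = (\<lambda>d\<in>multidegrees n p. 0)"
  "s \<oplus>\<^bsub>chains (koszul_complex n) p\<^esub> t = (\<lambda>d\<in>multidegrees n p. s d + t d)"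
  "r \<odot>\<^bsub>chains (koszul_complex n) p\<^esub> s = (\<lambda>d\<in>multidegrees n p. r * s d)"
  by (simp_all add: koszul_complex_simps finite_direct_sum_simps koszul_module_simps)

lemma module_koszul_chains: "module (real_poly_ring n) (chains (koszul_complex n) p)"
  unfolding koszul_complex_simps
  by (rule module_finite_direct_sum[OF cring_real_poly_ring module_koszul])

lemma koszul_boundary_mod_hom:
  "boundary (koszul_complex n) p \<in>
    mod_hom (real_poly_ring n) (chains (koszul_complex n) (Suc p)) (chains (koszul_complex n) p)"
proof (rule mod_homI; unfold koszul_chains_simps koszul_complex_simps(2))
  fix s assume s: "s \<in> (\<Pi>\<^sub>E d\<in>multidegrees n (Suc p). koszul_ideal n d)"
  have "koszul_boundary n s e \<in> koszul_ideal n e" if "e \<in> multidegrees n p" for e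
    unfolding koszul_boundary_def
  proof (intro koszul_ideal_closed(4) koszul_ideal_closed(3))
    fix i assume "i \<in> {..<n}"
    then show "s (e(i := Suc (e i))) \<in> koszul_ideal n e"
      using PiE_mem[OF s multidegrees_Suc[OF that]] koszul_ideal_Suc by blast
  qed
  then show "restrict (koszul_boundary n s) (multidegrees n p) \<in> (\<Pi>\<^sub>E d\<in>multidegrees n p. koszul_ideal n d)"
    by auto
next
  fix s t
  show "restrict (koszul_boundary n (\<lambda>d\<in>multidegrees n (Suc p). s d + t d)) (multidegrees n p) =
      (\<lambda>d\<in>multidegrees n p. restrict (koszul_boundary n s) (multidegrees n p) d +
        restrict (koszul_boundary n t) (multidegrees n p) d)"
    by (intro restrict_ext) (simp add: koszul_boundary_def multidegrees_Suc distrib_left sum.distrib)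
next
  fix r s
  show "restrict (koszul_boundary n (\<lambda>d\<in>multidegrees n (Suc p). r * s d)) (multidegrees n p) =
      (\<lambda>d\<in>multidegrees n p. r * restrict (koszul_boundary n s) (multidegrees n p) d)"
    by (intro restrict_ext) (simp add: koszul_boundary_def multidegrees_Suc sum_distrib_left mult.left_commute)
qed

text \<open>Off the diagonal the terms cancel in pairs. The diagonal is a hypothesis of its own,
  since in characteristic 2 antisymmetry says nothing about it.\<close>

lemma antisymmetric_double_sum:
  fixes f :: "nat \<Rightarrow> nat \<Rightarrow> 'a::ab_group_add"
  assumes "\<And>i. i < n \<Longrightarrow> f i i = 0" "\<And>i k. i < k \<Longrightarrow> k < n \<Longrightarrow> f i k = - f k i"
  shows "(\<Sum>i<n. \<Sum>k<n. f i k) = 0"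
  using assms
proof (induction n)
  case 0
  show ?case by simp
next
  case (Suc n)
  have "(\<Sum>i<Suc n. \<Sum>k<Suc n. f i k) = (\<Sum>i<n. \<Sum>k<n. f i k) + (\<Sum>i<n. f i n + f n i) + f n n"
    by (simp add: sum.distrib add_ac)
  also have "(\<Sum>i<n. f i n + f n i) = 0"
    using Suc.prems(2) by (intro sum.neutral) auto
  also have "(\<Sum>i<n. \<Sum>k<n. f i k) = 0"
    by (rule Suc.IH; rule Suc.prems; simp)
  finally show ?case
    by (simp add: Suc.prems(1))
qed

lemma sum_lessThan_upd:
  fixes e :: "nat \<Rightarrow> nat"
  shows "(\<Sum>j<k. (e(i := Suc (e i))) j) = (\<Sum>j<k. e j) + (if i < k then 1 else 0)"
proof (cases "i < k")
  case True
  then show ?thesis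
    using sum_fun_upd[OF True, of e "Suc (e i)"] by simp
next
  case False
  then show ?thesis
    by (auto intro!: sum.cong)
qed

text \<open>Raising two entries in either order reaches the same multidegree with opposite signs,
  because raising the smaller index shifts the sign exponent at the larger one by one. Raising one
  entry twice lands where the ideal is zero.\<close>

lemma koszul_boundary_boundary:
  assumes s: "s \<in> carrier (chains (koszul_complex n) (Suc (Suc p)))"
  shows "boundary (koszul_complex n) p (boundary (koszul_complex n) (Suc p) s) =
    \<zero>\<^bsub>chains (koszul_complex n) p\<^esub>"
  unfolding koszul_complex_simps(2) koszul_chains_simps
proof (rule restrict_ext)
  fix e assume e: "e \<in> multidegrees n p"
  let ?u = "\<lambda>i. e(i := Suc (e i))"
  let ?u2 = "\<lambda>i k. (?u i)(k := Suc (?u i k))"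
  define f where "f i k = (- 1) ^ ((\<Sum>j<i. e j) + (\<Sum>j<k. ?u i j)) * s (?u2 i k)" for i k
  have "koszul_boundary n (restrict (koszul_boundary n s) (multidegrees n (Suc p))) e =
      (\<Sum>i<n. \<Sum>k<n. f i k)"
    unfolding koszul_boundary_def[of n _ e]
    by (intro sum.cong refl)
      (simp add: multidegrees_Suc[OF e] koszul_boundary_def f_def sum_distrib_left power_add mult.assoc
        del: fun_upd_apply)
  also have "\<dots> = 0"
  proof (rule antisymmetric_double_sum)
    fix i assume i: "i < n"
    have "?u2 i i \<in> multidegrees n (Suc (Suc p))"
      by (intro multidegrees_Suc e i)
    then have "s (?u2 i i) \<in> koszul_ideal n (?u2 i i)"
      using s unfolding koszul_chains_simps by (rule PiE_mem[rotated])
    then have "s (?u2 i i) = 0"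
      by (rule koszul_ideal_trivial[OF i, rotated]) simp
    then show "f i i = 0"
      by (simp add: f_def del: fun_upd_apply)
  next
    fix i k assume "i < k" "k < n"
    moreover from this have "?u2 i k = ?u2 k i"
      by (auto simp: fun_eq_iff)
    ultimately show "f i k = - f k i"
      by (simp add: f_def sum_lessThan_upd add.commute del: fun_upd_apply)
  qed
  finally show "koszul_boundary n (restrict (koszul_boundary n s) (multidegrees n (Suc p))) e = 0" .
qed

text \<open>
  The strand of the complex at an exponent whose first nonzero coordinate is \<open>i0\<close> is contracted by
  the map that sends multidegree \<open>d(i0 := 0)\<close> to \<open>d(i0 := 1)\<close>.
\<close>

lemma koszul_homotopy:
  fixes u :: "(nat \<Rightarrow> nat) \<Rightarrow> 'k::comm_ring_1"
  assumes i0: "i0 < n"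
    and below: "\<And>e i. i < i0 \<Longrightarrow> e i \<noteq> 0 \<Longrightarrow> u e = 0" and two: "\<And>e. 2 \<le> e i0 \<Longrightarrow> u e = 0"
  defines "v \<equiv> \<lambda>d. if d i0 = 1 then u (d(i0 := 0)) else 0"
  shows "koszul_boundary n v e + (if e i0 = 1 then koszul_boundary n u (e(i0 := 0)) else 0) = u e"
proof -
  let ?s = "\<lambda>e i. (- 1) ^ (\<Sum>j<i. e j) :: 'k"
  \<comment> \<open>The sign exponent at \<open>i0\<close> sums the entries before
    \<open>i0\<close>. Where \<open>u\<close> is nonzero these all vanish, as \<open>i0\<close> is
    the first index of the support.\<close>
  have sign: "?s e' i0 * u e = u e" if "\<And>j. j < i0 \<Longrightarrow> e' j = e j" for e e' :: "nat \<Rightarrow> nat"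
  proof (cases "\<exists>j<i0. e j \<noteq> 0")
    case True
    then show ?thesis using below by auto
  next
    case False
    then show ?thesis using that by simp
  qed
  have split: "(\<Sum>i<n. g i) = g i0 + (\<Sum>i\<in>{..<n} - {i0}. g i)" for g :: "nat \<Rightarrow> 'k"
    using i0 by (intro sum.remove) auto
  consider "e i0 = 0" | "e i0 = 1" | "2 \<le> e i0" by linarith
  then show ?thesis
  proof cases
    case 1
    then have "e(i0 := 0) = e" by (auto simp: fun_eq_iff)
    then have "v (e(i0 := Suc (e i0))) = u e"
      using 1 by (simp add: v_def)
    moreover have "v (e(i := Suc (e i))) = 0" if "i \<noteq> i0" for i
      using 1 that by (simp add: v_def)
    ultimately show ?thesis
      using 1 sign[of e e] by (simp add: koszul_boundary_def split)
  next
    case 2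
    let ?e = "e(i0 := 0)"
    have "?e(i0 := Suc (?e i0)) = e"
      using 2 by (auto simp: fun_eq_iff)
    then have first: "?s ?e i0 * u (?e(i0 := Suc (?e i0))) = u e"
      using sign[of ?e e] by simp
    have v0: "v (e(i0 := Suc (e i0))) = 0"
      using 2 by (simp add: v_def)
    \<comment> \<open>Away from \<open>i0\<close> the two contributions cancel: for \<open>i\<close>
      below \<open>i0\<close> the strand vanishes, and for \<open>i\<close> beyond \<open>i0\<close>
      lowering the entry at \<open>i0\<close> from 1 to 0 reverses the sign.\<close>
    have "?s e i * v (e(i := Suc (e i))) + ?s ?e i * u (?e(i := Suc (?e i))) = 0" if i: "i \<noteq> i0" for i
    proof -
      have "(e(i := Suc (e i)))(i0 := 0) = ?e(i := Suc (?e i))"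
        using i by (auto simp: fun_eq_iff)
      then have v: "v (e(i := Suc (e i))) = u (?e(i := Suc (?e i)))"
        using 2 i by (simp add: v_def)
      show ?thesis
      proof (cases "i < i0")
        case True
        then have "u (?e(i := Suc (?e i))) = 0"
          using below[of i "?e(i := Suc (?e i))"] by simp
        then show ?thesis by (simp only: v mult_zero_right add_0)
      next
        case False
        then have "(\<Sum>j<i. e j) = Suc (\<Sum>j<i. ?e j)"
          using i 2 sum_fun_upd[of i0 i e 0] by simp
        then have "?s e i = - ?s ?e i"
          by (simp only: power_Suc) simp
        then show ?thesis
          by (simp only: v) simp
      qed
    qed
    then have "(\<Sum>i\<in>{..<n} - {i0}. ?s e i * v (e(i := Suc (e i)))) +
        (\<Sum>i\<in>{..<n} - {i0}. ?s ?e i * u (?e(i := Suc (?e i)))) = 0"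
      unfolding sum.distrib[symmetric] by (intro sum.neutral) auto
    then show ?thesis
      using 2 unfolding koszul_boundary_def split first v0 by (simp add: algebra_simps)
  next
    case 3
    then have "v (e(i := Suc (e i))) = 0" for i
      by (cases "i = i0") (simp_all add: v_def)
    then show ?thesis
      using 3 two by (simp add: koszul_boundary_def)
  qed
qed

text \<open>In degree 0 the condition on constant terms says that the augmentation kills
  \<open>s\<close>; in degree \<open>Suc q\<close> the boundary condition makes it a cycle. Both
  cases are treated together: the contraction is applied to the coefficients at each of the finitely
  many exponents that occur, and the results are reassembled.\<close>

lemma koszul_exact:
  fixes s :: "(nat \<Rightarrow> nat) \<Rightarrow> (nat \<Rightarrow>\<^sub>0 real) \<Rightarrow>\<^sub>0 'k::field"
  assumes s: "s \<in> carrier (chains (koszul_complex n) p)"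
    and s0: "\<And>e. e \<in> multidegrees n p \<Longrightarrow> Poly_Mapping.lookup (s e) 0 = 0"
    and cycle: "\<And>q e. p = Suc q \<Longrightarrow> e \<in> multidegrees n q \<Longrightarrow> koszul_boundary n s e = 0"
  shows "\<exists>h\<in>carrier (chains (koszul_complex n) (Suc p)). boundary (koszul_complex n) p h = s"
proof -
  let ?D = "multidegrees n p"
  have s_mem: "s e \<in> koszul_ideal n e" if "e \<in> ?D" for e
    using s that by (auto simp: koszul_chains_simps)
  define A where "A = (\<Union>e\<in>?D. Poly_Mapping.keys (s e))"
  have A: "finite A"
    using finite_multidegrees by (auto simp: A_def)
  define i0 where "i0 a = Min (Poly_Mapping.keys a)" for a :: "nat \<Rightarrow>\<^sub>0 real"
  \<comment> \<open>\<open>u a\<close> is the strand at the exponent \<open>a\<close>, extended by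
    zero to all functions \<open>e\<close>, since the contraction is stated for arbitrary
    ones.\<close>
  define u where "u a e = (if e \<in> ?D then Poly_Mapping.lookup (s e) a else 0)" for a e
  define v where "v a d = (if d (i0 a) = 1 then u a (d(i0 a := 0)) else 0)" for a d
  have uA: "u a e = 0" if "a \<notin> A" for a e
    using that by (auto simp: u_def A_def in_keys_iff)
  have A_exp: "a \<in> orthant n" "a \<noteq> 0" if aA: "a \<in> A" for a
  proof -
    obtain e where e: "e \<in> ?D" "Poly_Mapping.lookup (s e) a \<noteq> 0"
      using aA by (auto simp: A_def in_keys_iff)
    then show "a \<in> orthant n"
      using koszul_ideal_exponent[OF s_mem] by (auto simp: koszul_exponents_def)
    show "a \<noteq> 0"
      using e s0 by metis
  qed
  have i0: "i0 a < n" "0 < Poly_Mapping.lookup a (i0 a)" "\<And>i. i < i0 a \<Longrightarrow> Poly_Mapping.lookup a i = 0"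
    if "a \<in> A" for a
  proof -
    have ne: "Poly_Mapping.keys a \<noteq> {}"
      using A_exp[OF that] by (metis keys_eq_empty)
    then have mem: "i0 a \<in> Poly_Mapping.keys a"
      unfolding i0_def by (intro Min_in) auto
    then show "i0 a < n" "0 < Poly_Mapping.lookup a (i0 a)"
      using A_exp[OF that] by (auto simp: orthant_def in_keys_iff order_le_less)
    show "Poly_Mapping.lookup a i = 0" if "i < i0 a" for i
      using that Min_le[of "Poly_Mapping.keys a" i] unfolding i0_def by (metis finite_keys in_keys_iff leD)
  qed
  define h where "h = (\<lambda>d\<in>multidegrees n (Suc p). \<Sum>a\<in>A. Poly_Mapping.single a (v a d))"
  have lookup_h: "Poly_Mapping.lookup (h d) a = v a d" if "d \<in> multidegrees n (Suc p)" for d a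
    using that A uA by (auto simp: h_def lookup_sum lookup_single when_def v_def)
  have "h d \<in> koszul_ideal n d" if d: "d \<in> multidegrees n (Suc p)" for d
    unfolding koszul_ideal_def
  proof safe
    fix a assume "a \<in> Poly_Mapping.keys (h d)"
    then have va: "v a d \<noteq> 0"
      by (simp add: in_keys_iff lookup_h[OF d])
    then have di: "d (i0 a) = 1" and "u a (d(i0 a := 0)) \<noteq> 0" and aA: "a \<in> A"
      using uA by (auto simp: v_def split: if_splits)
    then have "a \<in> koszul_exponents n (d(i0 a := 0))"
      using koszul_ideal_exponent[OF s_mem] by (auto simp: u_def split: if_splits)
    then have "a \<in> orthant n" and *: "\<forall>i<n. Poly_Mapping.lookup a i \<in> koszul_exponents1 ((d(i0 a := 0)) i)"
      unfolding koszul_exponents_def by blast+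
    \<comment> \<open>Passing from entry 0 to entry 1 at \<open>i0 a\<close> only demands a positive
      coordinate there, and \<open>i0 a\<close> lies in the support of \<open>a\<close>.\<close>
    moreover have "Poly_Mapping.lookup a i \<in> koszul_exponents1 (d i)" if "i < n" for i
      using *[rule_format, OF that] di i0(2)[OF aA]
      by (cases "i = i0 a") (auto simp: koszul_exponents1_def)
    ultimately show "a \<in> koszul_exponents n d"
      by (simp add: koszul_exponents_def)
  qed
  then have "h \<in> carrier (chains (koszul_complex n) (Suc p))"
    by (auto simp: koszul_chains_simps h_def)
  moreover have "koszul_boundary n h e = s e" if e: "e \<in> ?D" for e
  proof (rule poly_mapping_eqI)
    fix a
    have "Poly_Mapping.lookup (koszul_boundary n h e) a = koszul_boundary n (v a) e"
      by (simp add: koszul_boundary_def lookup_sum lookup_sign_mult lookup_h multidegrees_Suc[OF e]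
          del: fun_upd_apply)
    also have "\<dots> = u a e"
    proof (cases "a \<in> A")
      case False
      then have "v a = (\<lambda>_. 0)" "u a e = 0"
        using uA by (auto simp: v_def fun_eq_iff)
      then show ?thesis
        by (simp add: koszul_boundary_def)
    next
      case True
      have supp: "Poly_Mapping.lookup a i \<in> koszul_exponents1 (e i)" if "u a e \<noteq> 0" "i < n" for e i
        using that koszul_ideal_exponent[OF s_mem, of e a]
        by (auto simp: u_def koszul_exponents_def split: if_splits)
      have "koszul_boundary n (v a) e +
          (if e (i0 a) = 1 then koszul_boundary n (u a) (e(i0 a := 0)) else 0) = u a e"
        unfolding v_def
      proof (rule koszul_homotopy[OF i0(1)[OF True]])
        fix e :: "nat \<Rightarrow> nat" and i assume i: "i < i0 a" "e i \<noteq> 0"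
        show "u a e = 0"
        proof (rule ccontr)
          assume "u a e \<noteq> 0"
          from supp[OF this, of i] show False
            using i i0(1)[OF True] i0(3)[OF True i(1)] by (auto simp: koszul_exponents1_def split: if_splits)
        qed
      next
        fix e :: "nat \<Rightarrow> nat" assume i: "2 \<le> e (i0 a)"
        show "u a e = 0"
        proof (rule ccontr)
          assume "u a e \<noteq> 0"
          from supp[OF this i0(1)[OF True]] show False
            using i by (auto simp: koszul_exponents1_def split: if_splits)
        qed
      qed
      moreover have "koszul_boundary n (u a) (e(i0 a := 0)) = 0" if "e (i0 a) = 1"
      proof (cases p)
        \<comment> \<open>In degree 0 all entries of \<open>e\<close> below \<open>n\<close> vanish,
          so the entry at the apex cannot be 1.\<close>
        case 0
        then show ?thesis
          using e that i0(1)[OF True] by (simp add: multidegrees_0)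
      next
        case (Suc q)
        then have e': "e(i0 a := 0) \<in> multidegrees n q"
          using multidegrees_drop[of e n q "i0 a"] i0(1)[OF True] that e by simp
        have "koszul_boundary n (u a) (e(i0 a := 0)) =
            Poly_Mapping.lookup (koszul_boundary n s (e(i0 a := 0))) a"
          using multidegrees_Suc[OF e'] Suc
          by (simp add: koszul_boundary_def lookup_sum lookup_sign_mult u_def del: fun_upd_apply)
        then show ?thesis
          by (simp add: cycle[OF Suc e'])
      qed
      ultimately show ?thesis by (simp split: if_splits)
    qed
    finally show "Poly_Mapping.lookup (koszul_boundary n h e) a = Poly_Mapping.lookup (s e) a"
      using e by (simp add: u_def)
  qed
  then have "boundary (koszul_complex n) p h = restrict s ?D"
    unfolding koszul_complex_simps(2) by (intro restrict_ext)
  then have "boundary (koszul_complex n) p h = s"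
    using s by (simp add: koszul_chains_simps PiE_restrict)
  ultimately show ?thesis by blast
qed

section \<open>Local splitting of the chain modules\<close>

lemma finsum_koszul_module:
  assumes "\<And>x. x \<in> A \<Longrightarrow> f x \<in> koszul_ideal n d"
  shows "finsum (koszul_module n d) f A = sum f A"
proof -
  interpret K: module "real_poly_ring n" "koszul_module n d"
    by (rule module_koszul)
  show ?thesis
    using assms
  proof (induction A rule: infinite_finite_induct)
    case (infinite A)
    then show ?case
      by (simp add: K.finsum_infinite koszul_module_simps)
  next
    case empty
    then show ?case
      by (simp only: K.finsum_empty koszul_module_simps sum.empty)
  next
    case (insert x A)
    then have "f \<in> A \<rightarrow> carrier (koszul_module n d)" "f x \<in> carrier (koszul_module n d)"
      by (auto simp: koszul_module_simps)
    with insert show ?case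
      by (simp add: K.finsum_insert koszul_module_simps)
  qed
qed

lemma keys_single_mult:
  fixes p :: "'e::cancel_comm_monoid_add \<Rightarrow>\<^sub>0 'k::comm_ring_1"
  shows "Poly_Mapping.keys (Poly_Mapping.single v 1 * p) \<subseteq> (+) v ` Poly_Mapping.keys p"
  using keys_mult[of "Poly_Mapping.single v 1" p] by fastforce

text \<open>
  Finitely many chains involve finitely many exponents, whose positive coordinates are at least some
  \<open>\<epsilon> > 0\<close>. On the submodule of the chains whose component at \<open>d\<close> is divisible by the monomial with
  exponent \<open>\<epsilon>\<close> in the coordinates \<open>i\<close> with \<open>d i = 1\<close>, division by these monomials gives a dual basis.
\<close>

lemma locally_split_koszul_chains:
  "locally_split TYPE(nat \<Rightarrow> nat) (real_poly_ring n :: ((nat \<Rightarrow>\<^sub>0 real) \<Rightarrow>\<^sub>0 'k::field) ring)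
    (chains (koszul_complex n) p)"
  unfolding locally_split_def
proof (intro conjI allI impI module_koszul_chains)
  let ?R = "real_poly_ring n :: ((nat \<Rightarrow>\<^sub>0 real) \<Rightarrow>\<^sub>0 'k) ring"
  let ?M = "chains (koszul_complex n) p :: ((nat \<Rightarrow>\<^sub>0 real) \<Rightarrow>\<^sub>0 'k, (nat \<Rightarrow> nat) \<Rightarrow> (nat \<Rightarrow>\<^sub>0 real) \<Rightarrow>\<^sub>0 'k) module"
  let ?D = "multidegrees n p"
  interpret M: module ?R ?M by (rule module_koszul_chains)
  fix F assume F: "finite F" "F \<subseteq> carrier ?M"
  define A where "A = (\<Union>s\<in>F. \<Union>d\<in>?D. Poly_Mapping.keys (s d))"
  \<comment> \<open>The inserted 1 keeps the minimum defined when no positive coordinate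
    occurs.\<close>
  define E where "E = insert 1 {x \<in> (\<lambda>(a, i). Poly_Mapping.lookup a i) ` (A \<times> {..<n}). 0 < x}"
  define \<epsilon> where "\<epsilon> = Min E"
  have "finite A"
    using F(1) finite_multidegrees by (auto simp: A_def)
  then have E: "finite E" "E \<noteq> {}"
    by (auto simp: E_def)
  then have \<epsilon>: "0 < \<epsilon>"
    using Min_in[OF E] by (auto simp: \<epsilon>_def E_def)
  have \<epsilon>_le: "\<epsilon> \<le> Poly_Mapping.lookup a i"
    if "a \<in> A" "i < n" "0 < Poly_Mapping.lookup a i" for a i
    unfolding \<epsilon>_def using that by (intro Min_le[OF E(1)]) (force simp: E_def)
  define w where "w d = (\<Sum>i<n. Poly_Mapping.single i (if d i = 1 then \<epsilon> else 0))" for d :: "nat \<Rightarrow> nat"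
  have lookup_w: "Poly_Mapping.lookup (w d) i = (if i < n \<and> d i = 1 then \<epsilon> else 0)" for d i
    by (auto simp: w_def lookup_sum lookup_single when_def)
  have keys_w: "Poly_Mapping.keys (w d) \<subseteq> {..<n}" for d
    by (auto simp: in_keys_iff lookup_w split: if_splits)
  \<comment> \<open>Multidegrees with an entry of 2 or more have zero ideal and receive no basis
    element; \<open>w d\<close> would not be an exponent of that ideal.\<close>
  define D where "D = {d \<in> ?D. \<forall>i<n. d i \<le> 1}"
  have D: "finite D" "D \<subseteq> ?D"
    using finite_multidegrees by (auto simp: D_def)
  have w: "w d \<in> koszul_exponents n d" if "d \<in> D" for d
  proof -
    have "w d \<in> orthant n"
      using keys_w \<epsilon> by (auto simp: orthant_def lookup_w)
    moreover have "Poly_Mapping.lookup (w d) i \<in> koszul_exponents1 (d i)" if "i < n" for i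
      using that \<open>d \<in> D\<close> \<epsilon> by (auto simp: D_def lookup_w koszul_exponents1_def le_Suc_eq)
    ultimately show ?thesis
      by (simp add: koszul_exponents_def)
  qed
  \<comment> \<open>Division by the monomial with exponent \<open>w d\<close>. It takes place among
    polynomials with arbitrary real exponents, so the result may leave the ring.\<close>
  define \<kappa> where "\<kappa> d s = Poly_Mapping.single (- w d) 1 * s d"
    for d and s :: "(nat \<Rightarrow> nat) \<Rightarrow> (nat \<Rightarrow>\<^sub>0 real) \<Rightarrow>\<^sub>0 'k"
  define e where "e d = (\<lambda>d'\<in>?D. if d' = d then Poly_Mapping.single (w d) (1 :: 'k) else 0)" for d
  \<comment> \<open>The chains for which all these divisions stay inside the ring. Closure under the
    module operations is then inherited from the ring.\<close>
  define M0 where "M0 = {s \<in> carrier ?M. \<forall>d\<in>D. \<kappa> d s \<in> carrier ?R}"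
  have \<kappa>_add: "\<kappa> d (s \<oplus>\<^bsub>?M\<^esub> t) = \<kappa> d s + \<kappa> d t" if "d \<in> D" for d s t
    using that D(2) by (auto simp: \<kappa>_def koszul_chains_simps distrib_left)
  have \<kappa>_mult: "\<kappa> d (r \<odot>\<^bsub>?M\<^esub> s) = r * \<kappa> d s" if "d \<in> D" for d s r
    using that D(2) by (auto simp: \<kappa>_def koszul_chains_simps mult.left_commute)
  have R: "x \<oplus>\<^bsub>?R\<^esub> y = x + y" "x \<otimes>\<^bsub>?R\<^esub> y = x * y" for x y
    by (simp_all add: real_poly_ring_def monoid_algebra_def)
  have F_M0: "F \<subseteq> M0"
    unfolding M0_def
  proof safe
    fix s d assume s: "s \<in> F" and d: "d \<in> D"
    have "a - w d \<in> orthant n" if a: "a \<in> Poly_Mapping.keys (s d)" for a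
    proof -
      have "s d \<in> koszul_ideal n d"
        using s F(2) d D(2) by (auto simp: koszul_chains_simps)
      then have exp: "a \<in> koszul_exponents n d"
        using a by (auto simp: koszul_ideal_def)
      have aA: "a \<in> A"
        using a s d D(2) by (auto simp: A_def)
      have "Poly_Mapping.keys (a - w d) \<subseteq> {..<n}"
        using keys_diff[of a "w d"] keys_w[of d] exp unfolding koszul_exponents_def orthant_def by blast
      moreover have "0 \<le> Poly_Mapping.lookup (a - w d) i" for i
      proof (cases "i < n \<and> d i = 1")
        case True
        then have "Poly_Mapping.lookup a i \<in> koszul_exponents1 1"
          using exp by (auto simp: koszul_exponents_def)
        then show ?thesis
          using True \<epsilon>_le[OF aA] by (simp add: lookup_minus lookup_w koszul_exponents1_def)
      next
        case False
        then show ?thesis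
          using exp by (auto simp: koszul_exponents_def orthant_def lookup_minus lookup_w)
      qed
      ultimately show ?thesis
        by (simp add: orthant_def)
    qed
    then show "\<kappa> d s \<in> carrier ?R"
      using keys_single_mult[of "- w d" "s d"] by (fastforce simp: \<kappa>_def carrier_real_poly_ring)
  qed (use F in blast)
  have e: "e d \<in> carrier ?M" if "d \<in> D" for d
    using that w by (auto simp: e_def koszul_chains_simps koszul_ideal_def)
  have basis: "s = finsum ?M (\<lambda>d. \<kappa> d s \<odot>\<^bsub>?M\<^esub> e d) D" if s: "s \<in> M0" for s
  proof -
    have mem: "\<kappa> d s \<odot>\<^bsub>?M\<^esub> e d \<in> carrier ?M" if "d \<in> D" for d
      using s e that by (auto simp: M0_def)
    have "finsum ?M (\<lambda>d. \<kappa> d s \<odot>\<^bsub>?M\<^esub> e d) D \<in> carrier ?M"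
      using mem by (intro M.finsum_closed) auto
    moreover have "s c = finsum ?M (\<lambda>d. \<kappa> d s \<odot>\<^bsub>?M\<^esub> e d) D c" if c: "c \<in> ?D" for c
    proof -
      have sc: "s c \<in> koszul_ideal n c"
        using s c by (auto simp: M0_def koszul_chains_simps)
      have "finsum ?M (\<lambda>d. \<kappa> d s \<odot>\<^bsub>?M\<^esub> e d) D c =
          finsum (koszul_module n c) (\<lambda>d. (\<kappa> d s \<odot>\<^bsub>?M\<^esub> e d) c) D"
        using c mem D(1)
        by (intro M.finsum_hom[OF module.axioms(2)[OF module_koszul], where g = "\<lambda>s. s c"])
          (auto simp: koszul_chains_simps koszul_module_simps)
      also have "\<dots> = (\<Sum>d\<in>D. (\<kappa> d s \<odot>\<^bsub>?M\<^esub> e d) c)"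
        using c mem by (intro finsum_koszul_module) (auto simp: koszul_chains_simps(1))
      also have "\<dots> = (\<Sum>d\<in>D. if d = c then s c else 0)"
        using c by (intro sum.cong refl)
          (auto simp: koszul_chains_simps e_def \<kappa>_def mult_single mult.assoc mult.commute[of "s _"]
            simp flip: mult.assoc)
      also have "\<dots> = s c"
      proof (cases "c \<in> D")
        \<comment> \<open>A component without basis element must itself be zero: some entry of
          \<open>c\<close> is at least 2.\<close>
        case False
        then obtain i where "i < n" "2 \<le> c i"
          using c by (auto simp: D_def not_le Suc_le_eq numeral_2_eq_2)
        then have "s c = 0"
          using koszul_ideal_trivial sc by blast
        then show ?thesis by (simp cong: if_cong)
      qed (use D(1) in simp)
      finally show ?thesis ..
    qed
    moreover have "s \<in> carrier ?M"
      using s by (simp add: M0_def)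
    ultimately show ?thesis
      unfolding koszul_chains_simps(1) by (intro PiE_ext)
  qed
  have "partial_functional ?R ?M M0 (\<kappa> d)" if "d \<in> D" for d
    unfolding partial_functional_def
    using that \<kappa>_add \<kappa>_mult M.R.add.m_closed M.R.m_closed
    by (auto simp: M0_def R)
  with F_M0 D e basis show "\<exists>M0 (D :: (nat \<Rightarrow> nat) set) e \<kappa>. F \<subseteq> M0 \<and> M0 \<subseteq> carrier ?M \<and> finite D \<and>
      e ` D \<subseteq> carrier ?M \<and> (\<forall>d\<in>D. partial_functional ?R ?M M0 (\<kappa> d)) \<and>
      (\<forall>x\<in>M0. x = finsum ?M (\<lambda>d. \<kappa> d x \<odot>\<^bsub>?M\<^esub> e d) D)"
    by (intro exI[of _ M0] exI[of _ D] exI[of _ e] exI[of _ \<kappa>]) (auto simp: M0_def)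
qed

section \<open>The residue field\<close>

text \<open>A model of the residue field without cosets, on which the ring acts through constant
  terms. The augmentation used for exactness takes values here.\<close>

definition evaluate_module :: "nat \<Rightarrow> ((nat \<Rightarrow>\<^sub>0 real) \<Rightarrow>\<^sub>0 'k::field, 'k) module"
  where "evaluate_module n =
    \<lparr>carrier = UNIV, monoid.mult = undefined, one = undefined, ring.zero = 0, add = (+),
     smult = (\<lambda>r c. Poly_Mapping.lookup r 0 * c)\<rparr>"

lemma orthant_sum_zero:
  assumes "a \<in> orthant n" "b \<in> orthant n" "a + b = 0"
  shows "a = 0"
proof (rule poly_mapping_eqI)
  fix i
  have "Poly_Mapping.lookup a i + Poly_Mapping.lookup b i = 0"
    using assms(3) by (metis lookup_add lookup_zero)
  moreover have "0 \<le> Poly_Mapping.lookup a i" "0 \<le> Poly_Mapping.lookup b i"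
    using assms(1,2) by (simp_all add: orthant_def)
  ultimately show "Poly_Mapping.lookup a i = Poly_Mapping.lookup 0 i"
    by simp
qed

text \<open>With negative exponents the terms of \<open>r\<close> and \<open>p\<close> could cancel
  to a constant; in the orthant two exponents add up to zero only if both are zero. So once the
  constant term of \<open>r\<close> is split off, the rest contributes nothing at exponent
  0.\<close>

lemma lookup_mult_0:
  fixes r p :: "(nat \<Rightarrow>\<^sub>0 real) \<Rightarrow>\<^sub>0 'k::field"
  assumes r: "Poly_Mapping.keys r \<subseteq> orthant n" and p: "Poly_Mapping.keys p \<subseteq> orthant n"
  shows "Poly_Mapping.lookup (r * p) 0 = Poly_Mapping.lookup r 0 * Poly_Mapping.lookup p 0"
proof -
  define c where "c = Poly_Mapping.lookup r 0"
  define r' where "r' = r - Poly_Mapping.single 0 c"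
  have "0 \<notin> Poly_Mapping.keys r'"
    by (simp add: r'_def c_def in_keys_iff lookup_minus)
  moreover have r': "Poly_Mapping.keys r' \<subseteq> orthant n"
    using r keys_diff[of r "Poly_Mapping.single 0 c"] orthant_zero[of n]
    by (auto simp: r'_def split: if_splits)
  moreover have "\<exists>a\<in>Poly_Mapping.keys r'. \<exists>b\<in>Poly_Mapping.keys p. a + b = 0"
    if "0 \<in> Poly_Mapping.keys (r' * p)"
    using subsetD[OF keys_mult that] by auto
  ultimately have "0 \<notin> Poly_Mapping.keys (r' * p)"
    using orthant_sum_zero p by (metis subsetD)
  then have "Poly_Mapping.lookup (r' * p) 0 = 0"
    by (simp add: in_keys_iff)
  moreover have "r * p = Poly_Mapping.map ((*) c) p + r' * p"
    by (simp add: r'_def mult_map_scale_conv_mult algebra_simps)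
  ultimately show ?thesis
    by (simp add: lookup_add lookup_map_scale c_def)
qed

lemma module_evaluate: "module (real_poly_ring n) (evaluate_module n :: (_, 'k::field) module)"
proof (rule moduleI)
  show "cring (real_poly_ring n :: ((nat \<Rightarrow>\<^sub>0 real) \<Rightarrow>\<^sub>0 'k) ring)"
    by (rule cring_real_poly_ring)
  show "abelian_group (evaluate_module n :: (_, 'k) module)"
    by (rule abelian_groupI)
      (auto simp: evaluate_module_def add.assoc add.commute intro!: exI[of _ "- x" for x])
  fix a b :: "(nat \<Rightarrow>\<^sub>0 real) \<Rightarrow>\<^sub>0 'k" and x :: 'k
  assume "a \<in> carrier (real_poly_ring n)" "b \<in> carrier (real_poly_ring n)"
  then show "(a \<otimes>\<^bsub>real_poly_ring n\<^esub> b) \<odot>\<^bsub>evaluate_module n\<^esub> x =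
      a \<odot>\<^bsub>evaluate_module n\<^esub> (b \<odot>\<^bsub>evaluate_module n\<^esub> x)"
    using lookup_mult_0[of a n b]
    by (simp add: evaluate_module_def real_poly_ring_def monoid_algebra_def mult.assoc)
qed (auto simp: evaluate_module_def real_poly_ring_def monoid_algebra_def lookup_add distrib_left distrib_right)

lemma graded_max_ideal_eq:
  "graded_max_ideal n = {p. Poly_Mapping.keys p \<subseteq> orthant n \<and> Poly_Mapping.lookup p 0 = 0}"
proof -
  have "a \<noteq> 0 \<longleftrightarrow> \<not> (\<exists>b\<in>orthant n. a + b = 0)" if "a \<in> orthant n" for a
    using orthant_sum_zero[OF that] orthant_zero[of n] by (cases "a = 0") auto
  then have "{a \<in> orthant n. \<not> (\<exists>b\<in>orthant n. a + b = 0)} = orthant n - {0}"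
    by blast
  then show ?thesis
    unfolding graded_max_ideal_def nonunit_ideal_def
    by (auto simp only: subset_Diff_insert Diff_empty not_in_keys_iff_lookup_eq_zero)
qed

lemma residue_field_iso:
  obtains h where
    "h \<in> mod_hom (real_poly_ring n) (evaluate_module n) (residue_field_module n :: (_, ((nat \<Rightarrow>\<^sub>0 real) \<Rightarrow>\<^sub>0 'k::field) set) module)"
    "bij_betw h (carrier (evaluate_module n)) (carrier (residue_field_module n :: (_, ((nat \<Rightarrow>\<^sub>0 real) \<Rightarrow>\<^sub>0 'k::field) set) module))"
    "module (real_poly_ring n) (residue_field_module n :: (_, ((nat \<Rightarrow>\<^sub>0 real) \<Rightarrow>\<^sub>0 'k) set) module)"
proof -
  let ?R = "real_poly_ring n :: ((nat \<Rightarrow>\<^sub>0 real) \<Rightarrow>\<^sub>0 'k) ring"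
  let ?M = "ideal_module ?R (carrier ?R)"
  let ?T = "\<lambda>p :: (nat \<Rightarrow>\<^sub>0 real) \<Rightarrow>\<^sub>0 'k. Poly_Mapping.lookup p 0"
  interpret R: cring ?R by (rule cring_real_poly_ring)
  have M: "abelian_group ?M"
    by (rule abelian_group_keys_subset[of _ "orthant n"])
      (auto simp: ideal_module_def real_poly_ring_def monoid_algebra_def)
  have smult: "r \<odot>\<^bsub>?M\<^esub> m \<in> carrier ?M" if "r \<in> carrier ?R" "m \<in> carrier ?M" for r m
    using R.m_closed[of r m] that by (simp add: ideal_module_def)
  have T: "?T \<in> mod_hom ?R ?M (evaluate_module n)"
    by (rule mod_homI)
      (auto simp: ideal_module_def evaluate_module_def real_poly_ring_def monoid_algebra_def lookup_add
        lookup_mult_0)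
  have surj: "?T ` carrier ?M = carrier (evaluate_module n)"
  proof -
    have "c \<in> ?T ` carrier ?M" for c
      by (rule image_eqI[of _ _ "Poly_Mapping.single 0 c"])
        (auto simp: ideal_module_def carrier_real_poly_ring orthant_zero)
    then show ?thesis
      by (auto simp: evaluate_module_def)
  qed
  have ker: "graded_max_ideal n = {m \<in> carrier ?M. ?T m = \<zero>\<^bsub>evaluate_module n\<^esub>}"
    by (auto simp: graded_max_ideal_eq evaluate_module_def ideal_module_def carrier_real_poly_ring)
  note iso = quot_module_iso[OF module_evaluate M _ T surj ker, folded residue_field_module_def]
  show thesis
    by (rule that[OF iso(1) iso(2) iso(4)]; rule smult)
qed

text \<open>\<open>koszul_exact\<close> turns cycles into boundaries in every degree. Its condition
  on constant terms is the kernel of the augmentation in degree 0 and holds automatically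
  above.\<close>

lemma koszul_resolution:
  "is_resolution (real_poly_ring n :: ((nat \<Rightarrow>\<^sub>0 real) \<Rightarrow>\<^sub>0 'k::field) ring)
    (koszul_complex n) (evaluate_module n)"
proof -
  let ?R = "real_poly_ring n :: ((nat \<Rightarrow>\<^sub>0 real) \<Rightarrow>\<^sub>0 'k) ring"
  let ?C = "koszul_complex n :: ((nat \<Rightarrow>\<^sub>0 real) \<Rightarrow>\<^sub>0 'k, (nat \<Rightarrow> nat) \<Rightarrow> (nat \<Rightarrow>\<^sub>0 real) \<Rightarrow>\<^sub>0 'k) chain_complex"
  have cplx: "is_chain_complex ?R ?C"
    unfolding is_chain_complex_def
    using module_koszul_chains koszul_boundary_mod_hom koszul_boundary_boundary by blast
  let ?d0 = "\<lambda>i\<in>{..<n}. 0 :: nat"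
  \<comment> \<open>Degree 0 has the single multidegree \<open>?d0\<close>, whose ideal is the whole
    ring; the augmentation takes the constant term there.\<close>
  let ?\<epsilon> = "\<lambda>s :: (nat \<Rightarrow> nat) \<Rightarrow> (nat \<Rightarrow>\<^sub>0 real) \<Rightarrow>\<^sub>0 'k. Poly_Mapping.lookup (s ?d0) 0"
  have d0: "?d0 \<in> multidegrees n 0"
    by (simp add: multidegrees_0)
  have s_d0: "Poly_Mapping.keys (s ?d0) \<subseteq> orthant n" if "s \<in> carrier (chains ?C 0)" for s
    using PiE_mem[OF that[unfolded koszul_chains_simps] d0]
    by (auto simp: koszul_ideal_def koszul_exponents_def simp del: restrict_apply)
  have \<epsilon>: "?\<epsilon> \<in> mod_hom ?R (chains ?C 0) (evaluate_module n)"
    by (rule mod_homI)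
      (use d0 s_d0 in \<open>auto simp: koszul_chains_simps(2-) evaluate_module_def lookup_add lookup_mult_0
        carrier_real_poly_ring simp del: restrict_apply' cong: restrict_cong\<close>)
  have surj: "?\<epsilon> ` carrier (chains ?C 0) = carrier (evaluate_module n)"
  proof -
    have "c \<in> ?\<epsilon> ` carrier (chains ?C 0)" for c
    proof (rule image_eqI)
      let ?s = "\<lambda>d\<in>multidegrees n 0. Poly_Mapping.single (0 :: nat \<Rightarrow>\<^sub>0 real) c"
      show "c = ?\<epsilon> ?s"
        using d0 by (simp add: restrict_apply'[OF d0])
      show "?s \<in> carrier (chains ?C 0)"
        by (auto simp: koszul_chains_simps multidegrees_0 koszul_ideal_def koszul_exponents_def orthant_zero
            koszul_exponents1_def)
    qed
    then show ?thesis
      by (auto simp: evaluate_module_def)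
  qed
  have ker0: "a_kernel (chains ?C 0) (evaluate_module n) ?\<epsilon> = boundary ?C 0 ` carrier (chains ?C 1)"
  proof (intro equalityI subsetI)
    fix s assume "s \<in> a_kernel (chains ?C 0) (evaluate_module n) ?\<epsilon>"
    then have s: "s \<in> carrier (chains ?C 0)" "?\<epsilon> s = 0"
      by (auto simp: a_kernel_def' evaluate_module_def simp del: restrict_apply)
    have "\<exists>h\<in>carrier (chains ?C (Suc 0)). boundary ?C 0 h = s"
      by (rule koszul_exact[OF s(1)]) (use s(2) in \<open>simp_all add: multidegrees_0 del: restrict_apply\<close>)
    then show "s \<in> boundary ?C 0 ` carrier (chains ?C 1)"
      by auto
  next
    fix s assume "s \<in> boundary ?C 0 ` carrier (chains ?C 1)"
    then obtain h where h: "h \<in> carrier (chains ?C (Suc 0))" "s = boundary ?C 0 h"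
      by auto
    \<comment> \<open>Every component that enters the boundary has one raised entry, hence no
      constant term.\<close>
    have "Poly_Mapping.lookup (h (?d0(i := Suc (?d0 i)))) 0 = 0" if "i < n" for i
      using h(1) multidegrees_Suc[OF d0 that]
      by (intro koszul_ideal_lookup_0[OF that, of "?d0(i := Suc (?d0 i))"])
        (auto simp: koszul_chains_simps simp del: fun_upd_apply restrict_apply simp: fun_upd_same)
    then have "?\<epsilon> s = 0"
      unfolding h(2) koszul_complex_simps(2) restrict_apply'[OF d0]
      by (simp add: koszul_boundary_def lookup_sum lookup_sign_mult del: fun_upd_apply restrict_apply)
    moreover have "s \<in> carrier (chains ?C 0)"
      using h mod_homD(1)[OF koszul_boundary_mod_hom] by blast
    ultimately show "s \<in> a_kernel (chains ?C 0) (evaluate_module n) ?\<epsilon>"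
      by (simp add: a_kernel_def' evaluate_module_def del: restrict_apply)
  qed
  have ker: "a_kernel (chains ?C (Suc p)) (chains ?C p) (boundary ?C p) =
      boundary ?C (Suc p) ` carrier (chains ?C (Suc (Suc p)))" for p
  proof (intro equalityI subsetI)
    fix s assume "s \<in> a_kernel (chains ?C (Suc p)) (chains ?C p) (boundary ?C p)"
    then have s: "s \<in> carrier (chains ?C (Suc p))" and bs: "boundary ?C p s = \<zero>\<^bsub>chains ?C p\<^esub>"
      by (auto simp: a_kernel_def')
    have "\<exists>h\<in>carrier (chains ?C (Suc (Suc p))). boundary ?C (Suc p) h = s"
    proof (rule koszul_exact[OF s])
      fix e assume e: "e \<in> multidegrees n (Suc p)"
      then have "(\<Sum>i<n. e i) \<noteq> 0"
        by (simp add: multidegrees_def)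
      \<comment> \<open>A positive total degree forces a nonzero entry, and that removes the
        constant term.\<close>
      then obtain i where "i < n" "e i \<noteq> 0"
        by (auto simp: sum_eq_0_iff)
      moreover have "s e \<in> koszul_ideal n e"
        using s e by (auto simp: koszul_chains_simps)
      ultimately show "Poly_Mapping.lookup (s e) 0 = 0"
        by (rule koszul_ideal_lookup_0)
    next
      fix q e assume "Suc p = Suc q" "e \<in> multidegrees n q"
      then have e: "e \<in> multidegrees n p" by simp
      show "koszul_boundary n s e = 0"
        using fun_cong[OF bs, of e] e by (simp add: koszul_complex_simps(2) koszul_chains_simps)
    qed
    then show "s \<in> boundary ?C (Suc p) ` carrier (chains ?C (Suc (Suc p)))"
      by auto
  next
    fix s assume "s \<in> boundary ?C (Suc p) ` carrier (chains ?C (Suc (Suc p)))"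
    then show "s \<in> a_kernel (chains ?C (Suc p)) (chains ?C p) (boundary ?C p)"
      using mod_homD(1)[OF koszul_boundary_mod_hom] koszul_boundary_boundary
      unfolding a_kernel_def' by blast
  qed
  show ?thesis
    unfolding is_resolution_def
    using cplx module_evaluate[of n] \<epsilon> surj ker0 ker by blast
qed

section \<open>Comparison with the open Koszul complex\<close>

lemma open_koszul_simps:
  "chains (open_koszul n) p =
    finite_direct_sum (multidegrees n p) (\<lambda>d. field_tensor n (\<lambda>i. chains open_koszul1 (d i)))"
  "boundary (open_koszul n) p s = (\<lambda>e\<in>multidegrees n p.
     \<Oplus>\<^bsub>field_tensor n (\<lambda>j. chains open_koszul1 (e j))\<^esub>i\<in>{..<n}.
       (-1) ^ (\<Sum>j<i. e j) \<odot>\<^bsub>field_tensor n (\<lambda>j. chains open_koszul1 (e j))\<^esub>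
         field_tensor_map n (\<lambda>j. chains open_koszul1 (e j))
           (\<lambda>j. if j = i then boundary open_koszul1 (e i) else id) (s (e(i := Suc (e i)))))"
  by (simp_all add: open_koszul_def tensor_complex_def)

text \<open>
  The boundary maps of the factors are inclusions, so on representatives the map between the tensor
  products is the identity.
\<close>

lemma field_tensor_map_coset:
  fixes p :: "(nat \<Rightarrow>\<^sub>0 real) \<Rightarrow>\<^sub>0 'k::field"
  assumes i: "i < n" and p: "p \<in> koszul_ideal n (e(i := Suc (e i)))"
  shows "field_tensor_map n (\<lambda>j. chains open_koszul1 (e j))
    (\<lambda>j. if j = i then boundary open_koszul1 (e i) else id) (tensor_coset n (e(i := Suc (e i))) p) =
    tensor_coset n e p"
proof -
  let ?e = "e(i := Suc (e i))"
  let ?f = "\<lambda>j. if j = i then boundary open_koszul1 (e i) else id :: (real \<Rightarrow>\<^sub>0 'k) \<Rightarrow> _"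
  have sub: "koszul_exponents1 (?e j) \<subseteq> koszul_exponents1 (e j)" for j
    by (auto simp: koszul_exponents1_def split: if_splits)
  have tuple: "(\<lambda>j\<in>{..<n}. ?f j (m j)) = m"
    if m: "m \<in> (\<Pi>\<^sub>E j\<in>{..<n}. {p. Poly_Mapping.keys p \<subseteq> koszul_exponents1 (?e j)})" for m
  proof
    fix j
    have "boundary open_koszul1 (e i) (m i) = m i"
    \<comment> \<open>Only the boundary from degree 1 to degree 0 is an inclusion; the higher ones
      are zero maps. There the entry \<open>m i\<close> is zero as well, so it is still
      fixed.\<close>
    proof (cases "e i = 0")
      case True
      then show ?thesis by (simp add: open_koszul1_def)
    next
      case False
      have "Poly_Mapping.keys (m i) \<subseteq> koszul_exponents1 (?e i)"
        using PiE_mem[OF m, of i] i by simp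
      then have "m i = 0"
        using False by (auto simp: koszul_exponents1_def intro!: poly_mapping_eqI simp: in_keys_iff)
      then show ?thesis
        using False by (simp add: open_koszul1_def)
    qed
    then show "(\<lambda>j\<in>{..<n}. ?f j (m j)) j = m j"
      using PiE_arb[OF m, of j] by auto
  qed
  have t: "koszul_relations n e +>\<^bsub>koszul_tuples n e\<^esub>
      (\<Sum>m\<in>Poly_Mapping.keys t. Poly_Mapping.single (\<lambda>j\<in>{..<n}. ?f j (m j)) (Poly_Mapping.lookup t m)) =
      tensor_coset n e p"
    if "t \<in> tensor_coset n ?e p" for t
  proof -
    have keys: "Poly_Mapping.keys t \<subseteq> (\<Pi>\<^sub>E j\<in>{..<n}. {p. Poly_Mapping.keys p \<subseteq> koszul_exponents1 (?e j)})"
      and ev: "tensor_eval n t = p"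
      using that unfolding tensor_coset_def carrier_koszul_tuples by blast+
    have "(\<Sum>m\<in>Poly_Mapping.keys t. Poly_Mapping.single (\<lambda>j\<in>{..<n}. ?f j (m j)) (Poly_Mapping.lookup t m)) =
        (\<Sum>m\<in>Poly_Mapping.keys t. Poly_Mapping.single m (Poly_Mapping.lookup t m))"
    proof (intro sum.cong refl)
      fix m assume "m \<in> Poly_Mapping.keys t"
      with keys have "(\<lambda>j\<in>{..<n}. ?f j (m j)) = m"
        by (intro tuple) blast
      then show "Poly_Mapping.single (\<lambda>j\<in>{..<n}. ?f j (m j)) (Poly_Mapping.lookup t m) =
          Poly_Mapping.single m (Poly_Mapping.lookup t m)"
        by (simp only:)
    qed
    also have "\<dots> = t"
      by (rule poly_mapping_eq_sum_single[symmetric])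
    finally have eq: "(\<Sum>m\<in>Poly_Mapping.keys t.
        Poly_Mapping.single (\<lambda>j\<in>{..<n}. ?f j (m j)) (Poly_Mapping.lookup t m)) = t" .
    have "(\<Pi>\<^sub>E j\<in>{..<n}. {p :: real \<Rightarrow>\<^sub>0 'k. Poly_Mapping.keys p \<subseteq> koszul_exponents1 (?e j)}) \<subseteq>
        (\<Pi>\<^sub>E j\<in>{..<n}. {p. Poly_Mapping.keys p \<subseteq> koszul_exponents1 (e j)})"
      using sub by (intro PiE_mono) blast
    then have "t \<in> carrier (koszul_tuples n e)"
      using keys unfolding carrier_koszul_tuples by blast
    then show ?thesis
      unfolding eq by (simp only: koszul_relations_coset ev)
  qed
  \<comment> \<open>The induced map is a union over representatives, so at least one is
    needed.\<close>
  have "tensor_expand n p \<in> tensor_coset n ?e p"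
    unfolding tensor_coset_def using tensor_expand_carrier[OF p] tensor_eval_expand[OF p] by blast
  then show ?thesis
    unfolding field_tensor_map_def using t by blast
qed

definition koszul_comparison ::
    "nat \<Rightarrow> nat \<Rightarrow> ((nat \<Rightarrow> nat) \<Rightarrow> (nat \<Rightarrow>\<^sub>0 real) \<Rightarrow>\<^sub>0 'k::field) \<Rightarrow>
      (nat \<Rightarrow> nat) \<Rightarrow> ((nat \<Rightarrow> (real \<Rightarrow>\<^sub>0 'k)) \<Rightarrow>\<^sub>0 'k) set"
  where "koszul_comparison n p s = (\<lambda>d\<in>multidegrees n p. tensor_coset n d (s d))"

lemma koszul_comparison_iso:
  shows "koszul_comparison n p \<in>
      mod_hom (real_poly_ring n) (chains (koszul_complex n) p) (chains (open_koszul n) p)"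
    and "bij_betw (koszul_comparison n p)
      (carrier (chains (koszul_complex n) p)) (carrier (chains (open_koszul n) p))"
  unfolding koszul_comparison_def[abs_def] koszul_complex_simps open_koszul_simps
  by (rule finite_direct_sum_iso[where g = "tensor_coset n"] module_koszul tensor_coset_iso(1,2))+

lemma module_open_koszul: "module (real_poly_ring n) (chains (open_koszul n) p)"
  unfolding open_koszul_simps
  by (intro module_finite_direct_sum cring_real_poly_ring tensor_coset_iso(4))

lemma sign_closed: "(- 1) ^ k \<in> carrier (real_poly_ring n)"
proof -
  interpret cring "real_poly_ring n" by (rule cring_real_poly_ring)
  show ?thesis
    by (cases "even k") (auto simp: carrier_real_poly_ring orthant_zero)
qed

text \<open>\<open>tensor_coset n e\<close> is linear and turns inclusions of ideals into the
  induced maps of tensor products, so it passes through signs and sums. The sum on the tensor side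
  is a \<open>finsum\<close> of cosets and is first pulled back to a \<open>finsum\<close> in the
  ideal, where it is an ordinary sum.\<close>

lemma koszul_comparison_boundary:
  fixes s :: "(nat \<Rightarrow> nat) \<Rightarrow> (nat \<Rightarrow>\<^sub>0 real) \<Rightarrow>\<^sub>0 'k::field"
  assumes s: "s \<in> carrier (chains (koszul_complex n) (Suc p))"
  shows "boundary (open_koszul n) p (koszul_comparison n (Suc p) s) =
    koszul_comparison n p (boundary (koszul_complex n) p s)"
  unfolding open_koszul_simps(2) koszul_complex_simps(2) koszul_comparison_def[of n p]
proof (rule restrict_ext)
  fix e assume e: "e \<in> multidegrees n p"
  let ?N = "field_tensor n (\<lambda>j. chains (open_koszul1 :: (real \<Rightarrow>\<^sub>0 'k, real \<Rightarrow>\<^sub>0 'k) chain_complex) (e j))"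
  let ?K = "koszul_module n e :: ((nat \<Rightarrow>\<^sub>0 real) \<Rightarrow>\<^sub>0 'k, (nat \<Rightarrow>\<^sub>0 real) \<Rightarrow>\<^sub>0 'k) module"
  interpret K: module "real_poly_ring n" ?K by (rule module_koszul)
  interpret N: module "real_poly_ring n" ?N by (rule tensor_coset_iso(4))
  note iso = mod_homD[OF tensor_coset_iso(1)[of n e]]
  let ?sgn = "\<lambda>i. (- 1) ^ (\<Sum>j<i. e j) :: (nat \<Rightarrow>\<^sub>0 real) \<Rightarrow>\<^sub>0 'k"
  have mem': "s (e(i := Suc (e i))) \<in> koszul_ideal n (e(i := Suc (e i)))" if "i < n" for i
    using s multidegrees_Suc[OF e that] unfolding koszul_chains_simps by (rule PiE_mem)
  \<comment> \<open>An element of the smaller ideal is read in the larger one; this inclusion is the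
    boundary component.\<close>
  then have mem: "s (e(i := Suc (e i))) \<in> koszul_ideal n e" if "i < n" for i
    using that koszul_ideal_Suc by blast
  have sgn_mem: "?sgn i * s (e(i := Suc (e i))) \<in> koszul_ideal n e" if "i < n" for i
    using mem[OF that] by (rule koszul_ideal_closed(3))
  have summand: "?sgn i \<odot>\<^bsub>?N\<^esub> field_tensor_map n (\<lambda>j. chains open_koszul1 (e j))
        (\<lambda>j. if j = i then boundary open_koszul1 (e i) else id)
        (koszul_comparison n (Suc p) s (e(i := Suc (e i)))) =
      tensor_coset n e (?sgn i * s (e(i := Suc (e i))))" if i: "i < n" for i
  proof -
    have "koszul_comparison n (Suc p) s (e(i := Suc (e i))) =
        tensor_coset n (e(i := Suc (e i))) (s (e(i := Suc (e i))))"
      using multidegrees_Suc[OF e i] by (simp add: koszul_comparison_def)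
    then show ?thesis
      using iso(3)[OF sign_closed, of "s (e(i := Suc (e i)))"] mem[OF i]
      by (simp only: field_tensor_map_coset[OF i mem'[OF i]] koszul_module_simps)
  qed
  have "(\<Oplus>\<^bsub>?N\<^esub>i\<in>{..<n}. ?sgn i \<odot>\<^bsub>?N\<^esub> field_tensor_map n (\<lambda>j. chains open_koszul1 (e j))
        (\<lambda>j. if j = i then boundary open_koszul1 (e i) else id)
        (koszul_comparison n (Suc p) s (e(i := Suc (e i))))) =
      (\<Oplus>\<^bsub>?N\<^esub>i\<in>{..<n}. tensor_coset n e (?sgn i * s (e(i := Suc (e i)))))"
  proof (rule N.finsum_cong')
    show "(\<lambda>i. tensor_coset n e (?sgn i * s (e(i := Suc (e i))))) \<in> {..<n} \<rightarrow> carrier ?N"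
      using iso(1) sgn_mem by (auto simp: koszul_module_simps)
  qed (use summand in auto)
  also have "\<dots> = tensor_coset n e (\<Oplus>\<^bsub>?K\<^esub>i\<in>{..<n}. ?sgn i * s (e(i := Suc (e i))))"
    using sgn_mem
    by (intro K.finsum_hom[OF N.abelian_group_axioms iso(1,2), symmetric]) (auto simp: koszul_module_simps)
  also have "(\<Oplus>\<^bsub>?K\<^esub>i\<in>{..<n}. ?sgn i * s (e(i := Suc (e i)))) = koszul_boundary n s e"
    using sgn_mem by (subst finsum_koszul_module) (auto simp: koszul_boundary_def)
  finally show "(\<Oplus>\<^bsub>?N\<^esub>i\<in>{..<n}. ?sgn i \<odot>\<^bsub>?N\<^esub> field_tensor_map n (\<lambda>j. chains open_koszul1 (e j))
        (\<lambda>j. if j = i then boundary open_koszul1 (e i) else id)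
        (koszul_comparison n (Suc p) s (e(i := Suc (e i))))) =
      tensor_coset n e (restrict (koszul_boundary n s) (multidegrees n p) e)"
    unfolding restrict_apply'[OF e] .
qed

theorem proposition2p4:
  fixes n :: nat
  assumes "n \<ge> 1"
  shows "is_flat_resolution TYPE('s) TYPE('t)
    (real_poly_ring n :: ((nat \<Rightarrow>\<^sub>0 real) \<Rightarrow>\<^sub>0 'k::field) ring)
    (open_koszul n) (residue_field_module n)"
proof -
  obtain h where "h \<in> mod_hom (real_poly_ring n) (evaluate_module n)
      (residue_field_module n :: (_, ((nat \<Rightarrow>\<^sub>0 real) \<Rightarrow>\<^sub>0 'k) set) module)"
    "bij_betw h (carrier (evaluate_module n))
      (carrier (residue_field_module n :: (_, ((nat \<Rightarrow>\<^sub>0 real) \<Rightarrow>\<^sub>0 'k) set) module))"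
    "module (real_poly_ring n) (residue_field_module n :: (_, ((nat \<Rightarrow>\<^sub>0 real) \<Rightarrow>\<^sub>0 'k) set) module)"
    by (rule residue_field_iso)
  then have "is_resolution (real_poly_ring n :: ((nat \<Rightarrow>\<^sub>0 real) \<Rightarrow>\<^sub>0 'k) ring)
      (open_koszul n) (residue_field_module n)"
    by (intro resolution_iso[where g = "koszul_comparison n", OF koszul_resolution]
        module_open_koszul koszul_comparison_iso koszul_comparison_boundary)
  moreover have "flat_module TYPE('s) TYPE('t) (real_poly_ring n :: ((nat \<Rightarrow>\<^sub>0 real) \<Rightarrow>\<^sub>0 'k) ring)
      (chains (open_koszul n) p)" for p
    by (rule locally_split_imp_flat[OF locally_split_iso[OF locally_split_koszul_chains
          module_open_koszul koszul_comparison_iso]])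
  ultimately show ?thesis
    by (simp add: is_flat_resolution_def)
qed

end
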